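(* Let $A:\hat\Sigma_{\mathbf M}\to\mathbb R$ be Lipschitz continuous. For $\beta>0$ let $\phi^+_\beta$ be the effective potential for $\beta A$, normalized by $\phi^+_\beta(\mathbf y^0)=0$ at a fixed point $\mathbf y^0$, and let $\lambda^+_\beta$ be the effective constant for $\beta A$. Assume that $\phi^+_{\beta_n}/\beta_n\to V$ uniformly for some sequence $\beta_n\to\infty$. Then there exists a family $\{U_{\mathbf y}\}_{\mathbf y\in\Sigma^*_{\mathbf M}}$ such that each $U_{\mathbf y}\in\mathcal H$ is a sub-action with respect to $A(\mathbf y,\cdot)+V-V(\mathbf y)$, the function $(\mathbf y,\mathbf x)\mapsto A(\mathbf y,\mathbf x)+U_{\mathbf y}(\mathbf x)-U_{\mathbf y}(\sigma(\mathbf x))$ is bounded and Borel measurable on $\hat\Sigma_{\mathbf M}$, and $$\lim_{\beta\to\infty}\frac{\lambda^+_\beta}{\beta}=\sup_{\hat\eta:\ \pi_*(\hat\eta)=(\pi^* )_*(\hat\eta)}\ \iint_{\hat\Sigma_{\mathbf M}}\big[A(\mathbf y,\mathbf x)+U_{\mathbf y}(\mathbf x)-U_{\mathbf y}(\sigma(\mathbf x))\big]\,d\hat\eta(\mathbf y,\mathbf x),$$ where the supremum is over Borel probability measures $\hat\eta$ on $\hat\Sigma_{\mathbf M}$ with $\pi_*(\hat\eta)=(\pi^* )_*(\hat\eta)$.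
   Context: Let $\mathbf M:\{1,\dots,r\}\times\{1,\dots,r\}\to\{0,1\}$ be an irreducible symmetric transition matrix. Let $\Sigma_{\mathbf M}=\{(x_0,x_1,\dots)\in\{1,\dots,r\}^{\mathbb Z_+}:\mathbf M(x_j,x_{j+1})=1\ \forall j\}$, with left shift $\sigma(x_0,x_1,x_2,\dots)=(x_1,x_2,\dots)$, and let $\Sigma^*_{\mathbf M}$ be the dual subshift of sequences $(\dots,x_1,x_0)$ with $\mathbf M(x_{j+1},x_j)=1$ for all $j$. As $\mathbf M$ is symmetric, $\mathbf x=(x_0,x_1,\dots)\mapsto\mathbf x^*=(\dots,x_1,x_0)$ is a bijection $\Sigma_{\mathbf M}\to\Sigma^*_{\mathbf M}$, by which the two spaces, and functions and measures on them, are identified (points $\mathbf y^*$ are written simply $\mathbf y$). Fix $\Lambda\in(0,1)$; for $\mathbf x\neq\mathbf y$ put $d(\mathbf x,\mathbf y)=\Lambda^k$ with $k=\min\{j:x_j\neq y_j\}$ (and $d(\mathbf x,\mathbf x)=0$). $\mathcal H$ is the space of Lipschitz continuous real functions on $\Sigma_{\mathbf M}\simeq\Sigma^*_{\mathbf M}$. Let $\hat\Sigma_{\mathbf M}=\{(\mathbf y,\mathbf x)\in\Sigma^*_{\mathbf M}\times\Sigma_{\mathbf M}:\mathbf M(y_0,x_0)=1\}$ with the product (max) metric, and let $\pi:\hat\Sigma_{\mathbf M}\to\Sigma_{\mathbf M}$, $\pi(\mathbf y,\mathbf x)=\mathbf x$, and $\pi^*:\hat\Sigma_{\mathbf M}\to\Sigma^*_{\mathbf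 M}$, $\pi^*(\mathbf y,\mathbf x)=\mathbf y$, be the canonical projections; the condition $\pi_*(\hat\eta)=(\pi^* )_*(\hat\eta)$ is understood via $\Sigma_{\mathbf M}\simeq\Sigma^*_{\mathbf M}$. In every expression where $\mathbf y$ is fixed and $\mathbf x$ ranges over all of $\Sigma_{\mathbf M}$, $A(\mathbf y,\mathbf x)$ means $A(\mathbf y,\mathbf x)\mathbf M(y_0,x_0)$, i.e. $A$ is extended by $0$. Let $\mathcal M_\sigma$ be the set of $\sigma$-invariant Borel probability measures on $\Sigma_{\mathbf M}$ and $h_\mu(\sigma)$ the Kolmogorov–Sinai entropy. For $\beta>0$ and $\phi\in\mathcal H$ put $$\mathcal G^+_{\beta A}(\phi)(\mathbf y)=\sup_{\mu\in\mathcal M_\sigma}\Big[\int_{\Sigma_{\mathbf M}}\big(\beta A(\mathbf y,\mathbf x)+\phi(\mathbf x)\big)\,d\mu(\mathbf x)+h_\mu(\sigma)\Big].$$ There is a function $\phi^+_\beta\in\mathcal H$, unique up to an additive constant, and a unique $\lambda^+_\beta\in\mathbb R$ with $\mathcal G^+_{\beta A}(\phi^+_\beta)=\phi^+_\beta+\lambda^+_\beta$; $\phi^+_\beta$ is the (forward) effective potential and $\lambda^+_\beta$ the effective constant for $\beta A$. The limit $\lim_{\beta\to\infty}\lambda^+_\beta/\beta$ exists. A sub-action with respect to $f\in\mathcal H$ is a function $U\in\mathcal H$ such that $f(\mathbf x)+U(\mathbf x)-U(\sigma(\mathbf x))\le\max_{\mu\in\mathcal M_\sigma}\int f\,d\mu$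 for all $\mathbf x\in\Sigma_{\mathbf M}$. (For $f=A(\mathbf y,\cdot)+V-V(\mathbf y)$, the right-hand side equals $\lim_{\beta\to\infty}\lambda^+_\beta/\beta$ for every $\mathbf y$.) *)

theory Defs
  imports "HOL-Probability.Probability"
begin

section \<open>Transition matrices and subshifts\<close>

text \<open>The alphabet is \<open>{1..r}\<close>; only the entries of a matrix with both indices in \<open>{1..r}\<close>
  are relevant.\<close>

definition transition_matrix :: "nat \<Rightarrow> (nat \<Rightarrow> nat \<Rightarrow> nat) \<Rightarrow> bool" where
  "transition_matrix r M \<longleftrightarrow> (\<forall>i\<in>{1..r}. \<forall>j\<in>{1..r}. M i j \<in> {0, 1})"

definition symmetric_matrix :: "nat \<Rightarrow> (nat \<Rightarrow> nat \<Rightarrow> nat) \<Rightarrow> bool" where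
  "symmetric_matrix r M \<longleftrightarrow> (\<forall>i\<in>{1..r}. \<forall>j\<in>{1..r}. M i j = M j i)"

fun matrix_power :: "nat \<Rightarrow> (nat \<Rightarrow> nat \<Rightarrow> nat) \<Rightarrow> nat \<Rightarrow> nat \<Rightarrow> nat \<Rightarrow> nat" where
  "matrix_power r M 0 i j = (if i = j then 1 else 0)"
| "matrix_power r M (Suc n) i j = (\<Sum>k=1..r. M i k * matrix_power r M n k j)"

definition irreducible_matrix :: "nat \<Rightarrow> (nat \<Rightarrow> nat \<Rightarrow> nat) \<Rightarrow> bool" where
  "irreducible_matrix r M \<longleftrightarrow>
     (\<forall>i\<in>{1..r}. \<forall>j\<in>{1..r}. \<exists>n\<ge>1. matrix_power r M n i j > 0)"

definition subshift :: "nat \<Rightarrow> (nat \<Rightarrow> nat \<Rightarrow> nat) \<Rightarrow> (nat \<Rightarrow> nat) set" where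
  "subshift r M = {x. \<forall>j. x j \<in> {1..r} \<and> M (x j) (x (Suc j)) = 1}"

text \<open>A point \<open>(\<dots>, x\<^sub>1, x\<^sub>0)\<close> of the dual subshift is encoded by the function \<open>j \<mapsto> x\<^sub>j\<close>, so that
  the bijection \<open>x \<mapsto> x\<^sup>*\<close> between the subshift and its dual becomes the identity.\<close>

definition dual_subshift :: "nat \<Rightarrow> (nat \<Rightarrow> nat \<Rightarrow> nat) \<Rightarrow> (nat \<Rightarrow> nat) set" where
  "dual_subshift r M = {x. \<forall>j. x j \<in> {1..r} \<and> M (x (Suc j)) (x j) = 1}"

lemma dual_subshift_eq_subshift:
  assumes "symmetric_matrix r M"
  shows "dual_subshift r M = subshift r M"
proof -
  have "M (x (Suc j)) (x j) = M (x j) (x (Suc j))" if "\<forall>j. x j \<in> {1..r}" for x :: "nat \<Rightarrow> nat" and j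
    using assms that unfolding symmetric_matrix_def by blast
  then show ?thesis unfolding dual_subshift_def subshift_def by (simp add: all_conj_distrib cong: conj_cong)
qed

text \<open>Pairs are ordered \<open>(y, x)\<close> with \<open>y\<close> in the dual subshift.\<close>

definition two_sided_subshift ::
    "nat \<Rightarrow> (nat \<Rightarrow> nat \<Rightarrow> nat) \<Rightarrow> ((nat \<Rightarrow> nat) \<times> (nat \<Rightarrow> nat)) set" where
  "two_sided_subshift r M =
     {(y, x). y \<in> dual_subshift r M \<and> x \<in> subshift r M \<and> M (y 0) (x 0) = 1}"

definition shift_map :: "(nat \<Rightarrow> nat) \<Rightarrow> (nat \<Rightarrow> nat)" where
  "shift_map x = (\<lambda>j. x (Suc j))"


section \<open>Metrics\<close>

definition seq_dist :: "real \<Rightarrow> (nat \<Rightarrow> nat) \<Rightarrow> (nat \<Rightarrow> nat) \<Rightarrow> real" where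
  "seq_dist \<Lambda> x y = (if x = y then 0 else \<Lambda> ^ (LEAST j. x j \<noteq> y j))"

definition pair_dist ::
    "real \<Rightarrow> (nat \<Rightarrow> nat) \<times> (nat \<Rightarrow> nat) \<Rightarrow> (nat \<Rightarrow> nat) \<times> (nat \<Rightarrow> nat) \<Rightarrow> real" where
  "pair_dist \<Lambda> p q = max (seq_dist \<Lambda> (fst p) (fst q)) (seq_dist \<Lambda> (snd p) (snd q))"

lemma seq_dist_less_iff:
  assumes "0 < \<Lambda>" "\<Lambda> < 1"
  shows "seq_dist \<Lambda> x y < \<Lambda> ^ n \<longleftrightarrow> (\<forall>j\<le>n. x j = y j)"
proof (cases "x = y")
  case True
  then show ?thesis using assms by (simp add: seq_dist_def)
next
  case False
  define m where "m = (LEAST j. x j \<noteq> y j)"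
  from False obtain j0 where "x j0 \<noteq> y j0" by (meson ext)
  then have ne: "x m \<noteq> y m" unfolding m_def by (rule LeastI)
  have eq: "x j = y j" if "j < m" for j
    using not_less_Least[OF that[unfolded m_def]] by simp
  have "seq_dist \<Lambda> x y = \<Lambda> ^ m"
    using False by (simp add: seq_dist_def m_def)
  then have "seq_dist \<Lambda> x y < \<Lambda> ^ n \<longleftrightarrow> n < m"
    using power_strict_decreasing_iff[OF assms] by simp
  also have "\<dots> \<longleftrightarrow> (\<forall>j\<le>n. x j = y j)"
    using ne eq by (meson le_less_trans not_le)
  finally show ?thesis .
qed

lemma seq_dist_nonneg: "0 < \<Lambda> \<Longrightarrow> 0 \<le> seq_dist \<Lambda> x y"
  by (simp add: seq_dist_def)

lemma seq_dist_commute: "seq_dist \<Lambda> x y = seq_dist \<Lambda> y x"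
proof -
  have "(\<lambda>j. x j \<noteq> y j) = (\<lambda>j. y j \<noteq> x j)" by auto
  then show ?thesis unfolding seq_dist_def by auto
qed

lemma seq_dist_eq_0: "0 < \<Lambda> \<Longrightarrow> seq_dist \<Lambda> x y = 0 \<longleftrightarrow> x = y"
  by (simp add: seq_dist_def)

lemma seq_dist_ultra:
  assumes "0 < \<Lambda>" "\<Lambda> < 1"
  shows "seq_dist \<Lambda> x z \<le> max (seq_dist \<Lambda> x y) (seq_dist \<Lambda> y z)"
proof (cases "x = z")
  case True
  then show ?thesis using assms seq_dist_nonneg[of \<Lambda> x y] by (simp add: seq_dist_def)
next
  case False
  define n where "n = (LEAST j. x j \<noteq> z j)"
  have eq: "seq_dist \<Lambda> x z = \<Lambda> ^ n" using False by (simp add: seq_dist_def n_def)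
  then have "\<not> seq_dist \<Lambda> x z < \<Lambda> ^ n" by simp
  then have "\<not> (seq_dist \<Lambda> x y < \<Lambda> ^ n \<and> seq_dist \<Lambda> y z < \<Lambda> ^ n)"
    unfolding seq_dist_less_iff[OF assms] by auto
  then show ?thesis using eq by auto
qed

lemma Metric_space_seq_dist:
  assumes "0 < \<Lambda>" "\<Lambda> < 1"
  shows "Metric_space S (seq_dist \<Lambda>)"
proof
  fix x y z
  show "seq_dist \<Lambda> x z \<le> seq_dist \<Lambda> x y + seq_dist \<Lambda> y z"
    using seq_dist_ultra[OF assms, of x z y] seq_dist_nonneg[OF assms(1), of x y]
      seq_dist_nonneg[OF assms(1), of y z] by auto
next
  fix x y
  show "0 \<le> seq_dist \<Lambda> x y" by (rule seq_dist_nonneg[OF assms(1)])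
  show "seq_dist \<Lambda> x y = seq_dist \<Lambda> y x" by (rule seq_dist_commute)
  show "seq_dist \<Lambda> x y = 0 \<longleftrightarrow> x = y" by (rule seq_dist_eq_0[OF assms(1)])
qed

lemma Metric_space_pair_dist:
  assumes "0 < \<Lambda>" "\<Lambda> < 1"
  shows "Metric_space S (pair_dist \<Lambda>)"
proof -
  have tri: "max a1 a2 \<le> max b1 b2 + max c1 c2" if "a1 \<le> b1 + c1" "a2 \<le> b2 + c2"
    for a1 a2 b1 b2 c1 c2 :: real
    using that by (auto simp: max_def)
  have zero: "max a b = 0 \<longleftrightarrow> a = 0 \<and> b = 0" if "0 \<le> a" "0 \<le> b" for a b :: real
    using that by (auto simp: max_def)
  have seq_tri: "seq_dist \<Lambda> a c \<le> seq_dist \<Lambda> a b + seq_dist \<Lambda> b c" for a b c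
    by (rule Metric_space.triangle[OF Metric_space_seq_dist[OF assms, of UNIV]]) simp_all
  show ?thesis
  proof
    fix p q w
    show "pair_dist \<Lambda> p w \<le> pair_dist \<Lambda> p q + pair_dist \<Lambda> q w"
      unfolding pair_dist_def by (intro tri seq_tri)
  next
    fix p q
    show "0 \<le> pair_dist \<Lambda> p q"
      unfolding pair_dist_def by (intro max.coboundedI1 seq_dist_nonneg[OF assms(1)])
    show "pair_dist \<Lambda> p q = pair_dist \<Lambda> q p"
      unfolding pair_dist_def
      by (rule arg_cong2[where f = max]; rule seq_dist_commute)
    show "pair_dist \<Lambda> p q = 0 \<longleftrightarrow> p = q"
      unfolding pair_dist_def zero[OF seq_dist_nonneg[OF assms(1)] seq_dist_nonneg[OF assms(1)]]
        seq_dist_eq_0[OF assms(1)] prod_eq_iff ..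
  qed
qed

text \<open>Both metrics induce the topology inherited from the product topology of the ambient type
  (\<open>nat\<close> being discrete); hence Borel sets are taken in \<open>restrict_space borel\<close>.\<close>

definition cylinder :: "(nat \<Rightarrow> nat) \<Rightarrow> nat \<Rightarrow> (nat \<Rightarrow> nat) set" where
  "cylinder x n = {y. \<forall>j\<le>n. x j = y j}"

lemma cylinder_self: "x \<in> cylinder x n"
  by (simp add: cylinder_def)

lemma cylinder_antimono: "m \<le> n \<Longrightarrow> cylinder x n \<subseteq> cylinder x m"
  by (rule subsetI) (simp add: cylinder_def)

lemma open_cylinder: "open (cylinder x n)"
proof -
  have "open {f :: nat \<Rightarrow> nat. \<forall>i\<in>{..n}. f i \<in> {x i}}"
    using product_topology_basis'[of "{..n}" "\<lambda>i. {x i}" "\<lambda>i. i"]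
    by (simp only: finite_atMost discrete_topology_class.open_discrete simp_thms)
  moreover have "{f :: nat \<Rightarrow> nat. \<forall>i\<in>{..n}. f i \<in> {x i}} = cylinder x n"
    by (fastforce simp: cylinder_def)
  ultimately show ?thesis by (simp only:)
qed

lemma open_contains_cylinder:
  fixes U :: "(nat \<Rightarrow> nat) set"
  assumes "open U" "x \<in> U"
  shows "\<exists>n. cylinder x n \<subseteq> U"
proof -
  have "openin (product_topology (\<lambda>i. euclidean) UNIV) U"
    using assms(1) by (simp add: open_fun_def)
  from product_topology_open_contains_basis[OF this assms(2)]
  obtain X where X: "x \<in> (\<Pi>\<^sub>E i\<in>UNIV. X i)" "finite {i. X i \<noteq> UNIV}" "(\<Pi>\<^sub>E i\<in>UNIV. X i) \<subseteq> U"
    by auto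
  from X(2) obtain n where n: "{i. X i \<noteq> UNIV} \<subseteq> {..n}"
    by (auto simp: finite_nat_set_iff_bounded_le)
  have "cylinder x n \<subseteq> (\<Pi>\<^sub>E i\<in>UNIV. X i)"
  proof
    fix y assume y: "y \<in> cylinder x n"
    have "y i \<in> X i" for i
    proof (cases "X i = UNIV")
      case False
      then have "i \<le> n" using n by auto
      with y have "x i = y i" by (simp add: cylinder_def)
      moreover have "x i \<in> X i" using X(1) by (rule PiE_mem) simp
      ultimately show ?thesis by simp
    qed simp
    then show "y \<in> (\<Pi>\<^sub>E i\<in>UNIV. X i)" by (simp add: PiE_iff)
  qed
  then show ?thesis using X(3) by (intro exI[of _ n]) (rule order_trans)
qed

lemma seq_dist_topology:
  assumes "0 < \<Lambda>" "\<Lambda> < 1"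
  shows "mtopology_of (metric (S, seq_dist \<Lambda>)) = top_of_set S"
proof -
  interpret Submetric UNIV "seq_dist \<Lambda>" S
    using Metric_space_seq_dist[OF assms] by (simp add: Submetric_def Submetric_axioms_def)
  have ball: "mball x (\<Lambda> ^ n) = cylinder x n" for x n
    unfolding mball_def cylinder_def seq_dist_less_iff[OF assms] by simp
  have "openin mtopology U \<longleftrightarrow> open U" for U
  proof
    assume U: "openin mtopology U"
    show "open U"
    proof (subst open_subopen, intro ballI)
      fix x assume "x \<in> U"
      then obtain e where e: "e > 0" "mball x e \<subseteq> U" using U by (auto simp: openin_mtopology)
      obtain n where "\<Lambda> ^ n < e" using e(1) assms real_arch_pow_inv by blast
      then have "cylinder x n \<subseteq> U"
        using e(2) mball_subset_concentric[of "\<Lambda> ^ n" e x] unfolding ball by simp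
      then show "\<exists>T. open T \<and> x \<in> T \<and> T \<subseteq> U"
        by (intro exI[of _ "cylinder x n"] conjI open_cylinder cylinder_self)
    qed
  next
    assume U: "open U"
    show "openin mtopology U"
      unfolding openin_mtopology
    proof (intro conjI allI impI)
      fix x assume "x \<in> U"
      then obtain n where "mball x (\<Lambda> ^ n) \<subseteq> U"
        unfolding ball by (metis open_contains_cylinder[OF U])
      then show "\<exists>r>0. mball x r \<subseteq> U"
        by (intro exI[of _ "\<Lambda> ^ n"] conjI zero_less_power[OF assms(1)])
    qed simp
  qed
  then have "mtopology = euclidean" by (simp add: topology_eq)
  then show ?thesis using mtopology_submetric sub.mtopology_of by simp
qed

lemma pair_dist_topology:
  assumes "0 < \<Lambda>" "\<Lambda> < 1"
  shows "mtopology_of (metric (S, pair_dist \<Lambda>)) = top_of_set S"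
proof -
  interpret Submetric UNIV "pair_dist \<Lambda>" S
    using Metric_space_pair_dist[OF assms] by (simp add: Submetric_def Submetric_axioms_def)
  have ball: "mball p (\<Lambda> ^ n) = cylinder (fst p) n \<times> cylinder (snd p) n" for p n
    unfolding mball_def cylinder_def pair_dist_def max_less_iff_conj seq_dist_less_iff[OF assms]
    by (simp add: set_eq_iff)
  have "openin mtopology U \<longleftrightarrow> open U" for U
  proof
    assume U: "openin mtopology U"
    show "open U"
    proof (subst open_subopen, intro ballI)
      fix p assume "p \<in> U"
      then obtain e where e: "e > 0" "mball p e \<subseteq> U" using U unfolding openin_mtopology by metis
      obtain n where "\<Lambda> ^ n < e" using e(1) assms real_arch_pow_inv by blast
      then have "cylinder (fst p) n \<times> cylinder (snd p) n \<subseteq> U"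
        using e(2) mball_subset_concentric[of "\<Lambda> ^ n" e p] unfolding ball by simp
      moreover have "open (cylinder (fst p) n \<times> cylinder (snd p) n)"
        by (intro open_Times open_cylinder)
      moreover have "p \<in> cylinder (fst p) n \<times> cylinder (snd p) n"
        by (simp add: mem_Times_iff cylinder_self)
      ultimately show "\<exists>T. open T \<and> p \<in> T \<and> T \<subseteq> U"
        by (intro exI[of _ "cylinder (fst p) n \<times> cylinder (snd p) n"] conjI)
    qed
  next
    assume U: "open U"
    show "openin mtopology U"
      unfolding openin_mtopology
    proof (intro conjI allI impI)
      fix p assume "p \<in> U"
      with U obtain B C where BC: "open B" "open C" "p \<in> B \<times> C" "B \<times> C \<subseteq> U"
        by (rule open_prod_elim)
      obtain m where m: "cylinder (fst p) m \<subseteq> B"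
        using open_contains_cylinder[OF BC(1), of "fst p"] BC(3) by (auto simp: mem_Times_iff)
      obtain k where k: "cylinder (snd p) k \<subseteq> C"
        using open_contains_cylinder[OF BC(2), of "snd p"] BC(3) by (auto simp: mem_Times_iff)
      have "mball p (\<Lambda> ^ max m k) \<subseteq> B \<times> C"
        unfolding ball
        by (intro Sigma_mono order_trans[OF cylinder_antimono m] order_trans[OF cylinder_antimono k])
          simp_all
      then show "\<exists>r>0. mball p r \<subseteq> U"
        using BC(4)
        by (intro exI[of _ "\<Lambda> ^ max m k"] conjI zero_less_power[OF assms(1)]) (rule order_trans)
    qed simp
  qed
  then have "mtopology = euclidean" by (simp add: topology_eq)
  then show ?thesis using mtopology_submetric sub.mtopology_of by simp
qed


section \<open>Lipschitz functions and measures\<close>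

text \<open>Functions are total on the ambient type; their values off the carrier are irrelevant.\<close>

definition lipschitz_functions ::
    "nat \<Rightarrow> (nat \<Rightarrow> nat \<Rightarrow> nat) \<Rightarrow> real \<Rightarrow> ((nat \<Rightarrow> nat) \<Rightarrow> real) set" where
  "lipschitz_functions r M \<Lambda> =
     {f. Lipschitz_continuous_map (metric (subshift r M, seq_dist \<Lambda>)) euclidean_metric f}"

definition invariant_measures :: "nat \<Rightarrow> (nat \<Rightarrow> nat \<Rightarrow> nat) \<Rightarrow> (nat \<Rightarrow> nat) measure set" where
  "invariant_measures r M =
     {\<mu>. prob_space \<mu> \<and> sets \<mu> = sets (restrict_space borel (subshift r M)) \<and>
         distr \<mu> (restrict_space borel (subshift r M)) shift_map = \<mu>}"

definition equal_marginal_measures ::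
    "nat \<Rightarrow> (nat \<Rightarrow> nat \<Rightarrow> nat) \<Rightarrow> ((nat \<Rightarrow> nat) \<times> (nat \<Rightarrow> nat)) measure set" where
  "equal_marginal_measures r M =
     {\<eta>. prob_space \<eta> \<and> sets \<eta> = sets (restrict_space borel (two_sided_subshift r M)) \<and>
         distr \<eta> (restrict_space borel (subshift r M)) snd =
         distr \<eta> (restrict_space borel (dual_subshift r M)) fst}"


section \<open>Kolmogorov--Sinai entropy\<close>

definition finite_measurable_partition :: "'a measure \<Rightarrow> 'a set set \<Rightarrow> bool" where
  "finite_measurable_partition \<mu> P \<longleftrightarrow> finite P \<and> P \<subseteq> sets \<mu> \<and> partition_on (space \<mu>) P"

text \<open>Since \<open>ln 0 = 0\<close>, null atoms contribute nothing.\<close>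

definition partition_entropy :: "'a measure \<Rightarrow> 'a set set \<Rightarrow> real" where
  "partition_entropy \<mu> P = - (\<Sum>C\<in>P. measure \<mu> C * ln (measure \<mu> C))"

definition pullback_partition :: "'a measure \<Rightarrow> ('a \<Rightarrow> 'a) \<Rightarrow> 'a set set \<Rightarrow> 'a set set" where
  "pullback_partition \<mu> T P = (\<lambda>C. T -` C \<inter> space \<mu>) ` P - {{}}"

text \<open>The join \<open>P \<or> T\<^sup>-\<^sup>1 P \<or> \<dots> \<or> T\<^sup>-\<^sup>(\<^sup>n\<^sup>-\<^sup>1\<^sup>) P\<close>, for \<open>n \<ge> 1\<close>.\<close>

definition dynamical_join :: "'a measure \<Rightarrow> ('a \<Rightarrow> 'a) \<Rightarrow> 'a set set \<Rightarrow> nat \<Rightarrow> 'a set set" where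
  "dynamical_join \<mu> T P n = common_refinement ((\<lambda>i. pullback_partition \<mu> (T ^^ i) P) ` {..<n})"

definition entropy_wrt_partition :: "'a measure \<Rightarrow> ('a \<Rightarrow> 'a) \<Rightarrow> 'a set set \<Rightarrow> real" where
  "entropy_wrt_partition \<mu> T P = lim (\<lambda>n. partition_entropy \<mu> (dynamical_join \<mu> T P n) / real n)"

definition KS_entropy :: "'a measure \<Rightarrow> ('a \<Rightarrow> 'a) \<Rightarrow> ereal" where
  "KS_entropy \<mu> T =
     (SUP P \<in> {P. finite_measurable_partition \<mu> P}. ereal (entropy_wrt_partition \<mu> T P))"


section \<open>Effective potentials and sub-actions\<close>

text \<open>Extension by \<open>0\<close> of a function on the two-sided subshift.\<close>

definition zero_ext ::
    "(nat \<Rightarrow> nat \<Rightarrow> nat) \<Rightarrow> ((nat \<Rightarrow> nat) \<times> (nat \<Rightarrow> nat) \<Rightarrow> real) \<Rightarrow> (nat \<Rightarrow> nat) \<Rightarrow> (nat \<Rightarrow> nat) \<Rightarrow> real" where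
  "zero_ext M A y x = A (y, x) * real (M (y 0) (x 0))"

text \<open>The supremum is taken in the extended reals, where it always exists.\<close>

definition forward_operator ::
    "nat \<Rightarrow> (nat \<Rightarrow> nat \<Rightarrow> nat) \<Rightarrow> ((nat \<Rightarrow> nat) \<times> (nat \<Rightarrow> nat) \<Rightarrow> real) \<Rightarrow>
     ((nat \<Rightarrow> nat) \<Rightarrow> real) \<Rightarrow> (nat \<Rightarrow> nat) \<Rightarrow> ereal" where
  "forward_operator r M B \<phi> y =
     (SUP \<mu> \<in> invariant_measures r M.
        ereal (\<integral>x. zero_ext M B y x + \<phi> x \<partial>\<mu>) + KS_entropy \<mu> shift_map)"

text \<open>\<open>\<phi>\<close> is an effective potential for \<open>B\<close>, with effective constant \<open>c\<close>.\<close>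

definition effective_potential ::
    "nat \<Rightarrow> (nat \<Rightarrow> nat \<Rightarrow> nat) \<Rightarrow> real \<Rightarrow> ((nat \<Rightarrow> nat) \<times> (nat \<Rightarrow> nat) \<Rightarrow> real) \<Rightarrow>
     ((nat \<Rightarrow> nat) \<Rightarrow> real) \<Rightarrow> real \<Rightarrow> bool" where
  "effective_potential r M \<Lambda> B \<phi> c \<longleftrightarrow>
     \<phi> \<in> lipschitz_functions r M \<Lambda> \<and>
     (\<forall>y\<in>dual_subshift r M. forward_operator r M B \<phi> y = ereal (\<phi> y + c))"

text \<open>The supremum below is a maximum: the invariant measures form a weakly compact set.\<close>

definition sub_action ::
    "nat \<Rightarrow> (nat \<Rightarrow> nat \<Rightarrow> nat) \<Rightarrow> real \<Rightarrow> ((nat \<Rightarrow> nat) \<Rightarrow> real) \<Rightarrow> ((nat \<Rightarrow> nat) \<Rightarrow> real) \<Rightarrow> bool" where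
  "sub_action r M \<Lambda> f U \<longleftrightarrow>
     f \<in> lipschitz_functions r M \<Lambda> \<and> U \<in> lipschitz_functions r M \<Lambda> \<and>
     (\<forall>x\<in>subshift r M. f x + U x - U (shift_map x) \<le> (SUP \<mu>\<in>invariant_measures r M. \<integral>z. f z \<partial>\<mu>))"

end

theory Submission
  imports Defs
begin

text \<open>Write \<open>\<sigma>\<close> for the shift, \<open>d\<close> for the metric, and
\<open>f\<^sub>y = A(y, \<cdot>) + V - V(y)\<close>. Two facts about the zero temperature limit come first. Dividing the
fixed point equation by \<open>\<beta>\<close> leaves an error of at most \<open>h/\<beta>\<close>, where \<open>h\<close> bounds the entropy of
all invariant measures (the finiteness of the supremum at \<open>\<beta> = 1\<close> already forces such a bound).
Since the limit operator is monotone and commutes with the addition of constants, two approximate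
eigenvalues differ by at most that error, so \<open>\<lambda>\<^sub>\<beta>/\<beta>\<close> converges to some \<open>m\<close>; along the given sequence the
equation becomes \<open>sup\<^sub>\<mu> \<integral> f\<^sub>y d\<mu> = m\<close> for every \<open>y\<close> (\<open>limit_equation\<close>).

The inequality between \<open>m\<close> and the supremum over the measures \<open>\<eta>\<close> is immediate for every family of
sub-actions: on the two-sided space \<open>A(y,x) + U\<^sub>y(x) - U\<^sub>y(\<sigma> x) \<le> m + V(y) - V(x)\<close>, and
\<open>V(y) - V(x)\<close> integrates to zero when the marginals agree. The content is to choose the family
so that equality holds almost everywhere for one such \<open>\<eta>\<close>. Symmetry of the matrix offers a place to
look: every pair \<open>(\<sigma> x, x)\<close> lies in the two-sided space, and the image of a shift invariant measure
under \<open>x \<mapsto> (\<sigma> x, x)\<close> has equal marginals. So it suffices that equality holds at \<open>(\<sigma> x, x)\<close> for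
all \<open>x\<close> in the support of some invariant measure.

For fixed \<open>y\<close> there is a calibrated sub-action of \<open>f\<^sub>y\<close>, one for which equality holds at some preimage of
each point (\<open>calibrated_subaction_exists\<close>). Its dependence on \<open>y\<close> is not controlled, so it is replaced by the largest
sub-action normalised to vanish at \<open>y\<close>, with the same Lipschitz constant on cylinders. Being an
infimum of costs of finite chains from \<open>x\<close> to \<open>y\<close>, it is upper semicontinuous in \<open>(y, x)\<close>, hence
jointly measurable (\<open>maximal_subaction_upper_semicontinuous\<close>); and comparison with the
calibrated one shows that it still attains equality at \<open>(y, x)\<close> for some preimage \<open>x\<close> of \<open>y\<close>
(\<open>maximal_subaction_calibrated_at\<close>). The set of \<open>x\<close> with equality at \<open>(\<sigma> x, x)\<close> is
therefore closed and is mapped onto the whole subshift by \<open>\<sigma>\<close>. Following preimages inside this set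
gives arbitrarily long orbit segments in it, and a weak limit of the orbit averages is the
invariant measure required (\<open>invariant_measure_on_closed\<close>).\<close>

section \<open>Sequences and cylinders\<close>

lemma shift_map_apply [simp]: "shift_map x j = x (Suc j)"
  by (simp add: shift_map_def)

lemma shift_map_funpow: "(shift_map ^^ n) x = (\<lambda>j. x (n + j))"
  by (induction n arbitrary: x) (auto simp: funpow_swap1)

lemma shift_map_case_nat [simp]: "shift_map (case_nat a x) = x"
  by (simp add: shift_map_def)

lemma case_nat_shift_map [simp]: "case_nat (x 0) (shift_map x) = x"
  by (auto simp: fun_eq_iff split: nat.split)

lemma seq_dist_case_nat:
  assumes "0 < \<Lambda>" "\<Lambda> < 1"
  shows "seq_dist \<Lambda> (case_nat a x) (case_nat a y) = \<Lambda> * seq_dist \<Lambda> x y"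
proof (cases "x = y")
  case True
  then show ?thesis by (simp add: seq_dist_def)
next
  case False
  then obtain j where j: "x j \<noteq> y j" by blast
  have "case_nat a x \<noteq> case_nat a y" using False by (metis shift_map_case_nat)
  moreover have "(LEAST j. case_nat a x j \<noteq> case_nat a y j) = Suc (LEAST j. x j \<noteq> y j)"
    using Least_Suc[of "\<lambda>j. case_nat a x j \<noteq> case_nat a y j" "Suc j"] j by simp
  ultimately show ?thesis using False by (simp add: seq_dist_def)
qed

lemma seq_dist_le_1:
  assumes "0 < \<Lambda>" "\<Lambda> < 1"
  shows "seq_dist \<Lambda> x y \<le> 1"
  using assms by (simp add: seq_dist_def power_le_one)

lemma seq_dist_eq_1:
  assumes "x 0 \<noteq> y 0"
  shows "seq_dist \<Lambda> x y = 1"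
proof -
  have "(LEAST j. x j \<noteq> y j) = 0" using assms by (intro Least_eq_0)
  then show ?thesis using assms by (auto simp: seq_dist_def)
qed

lemma seq_dist_le_power:
  assumes "0 < \<Lambda>" "\<Lambda> < 1" "\<And>j. j < n \<Longrightarrow> x j = y j"
  shows "seq_dist \<Lambda> x y \<le> \<Lambda> ^ n"
proof (cases "x = y")
  case True
  then show ?thesis using assms(1) by (simp add: seq_dist_def)
next
  case False
  then have "\<exists>j. x j \<noteq> y j" by (simp add: fun_eq_iff)
  then have "x (LEAST j. x j \<noteq> y j) \<noteq> y (LEAST j. x j \<noteq> y j)"
    by (rule LeastI_ex)
  then have "n \<le> (LEAST j. x j \<noteq> y j)" using assms(3) not_le by blast
  then show ?thesis
    unfolding seq_dist_def using False assms(1,2) by (simp only: if_False) (rule power_decreasing, simp_all)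
qed

lemma continuous_on_cylinderI:
  fixes f :: "(nat \<Rightarrow> nat) \<Rightarrow> 'b::metric_space"
  assumes "\<And>x e. x \<in> S \<Longrightarrow> 0 < e \<Longrightarrow> \<exists>n. \<forall>y\<in>S \<inter> cylinder x n. dist (f y) (f x) < e"
  shows "continuous_on S f"
  unfolding continuous_on_def
proof (intro ballI tendstoI)
  fix x and e :: real assume "x \<in> S" "0 < e"
  then obtain n where "\<forall>y\<in>S \<inter> cylinder x n. dist (f y) (f x) < e" using assms by blast
  then show "eventually (\<lambda>y. dist (f y) (f x) < e) (at x within S)"
    unfolding eventually_at_topological
    by (intro exI[of _ "cylinder x n"]) (auto simp: open_cylinder cylinder_self)
qed

lemma continuous_on_seq_dist_lipschitz:
  fixes f :: "(nat \<Rightarrow> nat) \<Rightarrow> real"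
  assumes "0 < \<Lambda>" "\<Lambda> < 1" and L: "\<And>x y. x \<in> S \<Longrightarrow> y \<in> S \<Longrightarrow> \<bar>f x - f y\<bar> \<le> L * seq_dist \<Lambda> x y"
  shows "continuous_on S f"
proof (rule continuous_on_cylinderI)
  fix x and e :: real assume x: "x \<in> S" and e: "0 < e"
  define L' where "L' = max L 1"
  have L': "0 < L'" by (simp add: L'_def)
  obtain n where n: "\<Lambda> ^ n < e / L'"
    using real_arch_pow_inv[of "e / L'" \<Lambda>] divide_pos_pos[OF e L'] assms(2) by blast
  show "\<exists>n. \<forall>y\<in>S \<inter> cylinder x n. dist (f y) (f x) < e"
  proof (intro exI[of _ n] ballI)
    fix y assume y: "y \<in> S \<inter> cylinder x n"
    then have eq: "y j = x j" if "j < n" for j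
      using that unfolding cylinder_def by fastforce
    have "seq_dist \<Lambda> y x \<le> \<Lambda> ^ n"
      by (rule seq_dist_le_power[OF assms(1,2) eq])
    then have d: "seq_dist \<Lambda> y x < e / L'" using n by (rule order.strict_trans1)
    have "\<bar>f y - f x\<bar> \<le> L * seq_dist \<Lambda> y x" using L y x by blast
    also have "\<dots> \<le> L' * seq_dist \<Lambda> y x"
      by (intro mult_right_mono seq_dist_nonneg[OF assms(1)]) (simp add: L'_def)
    also have "\<dots> < e" using d unfolding pos_less_divide_eq[OF L'] by (simp only: mult.commute)
    finally show "dist (f y) (f x) < e" by (simp add: dist_real_def)
  qed
qed

lemma continuous_shift_map: "continuous_on S shift_map"
  unfolding shift_map_def
  by (intro continuous_on_coordinatewise_then_product)
    (rule continuous_on_subset[OF continuous_on_product_coordinates], simp)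

lemma measurable_shift_map [measurable]: "shift_map \<in> borel_measurable borel"
  by (intro borel_measurable_continuous_onI continuous_shift_map)

lemma open_eq_countable_Union_cylinders:
  assumes U: "open U"
  obtains F where "countable F" "F \<subseteq> range (case_prod cylinder)" "U = \<Union>F"
proof (rule that)
  let ?C = "\<lambda>l :: nat list. cylinder ((!) l) (length l - 1)"
  let ?F = "?C ` {l. ?C l \<subseteq> U}"
  show "countable ?F" by simp
  show "?F \<subseteq> range (case_prod cylinder)" by auto
  show "U = \<Union>?F"
  proof (intro equalityI subsetI)
    fix x assume "x \<in> U"
    then obtain n where n: "cylinder x n \<subseteq> U" using open_contains_cylinder[OF U] by blast
    have eq: "?C (map x [0..<Suc n]) = cylinder x n"
      by (simp add: cylinder_def less_Suc_eq_le nth_append del: upt_Suc)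
    then have "cylinder x n \<in> ?F"
      using n by (intro image_eqI[where x = "map x [0..<Suc n]"]) (simp_all only: mem_Collect_eq)
    then show "x \<in> \<Union>?F"
      using cylinder_self[of x n] by blast
  qed auto
qed

lemma sets_borel_eq_cylinders:
  "sets (borel :: (nat \<Rightarrow> nat) measure) = sigma_sets UNIV (insert {} (range (case_prod cylinder)))"
proof -
  have "sigma_sets UNIV {U. open U} = sigma_sets UNIV (insert {} (range (case_prod cylinder)))"
  proof (rule sigma_sets_eqI)
    fix U :: "(nat \<Rightarrow> nat) set" assume "U \<in> {S. open S}"
    then obtain F where F: "countable F" "F \<subseteq> range (case_prod cylinder)" "U = \<Union>F"
      using open_eq_countable_Union_cylinders by blast
    have "\<Union>F \<in> sigma_sets UNIV (insert {} (range (case_prod cylinder)))"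
      by (rule sigma_sets_UNION[OF F(1)]) (use F(2) in \<open>auto intro!: sigma_sets.Basic\<close>)
    then show "U \<in> sigma_sets UNIV (insert {} (range (case_prod cylinder)))"
      using F(3) by simp
  qed (auto simp: open_cylinder intro!: sigma_sets.Basic)
  then show ?thesis by (simp add: borel_def)
qed

text \<open>Any two cylinders are nested or disjoint, which is why they form a generator stable under intersection.\<close>

lemma cylinder_eqI:
  assumes "z \<in> cylinder x n"
  shows "cylinder z n = cylinder x n"
proof -
  have "x j = z j" if "j \<le> n" for j
    using assms that by (simp only: cylinder_def mem_Collect_eq)
  then show ?thesis by (simp add: cylinder_def)
qed

lemma measure_eqI_cylinders:
  assumes "finite_measure \<mu>" "sets \<mu> = sets borel" "sets \<nu> = sets (borel :: (nat \<Rightarrow> nat) measure)"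
    and eq: "\<And>x n. emeasure \<mu> (cylinder x n) = emeasure \<nu> (cylinder x n)"
  shows "\<mu> = \<nu>"
proof (rule measure_eqI_generator_eq[where \<Omega> = UNIV and E = "insert {} (range (case_prod cylinder))"
      and A = "\<lambda>i. cylinder (\<lambda>_. i) 0"])
  have "cylinder x n \<inter> cylinder y m \<in> insert {} (range (case_prod cylinder))" for x y n m
  proof (cases "cylinder x n \<inter> cylinder y m = {}")
    case False
    then obtain z where z: "cylinder z n = cylinder x n" "cylinder z m = cylinder y m"
      using cylinder_eqI by blast
    have "cylinder z n \<inter> cylinder z m = cylinder z (max n m)"
      using cylinder_antimono[of n m z] cylinder_antimono[of m n z]
      by (cases "n \<le> m") (auto simp: max_def)
    then show ?thesis unfolding z by auto
  qed simp
  then show "Int_stable (insert {} (range (case_prod cylinder)))"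
    unfolding Int_stable_def by auto
  show "(\<Union>i. cylinder (\<lambda>_. i) 0) = UNIV"
    by (simp add: cylinder_def set_eq_iff)
  show "emeasure \<mu> (cylinder (\<lambda>_. i) 0) \<noteq> \<infinity>" for i
    using finite_measure.emeasure_finite[OF assms(1)] by simp
  show "emeasure \<mu> X = emeasure \<nu> X" if "X \<in> insert {} (range (case_prod cylinder))" for X
    using that eq by auto
  show "sets \<mu> = sigma_sets UNIV (insert {} (range (case_prod cylinder)))"
     "sets \<nu> = sigma_sets UNIV (insert {} (range (case_prod cylinder)))"
    using assms sets_borel_eq_cylinders by auto
qed auto

section \<open>Weak compactness of measures on sequences\<close>

lemma compact_sequences_bounded: "compact {x :: nat \<Rightarrow> nat. \<forall>j. x j \<le> r}"
proof -
  have "compactin (product_topology (\<lambda>_. euclidean) UNIV) (PiE (UNIV :: nat set) (\<lambda>_. {..r}))"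
    by (subst compactin_PiE) (auto intro: finite_imp_compact)
  moreover have "PiE UNIV (\<lambda>_. {..r}) = {x :: nat \<Rightarrow> nat. \<forall>j. x j \<le> r}"
    by (auto simp: PiE_iff)
  ultimately show ?thesis
    by (simp only: euclidean_product_topology compactin_euclidean_iff)
qed

text \<open>With base \<open>r + 2\<close> and digits at most \<open>r\<close> the tail of the expansion stays strictly below one unit of the
preceding digit, so the code is injective. It embeds the compact space of sequences into the
real line, where Helly's theorem supplies weak limits.\<close>

definition digit_code :: "nat \<Rightarrow> (nat \<Rightarrow> nat) \<Rightarrow> real" where
  "digit_code r x = (\<Sum>j. real (x j) / (real r + 2) ^ Suc j)"

lemma digit_code_summable:
  assumes "\<And>j. x j \<le> r"
  shows "summable (\<lambda>j. real (x j) / (real r + 2) ^ Suc j)"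
proof (rule summable_comparison_test'[where N = 0])
  show "summable (\<lambda>j. real r / (real r + 2) * (1 / (real r + 2)) ^ j)"
    by (intro summable_mult summable_geometric) auto
  show "norm (real (x n) / (real r + 2) ^ Suc n) \<le> real r / (real r + 2) * (1 / (real r + 2)) ^ n" for n
    using assms[of n] by (auto simp: power_divide intro!: divide_right_mono)
qed

lemma digit_code_bounds:
  assumes "\<And>j. x j \<le> r"
  shows "0 \<le> digit_code r x" "digit_code r x < 1"
proof -
  show "0 \<le> digit_code r x"
    unfolding digit_code_def by (intro suminf_nonneg digit_code_summable assms) auto
  have g: "(\<lambda>j. real r / (real r + 2) * (1 / (real r + 2)) ^ j) sums (real r / (real r + 2) * (1 / (1 - 1 / (real r + 2))))"
    by (intro sums_mult geometric_sums) auto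
  have "digit_code r x \<le> (\<Sum>j. real r / (real r + 2) * (1 / (real r + 2)) ^ j)"
    unfolding digit_code_def
  proof (rule suminf_le)
    show "real (x n) / (real r + 2) ^ Suc n \<le> real r / (real r + 2) * (1 / (real r + 2)) ^ n" for n
      using assms[of n] by (auto simp: power_divide intro!: divide_right_mono)
  qed (use digit_code_summable[OF assms] sums_summable[OF g] in auto)
  also have "\<dots> = real r / (real r + 2) * (1 / (1 - 1 / (real r + 2)))"
    using g by (simp add: sums_unique[symmetric])
  also have "\<dots> = real r / (real r + 1)" by (simp add: divide_simps)
  also have "\<dots> < 1" by simp
  finally show "digit_code r x < 1" .
qed

lemma digit_code_shift:
  assumes "\<And>j. x j \<le> r"
  shows "(real r + 2) * digit_code r x = x 0 + digit_code r (shift_map x)"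
proof -
  have "(\<Sum>j. real (x (Suc j)) / (real r + 2) ^ Suc (Suc j)) = digit_code r (shift_map x) / (real r + 2)"
    unfolding digit_code_def
    by (subst suminf_divide[symmetric]) (use digit_code_summable[of "shift_map x" r] assms in \<open>auto simp: mult_ac\<close>)
  moreover have "digit_code r x = x 0 / (real r + 2) + (\<Sum>j. real (x (Suc j)) / (real r + 2) ^ Suc (Suc j))"
    unfolding digit_code_def
    using suminf_split_head[OF digit_code_summable[of x, OF assms]] by simp
  ultimately show ?thesis by (simp add: field_simps)
qed

lemma digit_code_eqD:
  assumes "\<And>j. x j \<le> r" "\<And>j. y j \<le> r" "digit_code r x = digit_code r y"
  shows "x 0 = y 0" "digit_code r (shift_map x) = digit_code r (shift_map y)"
proof -
  have e: "real (x 0) + digit_code r (shift_map x) = real (y 0) + digit_code r (shift_map y)"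
    using digit_code_shift[of x r, OF assms(1), symmetric]
      digit_code_shift[of y r, OF assms(2), symmetric] assms(3)
    by simp
  moreover have "0 \<le> digit_code r (shift_map x)" "digit_code r (shift_map x) < 1"
    "0 \<le> digit_code r (shift_map y)" "digit_code r (shift_map y) < 1"
    by (intro digit_code_bounds; simp add: assms)+
  ultimately have "real (x 0) < real (y 0) + 1" "real (y 0) < real (x 0) + 1"
    by linarith+
  then show "x 0 = y 0" by linarith
  then show "digit_code r (shift_map x) = digit_code r (shift_map y)" using e by simp
qed

lemma inj_on_digit_code: "inj_on (digit_code r) {x. \<forall>j. x j \<le> r}"
proof (rule inj_onI)
  have "x n = y n" if "\<forall>j. x j \<le> r" "\<forall>j. y j \<le> r" "digit_code r x = digit_code r y" for n x y
    using that
  proof (induction n arbitrary: x y)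
    case (0 x y)
    then show ?case using digit_code_eqD(1) by blast
  next
    case (Suc n x y)
    have "\<forall>j. shift_map x j \<le> r" "\<forall>j. shift_map y j \<le> r"
      using Suc.prems by simp_all
    then have "shift_map x n = shift_map y n"
      using Suc.IH digit_code_eqD(2)[of x r y] Suc.prems by blast
    then show ?case by simp
  qed
  then show "x = y" if "x \<in> {x. \<forall>j. x j \<le> r}" "y \<in> {x. \<forall>j. x j \<le> r}"
    "digit_code r x = digit_code r y" for x y
    using that by blast
qed

lemma continuous_on_digit_code: "continuous_on {x. \<forall>j. x j \<le> r} (digit_code r)"
proof (rule continuous_on_seq_dist_lipschitz[of "1 / (real r + 2)" _ _ 1])
  have *: "\<bar>digit_code r x - digit_code r y\<bar> \<le> (1 / (real r + 2)) ^ n"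
    if "\<And>j. x j \<le> r" "\<And>j. y j \<le> r" "\<And>j. j < n \<Longrightarrow> x j = y j" for n x y
    using that
  proof (induction n arbitrary: x y)
    case 0
    then show ?case using digit_code_bounds[of x r] digit_code_bounds[of y r] by auto
  next
    case (Suc n)
    have sh: "\<bar>digit_code r (shift_map x) - digit_code r (shift_map y)\<bar> \<le> (1 / (real r + 2)) ^ n"
      using Suc.prems by (intro Suc.IH) auto
    have e: "digit_code r x - digit_code r y = (digit_code r (shift_map x) - digit_code r (shift_map y)) / (real r + 2)"
    proof -
      have "(real r + 2) * digit_code r x = real (x 0) + digit_code r (shift_map x)"
        "(real r + 2) * digit_code r y = real (y 0) + digit_code r (shift_map y)"
        by (intro digit_code_shift Suc.prems)+
      moreover have "x 0 = y 0" by (intro Suc.prems) simp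
      ultimately have "(real r + 2) * (digit_code r x - digit_code r y) = digit_code r (shift_map x) - digit_code r (shift_map y)"
        unfolding right_diff_distrib by linarith
      then show ?thesis by (metis add_pos_nonneg nonzero_mult_div_cancel_left of_nat_0_le_iff add.commute less_irrefl zero_less_numeral)
    qed
    have "\<bar>digit_code r x - digit_code r y\<bar> \<le> (1 / (real r + 2)) ^ n / (real r + 2)"
      unfolding e abs_divide using sh by (auto intro!: divide_right_mono)
    then show ?case by simp
  qed
  fix x y :: "nat \<Rightarrow> nat" assume xy: "x \<in> {x. \<forall>j. x j \<le> r}" "y \<in> {x. \<forall>j. x j \<le> r}"
  show "\<bar>digit_code r x - digit_code r y\<bar> \<le> 1 * seq_dist (1 / (real r + 2)) x y"
  proof (cases "x = y")
    case False
    define n where "n = (LEAST j. x j \<noteq> y j)"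
    have "x j = y j" if "j < n" for j
      using not_less_Least[OF that[unfolded n_def]] by simp
    then have "\<bar>digit_code r x - digit_code r y\<bar> \<le> (1 / (real r + 2)) ^ n"
      using xy by (intro *) auto
    then show ?thesis using False by (simp add: seq_dist_def n_def)
  qed (simp add: seq_dist_def)
qed simp_all

lemma closed_sequences_bounded: "closed {x :: nat \<Rightarrow> nat. \<forall>j. x j \<in> R j}"
proof -
  have "closed {x :: nat \<Rightarrow> nat. x j \<in> R j}" for j
    using closed_vimage[of "R j" "\<lambda>x. x j"] by (simp add: vimage_def closed_def discrete_topology_class.open_discrete)
  then show ?thesis unfolding Collect_all_eq by blast
qed

text \<open>Sequential weak compactness: the laws of the codes are tight on the line, their weak limit is carried
by the compact set of codes, and the limit is pulled back by the inverse of the code. A continuous function on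
sequences becomes a test function on the line by Tietze extension.\<close>

lemma weak_limit_exists:
  fixes \<nu> :: "nat \<Rightarrow> (nat \<Rightarrow> nat) measure"
  assumes prob: "\<And>n. prob_space (\<nu> n)" and sets: "\<And>n. sets (\<nu> n) = sets borel"
    and supp: "\<And>n. AE x in \<nu> n. \<forall>j. x j \<le> r"
  obtains s \<mu> where "strict_mono (s :: nat \<Rightarrow> nat)" "prob_space \<mu>" "sets \<mu> = sets borel"
    "\<And>\<phi> :: (nat \<Rightarrow> nat) \<Rightarrow> real. continuous_on UNIV \<phi> \<Longrightarrow>
       (\<lambda>n. \<integral>x. \<phi> x \<partial>(\<nu> (s n))) \<longlonglongrightarrow> (\<integral>x. \<phi> x \<partial>\<mu>)"
proof -
  define K where "K = {x :: nat \<Rightarrow> nat. \<forall>j. x j \<le> r}"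
  have K: "compact K" "K \<noteq> {}"
    using compact_sequences_bounded[of r] by (auto simp: K_def intro: exI[of _ "\<lambda>_. 0"])
  have closedK: "closed K"
    using closed_sequences_bounded[of "\<lambda>_. {..r}"] by (simp add: K_def)
  have cont: "continuous_on K (digit_code r)" and inj: "inj_on (digit_code r) K"
    using continuous_on_digit_code inj_on_digit_code by (auto simp: K_def)
  define h where "h x = (if x \<in> K then digit_code r x else 0)" for x
  have [measurable]: "h \<in> borel_measurable borel"
    unfolding h_def using closedK cont by (intro borel_measurable_continuous_on_if) auto
  have AEK: "AE x in \<nu> n. x \<in> K" for n using supp by (simp add: K_def)
  have h01: "0 \<le> h x" "h x < 1" for x
    using digit_code_bounds[of x r] by (auto simp: h_def K_def)
  have [measurable_cong]: "sets (\<nu> n) = sets borel" for n by (rule sets)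
  define \<mu>' where "\<mu>' n = distr (\<nu> n) borel h" for n
  have rd: "real_distribution (\<mu>' n)" for n
    unfolding \<mu>'_def by (intro prob_space.real_distribution_distr prob) simp
  have "tight \<mu>'"
    unfolding tight_def
  proof (intro conjI allI impI rd)
    fix e :: real assume "0 < e"
    have "measure (\<mu>' n) {-1<..1} = 1" for n
    proof -
      have "h -` {-1<..1} \<inter> space (\<nu> n) = space (\<nu> n)"
        using order.strict_trans2[OF _ h01(1), of "-1"] less_imp_le[OF h01(2)] by auto
      then show ?thesis
        unfolding \<mu>'_def by (subst measure_distr) (auto simp: prob_space.prob_space[OF prob])
    qed
    then show "\<exists>a b. a < b \<and> (\<forall>n. 1 - e < measure (\<mu>' n) {a<..b})"
      using \<open>0 < e\<close> by (intro exI[of _ "-1"] exI[of _ 1]) auto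
  qed
  from tight_imp_convergent_subsubsequence[OF this, of id]
  obtain s M where s: "strict_mono (s :: nat \<Rightarrow> nat)" and M: "real_distribution M"
    and "weak_conv_m (\<mu>' \<circ> id \<circ> s) M" by (auto simp: strict_mono_id)
  then have wc: "weak_conv_m (\<lambda>n. \<mu>' (s n)) M" by (simp add: comp_def)
  note conv = weak_conv_imp_integral_bdd_continuous_conv[OF rd M wc]
  interpret M: real_distribution M by (rule M)
  define C where "C = digit_code r ` K"
  have C: "compact C" "C \<noteq> {}" unfolding C_def using K cont by (auto intro: compact_continuous_image)
  have closedC: "closed C" by (rule compact_imp_closed[OF C(1)])
  have AEC: "AE t in M. t \<in> C"
  proof -
    let ?f = "\<lambda>t. min 1 (infdist t C)"
    have [measurable]: "?f \<in> borel_measurable borel"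
      by (intro borel_measurable_continuous_onI continuous_intros)
    have "(\<lambda>n. \<integral>t. ?f t \<partial>\<mu>' (s n)) \<longlonglongrightarrow> (\<integral>t. ?f t \<partial>M)"
      by (rule conv[where B = 1]) (auto intro!: continuous_intros simp: infdist_nonneg)
    moreover have "(\<integral>t. ?f t \<partial>\<mu>' (s n)) = 0" for n
    proof -
      have "(\<integral>t. ?f t \<partial>\<mu>' (s n)) = (\<integral>x. ?f (h x) \<partial>\<nu> (s n))"
        unfolding \<mu>'_def by (intro integral_distr) measurable
      also have "\<dots> = (\<integral>x. 0 \<partial>\<nu> (s n))"
      proof (rule integral_cong_AE)
        show "AE x in \<nu> (s n). ?f (h x) = 0"
          using AEK[of "s n"] by eventually_elim (auto simp: h_def C_def)
      qed measurable
      finally show ?thesis by simp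
    qed
    ultimately have "(\<integral>t. ?f t \<partial>M) = 0" by (simp add: LIMSEQ_const_iff)
    moreover have "integrable M ?f"
      by (rule M.integrable_const_bound[where B = 1]) (auto simp: infdist_nonneg)
    ultimately have "AE t in M. ?f t = 0"
      by (subst (asm) integral_nonneg_eq_0_iff_AE) (auto simp: infdist_nonneg)
    then show ?thesis
      by eventually_elim (use in_closed_iff_infdist_zero[OF closedC C(2)] in \<open>auto simp: min_def split: if_splits\<close>)
  qed
  define k where "k t = (if t \<in> C then the_inv_into K (digit_code r) t else (\<lambda>_. 0))" for t
  have contk: "continuous_on C (the_inv_into K (digit_code r))"
    unfolding C_def by (rule continuous_on_inv_into[OF cont K(1) inj])
  have [measurable]: "k \<in> borel_measurable borel"
    unfolding k_def using closedC contk by (intro borel_measurable_continuous_on_if) auto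
  have kh: "k (h x) = x" "h x \<in> C" if "x \<in> K" for x
    using that by (auto simp: k_def h_def C_def the_inv_into_f_f[OF inj])
  define \<mu> where "\<mu> = distr M borel k"
  show ?thesis
  proof (rule that[OF s, of \<mu>])
    show "prob_space \<mu>" unfolding \<mu>_def by (intro M.prob_space_distr) simp
    show "sets \<mu> = sets borel" by (simp add: \<mu>_def)
    fix \<phi> :: "(nat \<Rightarrow> nat) \<Rightarrow> real" assume \<phi>: "continuous_on UNIV \<phi>"
    then have [measurable]: "\<phi> \<in> borel_measurable borel" by (rule borel_measurable_continuous_onI)
    have "bounded (\<phi> ` K)"
      using \<phi> K by (intro compact_imp_bounded compact_continuous_image) (auto intro: continuous_on_subset)
    then obtain B where B: "\<And>x. x \<in> K \<Longrightarrow> norm (\<phi> x) \<le> B" "0 < B"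
      unfolding bounded_pos by blast
    have kK: "the_inv_into K (digit_code r) t \<in> K" if "t \<in> C" for t
      using that unfolding C_def by (intro the_inv_into_into[OF inj]) auto
    have "continuous_on C (\<lambda>t. \<phi> (the_inv_into K (digit_code r) t))"
      by (rule continuous_on_compose2[OF \<phi> contk]) auto
    then obtain \<Phi> where \<Phi>: "continuous_on UNIV \<Phi>" "\<And>t. norm (\<Phi> t) \<le> B"
       "\<And>t. t \<in> C \<Longrightarrow> \<Phi> t = \<phi> (the_inv_into K (digit_code r) t)"
      by (rule Tietze[of C _ UNIV B]) (use B kK closedC in auto)
    then have [measurable]: "\<Phi> \<in> borel_measurable borel" by (intro borel_measurable_continuous_onI)
    have \<Phi>k: "\<Phi> t = \<phi> (k t)" if "t \<in> C" for t using that \<Phi>(3) by (simp add: k_def)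
    have "(\<lambda>n. \<integral>t. \<Phi> t \<partial>\<mu>' (s n)) \<longlonglongrightarrow> (\<integral>t. \<Phi> t \<partial>M)"
      by (rule conv[where B = B]) (use \<Phi> in \<open>auto simp: continuous_on_eq_continuous_at\<close>)
    moreover have "(\<integral>t. \<Phi> t \<partial>\<mu>' n) = (\<integral>x. \<phi> x \<partial>\<nu> n)" for n
    proof -
      have "(\<integral>t. \<Phi> t \<partial>\<mu>' n) = (\<integral>x. \<Phi> (h x) \<partial>\<nu> n)"
        unfolding \<mu>'_def by (intro integral_distr) measurable
      also have "\<dots> = (\<integral>x. \<phi> x \<partial>\<nu> n)"
      proof (rule integral_cong_AE)
        show "AE x in \<nu> n. \<Phi> (h x) = \<phi> x"
          using AEK[of n] by eventually_elim (simp add: \<Phi>k kh)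
      qed measurable
      finally show ?thesis .
    qed
    moreover have "(\<integral>t. \<Phi> t \<partial>M) = (\<integral>x. \<phi> x \<partial>\<mu>)"
    proof -
      have "(\<integral>x. \<phi> x \<partial>\<mu>) = (\<integral>t. \<phi> (k t) \<partial>M)"
        unfolding \<mu>_def by (intro integral_distr) measurable
      also have "\<dots> = (\<integral>t. \<Phi> t \<partial>M)"
      proof (rule integral_cong_AE)
        show "AE t in M. \<phi> (k t) = \<Phi> t"
          using AEC by eventually_elim (simp add: \<Phi>k)
      qed measurable
      finally show ?thesis by simp
    qed
    ultimately show "(\<lambda>n. \<integral>x. \<phi> x \<partial>(\<nu> (s n))) \<longlonglongrightarrow> (\<integral>x. \<phi> x \<partial>\<mu>)" by simp
  qed
qed

section \<open>Orbit averages and invariant measures\<close>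

definition orbit_measure :: "(nat \<Rightarrow> nat) measure \<Rightarrow> nat \<Rightarrow> (nat \<Rightarrow> nat) \<Rightarrow> (nat \<Rightarrow> nat) measure" where
  "orbit_measure N n x = distr (measure_pmf (pmf_of_set {..<n})) N (\<lambda>k. (shift_map ^^ k) x)"

lemma sets_orbit_measure [simp]: "sets (orbit_measure N n x) = sets N"
  by (simp add: orbit_measure_def)

lemma space_orbit_measure [simp]: "space (orbit_measure N n x) = space N"
  by (simp add: orbit_measure_def)

lemma prob_space_orbit_measure:
  assumes "\<And>k. (shift_map ^^ k) x \<in> space N"
  shows "prob_space (orbit_measure N n x)"
  unfolding orbit_measure_def
  by (rule prob_space.prob_space_distr) (use assms prob_space_measure_pmf in auto)

lemma integral_orbit_measure:
  fixes f :: "(nat \<Rightarrow> nat) \<Rightarrow> real"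
  assumes "\<And>k. (shift_map ^^ k) x \<in> space N" "f \<in> borel_measurable N" "0 < n"
  shows "(\<integral>z. f z \<partial>orbit_measure N n x) = (\<Sum>k<n. f ((shift_map ^^ k) x)) / n"
  unfolding orbit_measure_def
  by (subst integral_distr) (use assms in \<open>auto simp: integral_pmf_of_set lessThan_empty_iff\<close>)

lemma AE_orbit_measure:
  assumes "\<And>k. (shift_map ^^ k) x \<in> space N" "{z \<in> space N. P z} \<in> sets N" "0 < n"
    "\<And>k. k < n \<Longrightarrow> P ((shift_map ^^ k) x)"
  shows "AE z in orbit_measure N n x. P z"
  unfolding orbit_measure_def
  by (subst AE_distr_iff) (use assms in \<open>auto simp: AE_measure_pmf_iff set_pmf_of_set lessThan_empty_iff\<close>)

lemma sum_orbit_shift: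
  fixes f :: "(nat \<Rightarrow> nat) \<Rightarrow> real"
  shows "(\<Sum>k<n. f (shift_map ((shift_map ^^ k) x))) =
    (\<Sum>k<n. f ((shift_map ^^ k) x)) + f ((shift_map ^^ n) x) - f x"
  using sum.lessThan_Suc_shift[of "\<lambda>k. f ((shift_map ^^ k) x)" n]
    sum.lessThan_Suc[of "\<lambda>k. f ((shift_map ^^ k) x)" n] by simp

text \<open>The Krylov-Bogoliubov argument. An average over \<open>n\<close> points of an orbit changes by \<open>O(1/n)\<close> under the
shift, so a weak limit is invariant. Each cylinder disjoint from \<open>E\<close> has a continuous indicator and hence
measure zero in the limit; the complement of \<open>E\<close> is a countable union of these.\<close>

lemma invariant_measure_on_closed:
  fixes E :: "(nat \<Rightarrow> nat) set"
  assumes E: "closed E" "E \<subseteq> {x. \<forall>j. x j \<le> r}"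
    and ex: "\<And>n. \<exists>x. (\<forall>j. x j \<le> r) \<and> (\<forall>k<n. (shift_map ^^ k) x \<in> E)"
  obtains \<nu> where "prob_space \<nu>" "sets \<nu> = sets borel" "distr \<nu> borel shift_map = \<nu>"
    "AE x in \<nu>. x \<in> E"
proof -
  obtain p where p: "\<And>n j. p n j \<le> r" "\<And>n k. k < n \<Longrightarrow> (shift_map ^^ k) (p n) \<in> E"
    using ex by metis
  have "E \<noteq> {}" using p(2)[of 0 1] by auto
  define \<nu> where "\<nu> n = orbit_measure borel (Suc n) (p (Suc n))" for n
  have prob: "prob_space (\<nu> n)" for n
    unfolding \<nu>_def by (rule prob_space_orbit_measure) simp
  have [measurable]: "E \<in> sets borel" using E(1) by simp
  have AEE: "AE x in \<nu> n. x \<in> E" for n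
    unfolding \<nu>_def by (rule AE_orbit_measure) (use p(2)[of _ "Suc n"] in auto)
  have AEK: "AE x in \<nu> n. \<forall>j. x j \<le> r" for n
    using AEE[of n] by eventually_elim (use E(2) in auto)
  obtain s \<mu> where s: "strict_mono (s :: nat \<Rightarrow> nat)" and \<mu>: "prob_space \<mu>" "sets \<mu> = sets borel"
    and conv: "\<And>\<phi> :: (nat \<Rightarrow> nat) \<Rightarrow> real. continuous_on UNIV \<phi> \<Longrightarrow>
       (\<lambda>n. \<integral>x. \<phi> x \<partial>(\<nu> (s n))) \<longlonglongrightarrow> (\<integral>x. \<phi> x \<partial>\<mu>)"
    by (rule weak_limit_exists[of \<nu> r, OF prob _ AEK]) (simp_all add: \<nu>_def)
  interpret \<mu>: prob_space \<mu> by (rule \<mu>(1))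
  have [measurable_cong]: "sets \<mu> = sets borel" by (rule \<mu>(2))
  have int_shift: "(\<integral>x. \<phi> (shift_map x) \<partial>\<mu>) = (\<integral>x. \<phi> x \<partial>\<mu>)"
    if \<phi>: "continuous_on UNIV \<phi>" "\<And>x. \<bar>\<phi> x\<bar> \<le> 1" for \<phi> :: "(nat \<Rightarrow> nat) \<Rightarrow> real"
  proof -
    have c: "continuous_on UNIV (\<lambda>x. \<phi> (shift_map x))"
      by (rule continuous_on_compose2[OF \<phi>(1) continuous_shift_map]) auto
    have d: "(\<integral>x. \<phi> (shift_map x) \<partial>\<nu> n) - (\<integral>x. \<phi> x \<partial>\<nu> n) =
      (\<phi> ((shift_map ^^ Suc n) (p (Suc n))) - \<phi> (p (Suc n))) / Suc n" for n
    proof -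
      have "(\<integral>x. \<psi> x \<partial>\<nu> n) = (\<Sum>k<Suc n. \<psi> ((shift_map ^^ k) (p (Suc n)))) / Suc n"
        if "continuous_on UNIV \<psi>" for \<psi> :: "(nat \<Rightarrow> nat) \<Rightarrow> real"
        unfolding \<nu>_def using that
        by (intro integral_orbit_measure borel_measurable_continuous_onI) simp_all
      note this[OF \<phi>(1)] this[OF c]
      then show ?thesis
        by (simp only: sum_orbit_shift diff_divide_distrib add_divide_distrib)
    qed
    have "norm ((\<integral>x. \<phi> (shift_map x) \<partial>\<nu> n) - (\<integral>x. \<phi> x \<partial>\<nu> n)) \<le> 2 * inverse (Suc n)" for n
    proof -
      have "\<bar>\<phi> ((shift_map ^^ Suc n) (p (Suc n))) - \<phi> (p (Suc n))\<bar> \<le> 2"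
        using \<phi>(2)[of "(shift_map ^^ Suc n) (p (Suc n))"] \<phi>(2)[of "p (Suc n)"] by linarith
      then have "\<bar>\<phi> ((shift_map ^^ Suc n) (p (Suc n))) - \<phi> (p (Suc n))\<bar> / Suc n \<le> 2 / Suc n"
        by (rule divide_right_mono) simp
      then show ?thesis unfolding d real_norm_def abs_divide by (simp only: abs_of_nat divide_inverse)
    qed
    note bnd = this
    have "(\<lambda>n. 2 * inverse (real (Suc n))) \<longlonglongrightarrow> 0"
      by (rule tendsto_mult_right_zero[OF LIMSEQ_inverse_real_of_nat])
    from Lim_null_comparison[OF always_eventually[OF allI[OF bnd]] this]
    have "(\<lambda>n. (\<integral>x. \<phi> (shift_map x) \<partial>\<nu> n) - (\<integral>x. \<phi> x \<partial>\<nu> n)) \<longlonglongrightarrow> 0" .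
    from LIMSEQ_subseq_LIMSEQ[OF this s]
    have "(\<lambda>n. (\<integral>x. \<phi> (shift_map x) \<partial>\<nu> (s n)) - (\<integral>x. \<phi> x \<partial>\<nu> (s n))) \<longlonglongrightarrow> 0"
      by (simp add: comp_def)
    then have "0 = (\<integral>x. \<phi> (shift_map x) \<partial>\<mu>) - (\<integral>x. \<phi> x \<partial>\<mu>)"
      by (rule LIMSEQ_unique[OF _ tendsto_diff[OF conv[OF c] conv[OF \<phi>(1)]]])
    then show ?thesis by simp
  qed
  have cont_cyl: "continuous_on UNIV (indicat_real (cylinder x n))" for x n
  proof (rule continuous_on_cylinderI)
    fix z and e :: real assume "0 < e"
    have "y \<in> cylinder x n \<longleftrightarrow> z \<in> cylinder x n" if "y \<in> cylinder z n" for y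
      using cylinder_eqI[OF that] cylinder_eqI[of z x n] cylinder_eqI[of y x n] that
        cylinder_self[of z n] by blast
    then show "\<exists>m. \<forall>y\<in>UNIV \<inter> cylinder z m. dist (indicat_real (cylinder x n) y) (indicat_real (cylinder x n) z) < e"
      using \<open>0 < e\<close> by (intro exI[of _ n]) (simp add: indicator_def)
  qed
  have [measurable]: "cylinder x n \<in> sets borel" for x n using open_cylinder by simp
  have inv: "distr \<mu> borel shift_map = \<mu>"
  proof (rule measure_eqI_cylinders)
    show "finite_measure (distr \<mu> borel shift_map)"
      by (intro \<mu>.finite_measure_distr) measurable
    fix x n
    let ?C = "cylinder x n"
    have "(\<integral>x. indicat_real ?C (shift_map x) \<partial>\<mu>) = (\<integral>x. indicat_real ?C x \<partial>\<mu>)"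
      by (intro int_shift cont_cyl) (auto simp: indicator_def)
    moreover have "(\<integral>x. indicat_real ?C (shift_map x) \<partial>\<mu>) = measure (distr \<mu> borel shift_map) ?C"
      using integral_distr[of shift_map \<mu> borel "indicat_real ?C"] by simp
    ultimately show "emeasure (distr \<mu> borel shift_map) ?C = emeasure \<mu> ?C"
      by (simp add: \<mu>.emeasure_eq_measure
          finite_measure.emeasure_eq_measure[OF \<mu>.finite_measure_distr[of shift_map borel]])
  qed (use \<mu> in auto)
  have "AE x in \<mu>. x \<in> E"
  proof -
    obtain F where F: "countable F" "F \<subseteq> range (case_prod cylinder)" "- E = \<Union>F"
      using open_eq_countable_Union_cylinders[of "- E"] E(1) by (auto simp: open_Compl)
    have "AE x in \<mu>. x \<notin> C" if "C \<in> F" for C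
    proof -
      have "C \<in> range (case_prod cylinder)" using that F(2) by blast
      then obtain y n where C: "C = cylinder y n" by auto
      have "(\<integral>x. indicat_real C x \<partial>\<nu> m) = 0" for m
      proof (rule integral_eq_zero_AE)
        show "AE x in \<nu> m. indicat_real C x = 0"
          using AEE[of m] by eventually_elim (use F(3) that in \<open>auto simp: indicator_def\<close>)
      qed
      moreover have "(\<lambda>n. \<integral>x. indicat_real C x \<partial>(\<nu> (s n))) \<longlonglongrightarrow> (\<integral>x. indicat_real C x \<partial>\<mu>)"
        unfolding C by (rule conv[OF cont_cyl])
      ultimately have "measure \<mu> C = 0" using C by (simp add: LIMSEQ_const_iff)
      then show ?thesis using C
        by (intro AE_I[of _ _ C]) (auto simp: \<mu>.emeasure_eq_measure)
    qed
    then have "AE x in \<mu>. \<forall>C\<in>F. x \<notin> C" using F(1) by (simp add: AE_ball_countable)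
    then show ?thesis by eventually_elim (use F(3) in auto)
  qed
  with \<mu> inv show ?thesis by (rule that)
qed

section \<open>Words and periodic points\<close>

locale subshift_system =
  fixes r :: nat and M :: "nat \<Rightarrow> nat \<Rightarrow> nat" and \<Lambda> :: real
  assumes transition: "transition_matrix r M" and symmetric: "symmetric_matrix r M"
    and irreducible: "irreducible_matrix r M" and \<Lambda>_pos: "0 < \<Lambda>" and \<Lambda>_less: "\<Lambda> < 1"
begin

abbreviation "S \<equiv> subshift r M"
abbreviation "d \<equiv> seq_dist \<Lambda>"
abbreviation "\<sigma> \<equiv> shift_map"

lemmas d_nonneg = seq_dist_nonneg[OF \<Lambda>_pos]
lemmas d_le_1 = seq_dist_le_1[OF \<Lambda>_pos \<Lambda>_less]
lemmas d_case_nat = seq_dist_case_nat[OF \<Lambda>_pos \<Lambda>_less]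
lemmas d_le_power = seq_dist_le_power[OF \<Lambda>_pos \<Lambda>_less]

lemma in_S: "x \<in> S \<longleftrightarrow> (\<forall>j. x j \<in> {1..r} \<and> M (x j) (x (Suc j)) = 1)"
  by (simp add: subshift_def)

lemma dual_eq: "dual_subshift r M = S"
  by (rule dual_subshift_eq_subshift[OF symmetric])

lemma M_sym: "i \<in> {1..r} \<Longrightarrow> j \<in> {1..r} \<Longrightarrow> M i j = M j i"
  using symmetric unfolding symmetric_matrix_def by blast

lemma letter_in: "x \<in> S \<Longrightarrow> x j \<in> {1..r}"
  by (simp add: in_S)

lemma shift_in_S: "x \<in> S \<Longrightarrow> \<sigma> x \<in> S"
  by (simp add: in_S)

lemma shift_funpow_in_S: "x \<in> S \<Longrightarrow> (\<sigma> ^^ n) x \<in> S"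
  by (induction n) (auto intro: shift_in_S)

lemma case_nat_in_S: "x \<in> S \<Longrightarrow> a \<in> {1..r} \<Longrightarrow> M a (x 0) = 1 \<Longrightarrow> case_nat a x \<in> S"
  by (simp add: in_S split: nat.split)

lemma closed_S: "closed S"
proof -
  have "closed {x :: nat \<Rightarrow> nat. x j \<in> {1..r} \<and> M (x j) (x (Suc j)) = 1}" for j
    unfolding closed_def
  proof (rule topological_space_class.openI)
    fix x assume x: "x \<in> - {x :: nat \<Rightarrow> nat. x j \<in> {1..r} \<and> M (x j) (x (Suc j)) = 1}"
    have "y \<in> - {x :: nat \<Rightarrow> nat. x j \<in> {1..r} \<and> M (x j) (x (Suc j)) = 1}"
      if "y \<in> cylinder x (Suc j)" for y
    proof -
      have "x j = y j" "x (Suc j) = y (Suc j)" using that unfolding cylinder_def by simp_all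
      then show ?thesis using x by simp
    qed
    then show "\<exists>T. open T \<and> x \<in> T \<and> T \<subseteq> - {x :: nat \<Rightarrow> nat. x j \<in> {1..r} \<and> M (x j) (x (Suc j)) = 1}"
      by (intro exI[of _ "cylinder x (Suc j)"] conjI subsetI open_cylinder cylinder_self)
  qed
  moreover have "S = (\<Inter>j. {x :: nat \<Rightarrow> nat. x j \<in> {1..r} \<and> M (x j) (x (Suc j)) = 1})"
    by (auto simp: in_S)
  ultimately show ?thesis by auto
qed

lemma S_sets [measurable]: "S \<in> sets borel"
  using closed_S by simp

lemma word_exists:
  assumes "0 < matrix_power r M n i j" "i \<in> {1..r}" "j \<in> {1..r}"
  shows "\<exists>w. w 0 = i \<and> w n = j \<and> (\<forall>k\<le>n. w k \<in> {1..r}) \<and> (\<forall>k<n. M (w k) (w (Suc k)) = 1)"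
  using assms
proof (induction n arbitrary: i)
  case 0
  then show ?case by (intro exI[of _ "\<lambda>_. i"]) (auto split: if_splits)
next
  case (Suc n)
  then obtain k where k: "k \<in> {1..r}" "0 < M i k * matrix_power r M n k j"
    by (metis (no_types, lifting) gr_zeroI matrix_power.simps(2) sum.neutral)
  then obtain w where w: "w 0 = k" "w n = j" "\<forall>l\<le>n. w l \<in> {1..r}" "\<forall>l<n. M (w l) (w (Suc l)) = 1"
    using Suc.IH[of k] Suc.prems by auto
  have "M i k = 1" using k Suc.prems(2) transition unfolding transition_matrix_def by fastforce
  then show ?case
    using w Suc.prems(2)
    by (intro exI[of _ "case_nat i w"]) (auto split: nat.split simp: less_Suc_eq_0_disj)
qed

text \<open>There are only finitely many pairs of letters, so irreducibility gives paths of uniformly bounded length.\<close>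

lemma connecting_point:
  obtains D where "\<And>x y. x \<in> S \<Longrightarrow> y \<in> S \<Longrightarrow>
    \<exists>l z. 1 \<le> l \<and> l \<le> D \<and> z \<in> S \<and> z 0 = x 0 \<and> (\<sigma> ^^ l) z = y"
proof -
  have "\<forall>i\<in>{1..r}. \<forall>j\<in>{1..r}. \<exists>n\<ge>1. matrix_power r M n i j > 0"
    using irreducible unfolding irreducible_matrix_def .
  then obtain L where L: "\<And>i j. i \<in> {1..r} \<Longrightarrow> j \<in> {1..r} \<Longrightarrow> 1 \<le> L i j \<and> 0 < matrix_power r M (L i j) i j"
    by metis
  define D where "D = (\<Sum>i\<in>{1..r}. \<Sum>j\<in>{1..r}. L i j)"
  have LD: "L i j \<le> D" if "i \<in> {1..r}" "j \<in> {1..r}" for i j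
  proof -
    have "L i j \<le> (\<Sum>j\<in>{1..r}. L i j)" using that by (intro member_le_sum) auto
    also have "\<dots> \<le> D" unfolding D_def using that by (intro member_le_sum) auto
    finally show ?thesis .
  qed
  have "\<exists>l z. 1 \<le> l \<and> l \<le> D \<and> z \<in> S \<and> z 0 = x 0 \<and> (\<sigma> ^^ l) z = y" if x: "x \<in> S" and y: "y \<in> S" for x y
  proof -
    define l where "l = L (x 0) (y 0)"
    have l: "1 \<le> l" "l \<le> D" "0 < matrix_power r M l (x 0) (y 0)"
      using L LD letter_in[OF x] letter_in[OF y] by (auto simp: l_def)
    then obtain w where w: "w 0 = x 0" "w l = y 0" "\<forall>k\<le>l. w k \<in> {1..r}" "\<forall>k<l. M (w k) (w (Suc k)) = 1"
      using word_exists[OF l(3) letter_in[OF x] letter_in[OF y]] by blast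
    define z where "z k = (if k < l then w k else y (k - l))" for k
    have "z \<in> S" unfolding in_S
    proof
      fix j
      consider "Suc j < l" | "Suc j = l" | "l \<le> j" by linarith
      then show "z j \<in> {1..r} \<and> M (z j) (z (Suc j)) = 1"
      proof cases
        case 2
        then have "M (w j) (w (Suc j)) = 1" "w j \<in> {1..r}" using w by auto
        then show ?thesis using 2 w(2) by (simp add: z_def)
      next
        case 3
        then show ?thesis using y by (simp add: z_def in_S Suc_diff_le)
      qed (use w in \<open>simp add: z_def\<close>)
    qed
    moreover have "z 0 = x 0" using l w by (simp add: z_def)
    moreover have "(\<sigma> ^^ l) z = y" by (simp add: shift_map_funpow z_def)
    ultimately show ?thesis using l by blast
  qed
  then show ?thesis by (rule that)
qed

lemma periodic_point:
  assumes q: "q \<in> S" "q N = q 0" and N: "1 \<le> N"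
  shows "(\<lambda>k. q (k mod N)) \<in> S" "(\<sigma> ^^ N) (\<lambda>k. q (k mod N)) = (\<lambda>k. q (k mod N))"
proof -
  have "M (q (k mod N)) (q (Suc k mod N)) = 1" for k
  proof (cases "Suc (k mod N) = N")
    case True
    then have "Suc k mod N = 0" by (simp add: mod_Suc)
    then show ?thesis using q True by (metis in_S)
  next
    case False
    then have "Suc k mod N = Suc (k mod N)" by (simp add: mod_Suc)
    then show ?thesis using q by (simp add: in_S)
  qed
  then show "(\<lambda>k. q (k mod N)) \<in> S" using q by (simp add: in_S)
  show "(\<sigma> ^^ N) (\<lambda>k. q (k mod N)) = (\<lambda>k. q (k mod N))" by (simp add: shift_map_funpow)
qed

text \<open>Every orbit segment is shadowed by a periodic orbit whose period exceeds the length of the segment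
by a bounded amount only. This transfers the bound on integrals against periodic orbit measures to
Birkhoff sums along arbitrary segments.\<close>

lemma closing_point:
  obtains D where "\<And>z n. z \<in> S \<Longrightarrow> 1 \<le> n \<Longrightarrow>
    \<exists>p N. p \<in> S \<and> n \<le> N \<and> N \<le> n + D \<and> (\<sigma> ^^ N) p = p \<and> (\<forall>k<n. p k = z k)"
proof -
  obtain D where D: "\<And>x y. x \<in> S \<Longrightarrow> y \<in> S \<Longrightarrow>
    \<exists>l z. 1 \<le> l \<and> l \<le> D \<and> z \<in> S \<and> z 0 = x 0 \<and> (\<sigma> ^^ l) z = y"
    using connecting_point by blast
  have "\<exists>p N. p \<in> S \<and> n \<le> N \<and> N \<le> n + D \<and> (\<sigma> ^^ N) p = p \<and> (\<forall>k<n. p k = z k)"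
    if z: "z \<in> S" and n: "1 \<le> n" for z n
  proof -
    obtain l c where c: "1 \<le> l" "l \<le> D" "c \<in> S" "c 0 = z (n - 1)" "(\<sigma> ^^ l) c = z"
      using D[OF shift_funpow_in_S[OF z, of "n - 1"] z] by (auto simp: shift_map_funpow)
    \<comment> \<open>The connecting path starts at the last letter of the segment, hence the offset by n - 1.\<close>
    define q where "q k = (if k < n then z k else c (k - (n - 1)))" for k
    define N where "N = n - 1 + l"
    have q: "q \<in> S" unfolding in_S
    proof
      fix j
      consider "Suc j < n" | "Suc j = n" | "n \<le> j" by linarith
      then show "q j \<in> {1..r} \<and> M (q j) (q (Suc j)) = 1"
      proof cases
        case 2
        then have "q j = c 0" "q (Suc j) = c (Suc 0)" using c by (auto simp: q_def)
        then show ?thesis using c(3) by (simp add: in_S)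
      next
        case 3
        then have "q j = c (j - (n - 1))" "q (Suc j) = c (Suc (j - (n - 1)))"
          using n by (auto simp: q_def Suc_diff_le)
        then show ?thesis using c(3) by (simp add: in_S)
      qed (use z in \<open>simp add: q_def in_S\<close>)
    qed
    have "c l = z 0" using c(5) by (metis shift_map_funpow add.right_neutral)
    then have "q N = q 0" using n c by (auto simp: q_def N_def)
    moreover have "n \<le> N" "N \<le> n + D" "1 \<le> N" using n c by (auto simp: N_def)
    ultimately show ?thesis
      using periodic_point[OF q] by (intro exI[of _ "\<lambda>k. q (k mod N)"] exI[of _ N]) (auto simp: q_def)
  qed
  then show ?thesis by (rule that)
qed

lemma orbit_measure_invariant:
  assumes "p \<in> S" "(\<sigma> ^^ N) p = p" "0 < N"
  shows "orbit_measure (restrict_space borel S) N p \<in> invariant_measures r M"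
proof -
  let ?R = "restrict_space borel S"
  have sp: "(\<sigma> ^^ k) p \<in> space ?R" for k
    using shift_funpow_in_S[OF assms(1)] by (simp add: space_restrict_space)
  have ms [measurable]: "\<sigma> \<in> measurable ?R ?R"
    by (intro measurable_restrict_space2 measurable_restrict_space1 measurable_shift_map)
       (auto simp: space_restrict_space shift_in_S)
  interpret prob_space "orbit_measure ?R N p" by (rule prob_space_orbit_measure[OF sp])
  have "distr (orbit_measure ?R N p) ?R \<sigma> = orbit_measure ?R N p"
  proof (rule measure_eqI)
    fix B assume "B \<in> sets (distr (orbit_measure ?R N p) ?R \<sigma>)"
    then have [measurable]: "B \<in> sets ?R" by simp
    have ms': "\<sigma> \<in> measurable (orbit_measure ?R N p) ?R"
      using ms by (simp add: orbit_measure_def)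
    have pre: "\<sigma> -` B \<inter> space ?R \<in> sets ?R" by measurable
    have m: "measure (orbit_measure ?R N p) X = (\<Sum>k<N. indicat_real X ((\<sigma> ^^ k) p)) / N"
      if "X \<in> sets ?R" for X
      using integral_orbit_measure[OF sp _ assms(3), of "indicat_real X"] that
        sets.sets_into_space[OF that]
      by (simp add: Int_absorb2)
    have "measure (distr (orbit_measure ?R N p) ?R \<sigma>) B =
       measure (orbit_measure ?R N p) (\<sigma> -` B \<inter> space ?R)"
      by (subst measure_distr[OF ms']) simp_all
    also have "\<dots> = (\<Sum>k<N. indicat_real B (\<sigma> ((\<sigma> ^^ k) p))) / N"
      unfolding m[OF pre] using sp by (simp add: indicator_def)
    also have "\<dots> = measure (orbit_measure ?R N p) B"
      unfolding sum_orbit_shift assms(2) using m[of B] by simp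
    finally show "emeasure (distr (orbit_measure ?R N p) ?R \<sigma>) B = emeasure (orbit_measure ?R N p) B"
      by (simp add: emeasure_eq_measure finite_measure.emeasure_eq_measure[OF finite_measure_distr[OF ms']])
  qed simp
  then show ?thesis unfolding invariant_measures_def by (simp add: prob_space_axioms)
qed

end

section \<open>Calibrated sub-actions\<close>

\<comment> \<open>From here on iterates of the shift are manipulated as functions, not coordinatewise.\<close>
declare shift_map_apply [simp del]

context subshift_system
begin

lemma invariant_measureD:
  assumes "\<mu> \<in> invariant_measures r M"
  shows "prob_space \<mu>" "sets \<mu> = sets (restrict_space borel S)" "space \<mu> = S"
    "distr \<mu> (restrict_space borel S) \<sigma> = \<mu>"
proof -
  show "prob_space \<mu>" and sets: "sets \<mu> = sets (restrict_space borel S)"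
    and "distr \<mu> (restrict_space borel S) \<sigma> = \<mu>"
    using assms unfolding invariant_measures_def by blast+
  show "space \<mu> = S"
    using sets_eq_imp_space_eq[OF sets] by (simp add: space_restrict_space)
qed

lemma measurable_shift_on_S [measurable]:
  "\<sigma> \<in> measurable (restrict_space borel S) (restrict_space borel S)"
  by (intro measurable_restrict_space2 measurable_restrict_space1 measurable_shift_map)
     (auto simp: space_restrict_space shift_in_S)

end

text \<open>The limit superior of a sequence whose terms are bounded above and infinitely often bounded below,
stated through the two properties by which it is used.\<close>

lemma real_limsup_exists:
  fixes a :: "nat \<Rightarrow> real"
  assumes up: "\<And>n. a n \<le> C" and low: "\<And>n. \<exists>k\<ge>n. c \<le> a k"
  shows "\<exists>l. \<forall>e>0. (\<exists>N. \<forall>n\<ge>N. a n < l + e) \<and> (\<forall>N. \<exists>n\<ge>N. l - e < a n)"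
proof -
  define s where "s n = (SUP k\<in>{n..}. a k)" for n
  have bdd: "bdd_above (a ` {n..})" for n by (rule bdd_aboveI[of _ C]) (use up in blast)
  have s_ge: "a k \<le> s n" if "n \<le> k" for n k
    unfolding s_def by (rule cSUP_upper[OF _ bdd]) (simp add: that)
  have s_low: "c \<le> s n" for n
    using low[of n] s_ge order_trans by blast
  define l where "l = (INF n. s n)"
  have bdd': "bdd_below (range s)" by (rule bdd_belowI[of _ c]) (use s_low in blast)
  have l_le: "l \<le> s n" for n unfolding l_def by (intro cINF_lower bdd') simp
  show ?thesis
  proof (intro exI[of _ l] allI impI conjI)
    fix e :: real assume "0 < e"
    then have "Inf (range s) < l + e" unfolding l_def by simp
    then obtain N where "s N < l + e" using cInf_lessD[of "range s" "l + e"] by blast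
    then show "\<exists>N. \<forall>n\<ge>N. a n < l + e" using s_ge order.strict_trans1 by blast
    fix N
    have "l - e < s N" using l_le[of N] \<open>0 < e\<close> by simp
    then show "\<exists>n\<ge>N. l - e < a n"
      unfolding s_def using less_cSUP_iff[of "{N..}" a "l - e"] bdd[of N] by (simp add: Bex_def)
  qed
qed

text \<open>The last two assumptions say that \<open>m\<close> is the supremum of the integrals over invariant measures, without
assuming that it is attained.\<close>

locale critical_potential = subshift_system +
  fixes f :: "(nat \<Rightarrow> nat) \<Rightarrow> real" and m L :: real
  assumes L_nonneg: "0 \<le> L"
    and f_lip: "\<And>x y. x \<in> S \<Longrightarrow> y \<in> S \<Longrightarrow> \<bar>f x - f y\<bar> \<le> L * d x y"
    and integral_le: "\<And>\<mu>. \<mu> \<in> invariant_measures r M \<Longrightarrow> (\<integral>x. f x \<partial>\<mu>) \<le> m"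
    and integral_approx: "\<And>e. 0 < e \<Longrightarrow> \<exists>\<mu>\<in>invariant_measures r M. m - e < (\<integral>x. f x \<partial>\<mu>)"
begin

\<comment> \<open>On cylinders the Lipschitz constant K is preserved by passing to preimages: (L + K) * \<Lambda> \<le> K.\<close>
abbreviation "K \<equiv> L / (1 - \<Lambda>)"
abbreviation "birkhoff n x \<equiv> (\<Sum>k<n. f ((\<sigma> ^^ k) x) - m)"

lemma K_nonneg: "0 \<le> K"
  using L_nonneg \<Lambda>_less by simp

lemma S_nonempty: "S \<noteq> {}"
proof -
  obtain \<mu> where "\<mu> \<in> invariant_measures r M" using integral_approx[of 1] by auto
  then show ?thesis using prob_space.not_empty[OF invariant_measureD(1)] invariant_measureD(3) by simp
qed

lemma f_bounded: obtains B where "0 \<le> B" "\<And>x. x \<in> S \<Longrightarrow> \<bar>f x - m\<bar> \<le> B"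
proof -
  obtain z where z: "z \<in> S" using S_nonempty by blast
  show ?thesis
  proof (rule that[of "L + \<bar>f z - m\<bar>"])
    fix x assume x: "x \<in> S"
    have "\<bar>f x - f z\<bar> \<le> L * d x z" by (rule f_lip[OF x z])
    also have "\<dots> \<le> L * 1" by (intro mult_left_mono d_le_1 L_nonneg)
    finally show "\<bar>f x - m\<bar> \<le> L + \<bar>f z - m\<bar>" by linarith
  qed (use L_nonneg in simp)
qed

lemma f_measurable [measurable]: "f \<in> borel_measurable (restrict_space borel S)"
  by (intro borel_measurable_continuous_on_restrict continuous_on_seq_dist_lipschitz[OF \<Lambda>_pos \<Lambda>_less f_lip])

lemma birkhoff_periodic_le:
  assumes "p \<in> S" "(\<sigma> ^^ N) p = p" "0 < N"
  shows "birkhoff N p \<le> 0"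
proof -
  have "(\<Sum>k<N. f ((\<sigma> ^^ k) p)) / N \<le> m"
    using integral_le[OF orbit_measure_invariant[OF assms]]
      integral_orbit_measure[of p "restrict_space borel S" f N] shift_funpow_in_S[OF assms(1)] assms(3)
    by (simp add: space_restrict_space)
  then show ?thesis using assms(3) by (simp add: sum_subtractf field_simps)
qed

text \<open>The Birkhoff sums of \<open>f - m\<close> along periodic orbits are nonpositive. A segment and its closing stay
exponentially close while the segment lasts, which costs a geometric series, and the closing adds boundedly many
further terms.\<close>

lemma birkhoff_bounded_above:
  obtains C where "\<And>n z. z \<in> S \<Longrightarrow> birkhoff n z \<le> C"
proof -
  obtain B where B: "0 \<le> B" "\<And>x. x \<in> S \<Longrightarrow> \<bar>f x - m\<bar> \<le> B" using f_bounded by blast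
  obtain D where D: "\<And>z n. z \<in> S \<Longrightarrow> 1 \<le> n \<Longrightarrow>
    \<exists>p N. p \<in> S \<and> n \<le> N \<and> N \<le> n + D \<and> (\<sigma> ^^ N) p = p \<and> (\<forall>k<n. p k = z k)"
    using closing_point by blast
  have "birkhoff n z \<le> K + D * B" if z: "z \<in> S" for n z
  proof (cases "n = 0")
    case True
    then show ?thesis using K_nonneg B(1) by simp
  next
    case False
    then obtain p N where p: "p \<in> S" "n \<le> N" "N \<le> n + D" "(\<sigma> ^^ N) p = p" "\<forall>k<n. p k = z k"
      using D[OF z, of n] by auto
    have "birkhoff n z - birkhoff n p = (\<Sum>k<n. f ((\<sigma> ^^ k) z) - f ((\<sigma> ^^ k) p))"
      by (simp add: sum_subtractf)
    also have "\<dots> \<le> (\<Sum>k<n. L * \<Lambda> ^ (n - Suc k))"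
    proof (rule sum_mono)
      fix k assume k: "k \<in> {..<n}"
      have "f ((\<sigma> ^^ k) z) - f ((\<sigma> ^^ k) p) \<le> L * d ((\<sigma> ^^ k) z) ((\<sigma> ^^ k) p)"
        using f_lip[OF shift_funpow_in_S[OF z, of k] shift_funpow_in_S[OF p(1), of k]] by linarith
      also have "\<dots> \<le> L * \<Lambda> ^ (n - Suc k)"
        using k p(5) by (intro mult_left_mono L_nonneg d_le_power) (auto simp: shift_map_funpow)
      finally show "f ((\<sigma> ^^ k) z) - f ((\<sigma> ^^ k) p) \<le> L * \<Lambda> ^ (n - Suc k)" .
    qed
    also have "\<dots> = L * (\<Sum>k<n. \<Lambda> ^ k)"
      by (simp add: sum.nat_diff_reindex sum_distrib_left[symmetric])
    also have "\<dots> = L * ((1 - \<Lambda> ^ n) / (1 - \<Lambda>))"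
      using \<Lambda>_less by (simp add: sum_gp_strict)
    also have "\<dots> \<le> K"
    proof -
      have "L * (1 - \<Lambda> ^ n) \<le> L * 1" using \<Lambda>_pos by (intro mult_left_mono L_nonneg) simp
      then show ?thesis using \<Lambda>_less by (simp add: divide_right_mono)
    qed
    finally have 1: "birkhoff n z \<le> birkhoff n p + K" by simp
    have "birkhoff N p = birkhoff n p + (\<Sum>k=n..<N. f ((\<sigma> ^^ k) p) - m)"
      using p(2) by (simp add: sum.atLeastLessThan_concat lessThan_atLeast0)
    moreover have "- (\<Sum>k=n..<N. f ((\<sigma> ^^ k) p) - m) \<le> D * B"
    proof -
      have "\<bar>\<Sum>k=n..<N. f ((\<sigma> ^^ k) p) - m\<bar> \<le> (\<Sum>k=n..<N. B)"
        by (intro order_trans[OF sum_abs] sum_mono B shift_funpow_in_S p)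
      also have "\<dots> = real (N - n) * B" by simp
      also have "\<dots> \<le> D * B" using p(3) B(1) by (intro mult_right_mono) auto
      finally show ?thesis by linarith
    qed
    moreover have "birkhoff N p \<le> 0" using False p by (intro birkhoff_periodic_le) auto
    ultimately show ?thesis using 1 by linarith
  qed
  then show ?thesis by (rule that)
qed

definition predecessors :: "(nat \<Rightarrow> nat) \<Rightarrow> nat set" where
  "predecessors x = {a\<in>{1..r}. M a (x 0) = 1}"

lemma finite_predecessors: "finite (predecessors x)"
  by (simp add: predecessors_def)

lemma predecessors_nonempty: "x \<in> S \<Longrightarrow> predecessors x \<noteq> {}"
  using M_sym[of "x 0" "x 1"] by (auto simp: predecessors_def in_S intro!: exI[of _ "x 1"])

lemma predecessor_in_S: "x \<in> S \<Longrightarrow> a \<in> predecessors x \<Longrightarrow> case_nat a x \<in> S"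
  by (auto simp: predecessors_def intro: case_nat_in_S)

lemma head_predecessor: "x \<in> S \<Longrightarrow> x 0 \<in> predecessors (\<sigma> x)"
  by (simp add: predecessors_def in_S shift_map_apply)

text \<open>The iterates, started at zero, of the Lax-Oleinik operator
\<open>u \<mapsto> (y \<mapsto> max {f x - m + u x | \<sigma> x = y})\<close>, whose fixed points are the calibrated sub-actions.\<close>

primrec iterate :: "nat \<Rightarrow> (nat \<Rightarrow> nat) \<Rightarrow> real" where
  "iterate 0 x = 0"
| "iterate (Suc n) x = Max ((\<lambda>a. f (case_nat a x) - m + iterate n (case_nat a x)) ` predecessors x)"

lemma iterate_ge:
  assumes "x \<in> S"
  shows "f x - m + iterate n x \<le> iterate (Suc n) (\<sigma> x)"
proof -
  have "f (case_nat (x 0) (\<sigma> x)) - m + iterate n (case_nat (x 0) (\<sigma> x)) \<le> iterate (Suc n) (\<sigma> x)"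
    unfolding iterate.simps using head_predecessor[OF assms] finite_predecessors
    by (intro Max_ge finite_imageI) blast+
  then show ?thesis by (simp only: case_nat_shift_map)
qed

lemma iterate_attained:
  assumes "y \<in> S"
  obtains a where "a \<in> predecessors y"
    "iterate (Suc n) y = f (case_nat a y) - m + iterate n (case_nat a y)"
proof -
  have "iterate (Suc n) y \<in> (\<lambda>a. f (case_nat a y) - m + iterate n (case_nat a y)) ` predecessors y"
    unfolding iterate.simps
    by (intro Max_in finite_imageI finite_predecessors) (use predecessors_nonempty[OF assms] in simp)
  then show ?thesis using that by blast
qed

lemma iterate_birkhoff:
  assumes "y \<in> S"
  shows "\<exists>z\<in>S. iterate n y = birkhoff n z"
proof -
  have "\<exists>z\<in>S. (\<sigma> ^^ n) z = y \<and> iterate n y = birkhoff n z"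
    using assms
  proof (induction n arbitrary: y)
    case 0
    then show ?case by auto
  next
    case (Suc n)
    obtain a where a: "a \<in> predecessors y"
      "iterate (Suc n) y = f (case_nat a y) - m + iterate n (case_nat a y)"
      using iterate_attained[OF Suc.prems] by blast
    obtain z where z: "z \<in> S" "(\<sigma> ^^ n) z = case_nat a y" "iterate n (case_nat a y) = birkhoff n z"
      using Suc.IH[OF predecessor_in_S[OF Suc.prems a(1)]] by blast
    have "(\<sigma> ^^ Suc n) z = y" using z(2) by simp
    moreover have "iterate (Suc n) y = birkhoff (Suc n) z"
      unfolding a(2) z(3) sum.lessThan_Suc z(2) by simp
    ultimately show ?case using z(1) by blast
  qed
  then show ?thesis by blast
qed

lemma iterate_ge_birkhoff:
  assumes "x \<in> S"
  shows "birkhoff l x + iterate n x \<le> iterate (n + l) ((\<sigma> ^^ l) x)"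
proof (induction l)
  case (Suc l)
  then show ?case using iterate_ge[OF shift_funpow_in_S[OF assms, of l], of "n + l"]
    by (simp del: iterate.simps)
qed simp

lemma iterate_lip:
  assumes "x \<in> S" "y \<in> S" "x 0 = y 0"
  shows "\<bar>iterate n x - iterate n y\<bar> \<le> K * d x y"
proof -
  have "iterate n x - iterate n y \<le> K * d x y" if "x \<in> S" "y \<in> S" "x 0 = y 0" for x y
    using that
  proof (induction n arbitrary: x y)
    case 0
    then show ?case using mult_nonneg_nonneg[OF K_nonneg d_nonneg] by simp
  next
    case (Suc n)
    obtain a where a: "a \<in> predecessors x"
      "iterate (Suc n) x = f (case_nat a x) - m + iterate n (case_nat a x)"
      using iterate_attained[OF Suc.prems(1)] by blast
    let ?x = "case_nat a x" and ?y = "case_nat a y"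
    have a': "a \<in> predecessors y" using a(1) Suc.prems by (simp add: predecessors_def)
    have S: "?x \<in> S" "?y \<in> S" using predecessor_in_S a(1) a' Suc.prems by blast+
    have "f ?y - m + iterate n ?y \<le> iterate (Suc n) y"
      using iterate_ge[OF S(2)] by simp
    moreover have "iterate n ?x - iterate n ?y \<le> K * d ?x ?y" using S by (intro Suc.IH) simp_all
    moreover have "f ?x - f ?y \<le> L * d ?x ?y" using f_lip[OF S] by linarith
    ultimately have "iterate (Suc n) x - iterate (Suc n) y \<le> L * d ?x ?y + K * d ?x ?y"
      using a(2) by linarith
    also have "\<dots> = (L + K) * \<Lambda> * d x y" by (simp add: d_case_nat algebra_simps)
    also have "\<dots> \<le> K * d x y"
    proof (rule mult_right_mono[OF _ d_nonneg])
      have "0 \<le> (1 - \<Lambda>)\<^sup>2" by simp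
      then have "L * (\<Lambda> * (2 - \<Lambda>)) \<le> L * 1"
        by (intro mult_left_mono L_nonneg) (simp add: power2_eq_square algebra_simps)
      moreover have "(L + K) * \<Lambda> = L * (\<Lambda> * (2 - \<Lambda>)) / (1 - \<Lambda>)"
        using \<Lambda>_less by (simp add: field_simps)
      ultimately show "(L + K) * \<Lambda> \<le> K" using \<Lambda>_less by (simp add: divide_right_mono)
    qed
    finally show ?case .
  qed
  from this[of x y] this[of y x] show ?thesis using assms by (auto simp: seq_dist_commute abs_le_iff)
qed

lemma integral_shift_funpow:
  assumes "\<mu> \<in> invariant_measures r M"
  shows "(\<integral>x. f ((\<sigma> ^^ k) x) \<partial>\<mu>) = (\<integral>x. f x \<partial>\<mu>)"
proof (induction k)
  case (Suc k)
  note \<mu> = invariant_measureD(2,4)[OF assms]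
  have [measurable]: "(\<sigma> ^^ k) \<in> measurable (restrict_space borel S) (restrict_space borel S)"
    by (rule measurable_compose_n) (rule measurable_shift_on_S)
  have "\<sigma> \<in> measurable \<mu> (restrict_space borel S)"
    unfolding measurable_cong_sets[OF \<mu>(1) refl] by (rule measurable_shift_on_S)
  from integral_distr[OF this, of "\<lambda>x. f ((\<sigma> ^^ k) x)"]
  have "(\<integral>x. f ((\<sigma> ^^ k) x) \<partial>\<mu>) = (\<integral>x. f ((\<sigma> ^^ k) (\<sigma> x)) \<partial>\<mu>)"
    unfolding \<mu>(2) by measurable
  then show ?case using Suc by (simp add: funpow_swap1)
qed simp

text \<open>This is where \<open>m\<close> must not exceed the supremum of the integrals: if the \<open>n\<close>-th iterate were at
most \<open>-1\<close> everywhere, so would be the Birkhoff sum of length \<open>n\<close>, and no invariant measure could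
have integral above \<open>m - 1/n\<close>.\<close>

lemma iterate_not_very_negative:
  shows "\<exists>x\<in>S. -1 < iterate n x"
proof (rule ccontr)
  assume "\<not> ?thesis"
  then have neg: "iterate n x \<le> -1" if "x \<in> S" for x using that by (meson not_le)
  have "n \<noteq> 0"
  proof
    assume "n = 0"
    then show False using neg S_nonempty by fastforce
  qed
  then obtain \<mu> where \<mu>: "\<mu> \<in> invariant_measures r M" "m - 1 / n < (\<integral>x. f x \<partial>\<mu>)"
    using integral_approx[of "1 / n"] by auto
  interpret prob_space \<mu> by (rule invariant_measureD(1)[OF \<mu>(1)])
  note sets [measurable_cong] = invariant_measureD(2)[OF \<mu>(1)]
  note space = invariant_measureD(3)[OF \<mu>(1)]
  obtain B where B: "0 \<le> B" "\<And>x. x \<in> S \<Longrightarrow> \<bar>f x - m\<bar> \<le> B" using f_bounded by blast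
  have [measurable]: "(\<sigma> ^^ k) \<in> measurable (restrict_space borel S) (restrict_space borel S)" for k
    by (rule measurable_compose_n) (rule measurable_shift_on_S)
  have int: "integrable \<mu> (\<lambda>x. f ((\<sigma> ^^ k) x))" for k
  proof (rule integrable_const_bound[where B = "B + \<bar>m\<bar>"])
    have "norm (f ((\<sigma> ^^ k) x)) \<le> B + \<bar>m\<bar>" if "x \<in> space \<mu>" for x
      using B(2)[OF shift_funpow_in_S, of x k] that unfolding space by simp
    then show "AE x in \<mu>. norm (f ((\<sigma> ^^ k) x)) \<le> B + \<bar>m\<bar>" by (rule AE_I2)
  qed measurable
  have "(\<integral>x. birkhoff n x \<partial>\<mu>) = (\<Sum>k<n. (\<integral>x. f ((\<sigma> ^^ k) x) - m \<partial>\<mu>))"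
    using int by (intro Bochner_Integration.integral_sum) auto
  also have "\<dots> = n * ((\<integral>x. f x \<partial>\<mu>) - m)"
    using int by (simp add: Bochner_Integration.integral_diff integral_shift_funpow[OF \<mu>(1)] prob_space)
  also have "\<dots> > -1" using \<mu>(2) \<open>n \<noteq> 0\<close> by (simp add: field_simps)
  finally have "-1 < (\<integral>x. birkhoff n x \<partial>\<mu>)" .
  moreover have "(\<integral>x. birkhoff n x \<partial>\<mu>) \<le> (\<integral>x. -1 \<partial>\<mu>)"
  proof (rule integral_mono)
    fix x assume "x \<in> space \<mu>"
    then have "x \<in> S" by (simp add: space)
    from iterate_ge_birkhoff[OF this, of n 0] neg[OF shift_funpow_in_S[OF this, of n]]
    show "birkhoff n x \<le> -1" by simp
  qed (use int in auto)
  ultimately show False by (simp add: prob_space)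
qed

text \<open>The preceding lower bound holds at one point only; a connecting path of bounded length carries it to any other
point, at the price of a bounded delay.\<close>

lemma iterate_frequently_bounded_below:
  obtains C where "\<And>x n. x \<in> S \<Longrightarrow> \<exists>k\<ge>n. C \<le> iterate k x"
proof -
  obtain B where B: "0 \<le> B" "\<And>x. x \<in> S \<Longrightarrow> \<bar>f x - m\<bar> \<le> B" using f_bounded by blast
  obtain D where D: "\<And>x y. x \<in> S \<Longrightarrow> y \<in> S \<Longrightarrow>
    \<exists>l z. 1 \<le> l \<and> l \<le> D \<and> z \<in> S \<and> z 0 = x 0 \<and> (\<sigma> ^^ l) z = y"
    using connecting_point by blast
  have "\<exists>k\<ge>n. - (D * B) - 1 - K \<le> iterate k x" if x: "x \<in> S" for x n
  proof -
    obtain y where y: "y \<in> S" "-1 < iterate n y" using iterate_not_very_negative by blast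
    obtain l z where z: "l \<le> D" "z \<in> S" "z 0 = y 0" "(\<sigma> ^^ l) z = x" using D[OF y(1) x] by blast
    have "\<bar>birkhoff l z\<bar> \<le> (\<Sum>k<l. B)"
      by (intro order_trans[OF sum_abs] sum_mono B shift_funpow_in_S z)
    also have "\<dots> \<le> D * B" using z(1) B(1) by (simp add: mult_right_mono)
    finally have "- (D * B) \<le> birkhoff l z" by linarith
    moreover have "\<bar>iterate n z - iterate n y\<bar> \<le> K * d z y" by (intro iterate_lip z y)
    moreover have "K * d z y \<le> K * 1" by (intro mult_left_mono d_le_1 K_nonneg)
    moreover have "birkhoff l z + iterate n z \<le> iterate (n + l) x"
      using iterate_ge_birkhoff[OF z(2), of l n] z(4) by simp
    ultimately have "- (D * B) - 1 - K \<le> iterate (n + l) x" using y(2) by linarith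
    then show ?thesis by (intro exI[of _ "n + l"]) simp
  qed
  then show ?thesis by (rule that)
qed

text \<open>The pointwise limit superior of the iterates is finite by the bounds above. It is a fixed
point of the Lax-Oleinik operator, because the limit superior commutes with the maximum over the finitely many
preimages.\<close>

lemma calibrated_subaction_exists:
  obtains u where "\<And>x y. x \<in> S \<Longrightarrow> y \<in> S \<Longrightarrow> x 0 = y 0 \<Longrightarrow> \<bar>u x - u y\<bar> \<le> K * d x y"
    "\<And>x. x \<in> S \<Longrightarrow> f x - m + u x \<le> u (\<sigma> x)"
    "\<And>y. y \<in> S \<Longrightarrow> \<exists>x\<in>S. \<sigma> x = y \<and> u y = f x - m + u x"
proof -
  obtain C where C: "\<And>n z. z \<in> S \<Longrightarrow> birkhoff n z \<le> C" using birkhoff_bounded_above by blast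
  have up: "iterate n y \<le> C" if "y \<in> S" for n y
    using iterate_birkhoff[OF that, of n] C by auto
  obtain c where low: "\<And>x n. x \<in> S \<Longrightarrow> \<exists>k\<ge>n. c \<le> iterate k x"
    using iterate_frequently_bounded_below by blast
  have "\<forall>x\<in>S. \<exists>l. \<forall>e>0. (\<exists>N. \<forall>n\<ge>N. iterate n x < l + e) \<and> (\<forall>N. \<exists>n\<ge>N. l - e < iterate n x)"
    by (intro ballI real_limsup_exists[OF up low])
  then obtain u where u: "\<forall>x\<in>S. \<forall>e>0. (\<exists>N. \<forall>n\<ge>N. iterate n x < u x + e) \<and> (\<forall>N. \<exists>n\<ge>N. u x - e < iterate n x)"
    by (rule bchoice[THEN exE])
  have ev: "\<exists>N. \<forall>n\<ge>N. iterate n x < u x + e" if "x \<in> S" "0 < e" for x e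
    using u that by blast
  have freq: "\<exists>n\<ge>N. u x - e < iterate n x" if "x \<in> S" "0 < e" for x e N
    using u that by blast
  have lip: "u x - u y \<le> K * d x y" if xy: "x \<in> S" "y \<in> S" "x 0 = y 0" for x y
  proof (rule field_le_epsilon)
    fix e :: real assume e: "0 < e"
    obtain N where N: "\<forall>n\<ge>N. iterate n y < u y + e / 2" using ev[OF xy(2), of "e / 2"] e by auto
    obtain n where n: "N \<le> n" "u x - e / 2 < iterate n x" using freq[OF xy(1), of "e / 2" N] e by auto
    have "iterate n y < u y + e / 2" using N n(1) by blast
    then show "u x - u y \<le> K * d x y + e"
      using n(2) iterate_lip[OF xy, of n] by linarith
  qed
  have sub: "f x - m + u x \<le> u (\<sigma> x)" if x: "x \<in> S" for x
  proof (rule field_le_epsilon)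
    fix e :: real assume e: "0 < e"
    obtain N where N: "\<forall>n\<ge>N. iterate n (\<sigma> x) < u (\<sigma> x) + e / 2"
      using ev[OF shift_in_S[OF x], of "e / 2"] e by auto
    obtain n where n: "N \<le> n" "u x - e / 2 < iterate n x" using freq[OF x, of "e / 2" N] e by auto
    have "iterate (Suc n) (\<sigma> x) < u (\<sigma> x) + e / 2" using N n(1) le_SucI by blast
    then show "f x - m + u x \<le> u (\<sigma> x) + e"
      using n(2) iterate_ge[OF x, of n] by linarith
  qed
  have cal: "\<exists>x\<in>S. \<sigma> x = y \<and> u y = f x - m + u x" if y: "y \<in> S" for y
  proof -
    define F where "F a = f (case_nat a y) - m + u (case_nat a y)" for a
    have "Max (F ` predecessors y) \<in> F ` predecessors y"
      by (intro Max_in finite_imageI finite_predecessors) (use predecessors_nonempty[OF y] in simp)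
    then obtain a where a: "a \<in> predecessors y" "F a = Max (F ` predecessors y)" by force
    have aS: "case_nat a y \<in> S" by (rule predecessor_in_S[OF y a(1)])
    have "u y \<le> F a"
    proof (rule field_le_epsilon)
      fix e :: real assume e: "0 < e"
      have "\<forall>b\<in>predecessors y. \<exists>N. \<forall>n\<ge>N. iterate n (case_nat b y) < u (case_nat b y) + e / 2"
        using ev[OF predecessor_in_S[OF y]] e by simp
      then obtain N where N: "\<forall>b\<in>predecessors y. \<forall>n\<ge>N b. iterate n (case_nat b y) < u (case_nat b y) + e / 2"
        by (rule bchoice[THEN exE])
      obtain k where k: "Suc (\<Sum>b\<in>predecessors y. N b) \<le> k" "u y - e / 2 < iterate k y"
        using freq[OF y, of "e / 2"] e by (meson half_gt_zero)
      then obtain n where n: "k = Suc n" "(\<Sum>b\<in>predecessors y. N b) \<le> n" by (cases k) auto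
      obtain b where b: "b \<in> predecessors y"
        "iterate (Suc n) y = f (case_nat b y) - m + iterate n (case_nat b y)"
        using iterate_attained[OF y] by blast
      have "N b \<le> n"
        using member_le_sum[of b "predecessors y" N] b(1) finite_predecessors n(2) by fastforce
      then have "iterate n (case_nat b y) < u (case_nat b y) + e / 2" using N b(1) by blast
      moreover have "F b \<le> F a" unfolding a(2) using b(1) finite_predecessors by simp
      ultimately show "u y \<le> F a + e" using k(2)[unfolded n(1)] b(2)
        unfolding F_def by linarith
    qed
    moreover have "F a \<le> u y" using sub[OF aS] by (simp add: F_def)
    ultimately have "u y = F a" by simp
    then show ?thesis using aS by (intro bexI[of _ "case_nat a y"]) (simp_all add: F_def)
  qed
  show ?thesis
  proof (rule that[of u])
    show "\<bar>u x - u y\<bar> \<le> K * d x y" if "x \<in> S" "y \<in> S" "x 0 = y 0" for x y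
      using lip[of x y] lip[of y x] that by (simp add: seq_dist_commute abs_le_iff)
  qed (use sub cal in blast)+
qed

end

section \<open>The maximal sub-action\<close>

context subshift_system
begin

text \<open>\<open>chain k h t x c\<close>: one can travel from \<open>x\<close> to \<open>t\<close> at cost \<open>c\<close>, where a step along the shift
costs \<open>- h\<close> and a jump inside a cylinder of length one costs \<open>k\<close> times its distance. A function
with Lipschitz constant \<open>k\<close> on these cylinders is a sub-action of \<open>h\<close> (for the value zero) exactly
if no step lowers it by more than its cost.\<close>

inductive chain :: "real \<Rightarrow> ((nat \<Rightarrow> nat) \<Rightarrow> real) \<Rightarrow> (nat \<Rightarrow> nat) \<Rightarrow> (nat \<Rightarrow> nat) \<Rightarrow> real \<Rightarrow> bool"
  for k :: real and h :: "(nat \<Rightarrow> nat) \<Rightarrow> real" and t :: "nat \<Rightarrow> nat" where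
  chain_end: "chain k h t t 0"
| chain_shift: "x \<in> S \<Longrightarrow> chain k h t (\<sigma> x) c \<Longrightarrow> chain k h t x (c - h x)"
| chain_jump: "x \<in> S \<Longrightarrow> y \<in> S \<Longrightarrow> x 0 = y 0 \<Longrightarrow> chain k h t y c \<Longrightarrow> chain k h t x (c + k * d x y)"

lemma chain_ge:
  assumes "chain k h t x c"
    and lip: "\<And>x y. x \<in> S \<Longrightarrow> y \<in> S \<Longrightarrow> x 0 = y 0 \<Longrightarrow> u x - u y \<le> k * d x y"
    and sub: "\<And>x. x \<in> S \<Longrightarrow> h x + u x \<le> u (\<sigma> x)"
  shows "u x - u t \<le> c"
  using assms(1)
proof induction
  case (chain_shift x c)
  then show ?case using sub[of x] by linarith
next
  case (chain_jump x y c)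
  then show ?case using lip[of x y] by linarith
qed simp

lemma chain_orbit:
  assumes "z \<in> S"
  shows "chain k h ((\<sigma> ^^ l) z) z (- (\<Sum>i<l. h ((\<sigma> ^^ i) z)))"
  using assms
proof (induction l arbitrary: z)
  case 0
  then show ?case using chain_end by simp
next
  case (Suc l)
  have "chain k h ((\<sigma> ^^ l) (\<sigma> z)) (\<sigma> z) (- (\<Sum>i<l. h ((\<sigma> ^^ i) (\<sigma> z))))"
    by (rule Suc.IH[OF shift_in_S[OF Suc.prems]])
  from chain_shift[OF Suc.prems this]
  moreover have "- (\<Sum>i<l. h ((\<sigma> ^^ i) (\<sigma> z))) - h z = - (\<Sum>i<Suc l. h ((\<sigma> ^^ i) z))"
    unfolding sum.lessThan_Suc_shift by (simp add: funpow_swap1)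
  ultimately show ?case by (simp add: funpow_swap1 del: sum.lessThan_Suc)
qed

lemma chain_exists_bounded:
  assumes "0 \<le> k" "0 \<le> B"
  shows "\<exists>C. \<forall>h. \<forall>t\<in>S. \<forall>x\<in>S. (\<forall>z\<in>S. \<bar>h z\<bar> \<le> B) \<longrightarrow> (\<exists>c\<le>C. chain k h t x c)"
proof -
  obtain D where D: "\<And>x y. x \<in> S \<Longrightarrow> y \<in> S \<Longrightarrow>
    \<exists>l z. 1 \<le> l \<and> l \<le> D \<and> z \<in> S \<and> z 0 = x 0 \<and> (\<sigma> ^^ l) z = y"
    using connecting_point by blast
  have "\<exists>c\<le>D * B + k. chain k h t x c"
    if t: "t \<in> S" and x: "x \<in> S" and B: "\<forall>z\<in>S. \<bar>h z\<bar> \<le> B" for h t x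
  proof -
    obtain l z where z: "l \<le> D" "z \<in> S" "z 0 = x 0" "(\<sigma> ^^ l) z = t" using D[OF x t] by blast
    have "chain k h t z (- (\<Sum>i<l. h ((\<sigma> ^^ i) z)))"
      using chain_orbit[OF z(2), of k h l] z(4) by simp
    then have "chain k h t x (- (\<Sum>i<l. h ((\<sigma> ^^ i) z)) + k * d x z)"
      by (rule chain_jump[OF x z(2) z(3)[symmetric]])
    moreover have "\<bar>\<Sum>i<l. h ((\<sigma> ^^ i) z)\<bar> \<le> (\<Sum>i<l. B)"
      by (intro order_trans[OF sum_abs] sum_mono B[rule_format] shift_funpow_in_S z)
    moreover have "(\<Sum>i<l. B) \<le> D * B" using z(1) assms(2) by (simp add: mult_right_mono)
    moreover have "k * d x z \<le> k * 1" by (intro mult_left_mono d_le_1 assms)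
    ultimately show ?thesis by (intro exI[of _ "- (\<Sum>i<l. h ((\<sigma> ^^ i) z)) + k * d x z"]) linarith
  qed
  then show ?thesis by (intro exI[of _ "D * B + k"]) blast
qed

end

text \<open>The functions \<open>f\<^sub>y\<close> of the zero temperature limit form such a family: that their critical value does not
depend on \<open>y\<close> is the limit of the fixed point equation.\<close>

locale critical_family = subshift_system +
  fixes F :: "(nat \<Rightarrow> nat) \<Rightarrow> (nat \<Rightarrow> nat) \<Rightarrow> real" and m L :: real
  assumes critical: "\<And>y. y \<in> S \<Longrightarrow> critical_potential r M \<Lambda> (F y) m L"
    and F_lip_param: "\<And>y y' x. y \<in> S \<Longrightarrow> y' \<in> S \<Longrightarrow> x \<in> S \<Longrightarrow> \<bar>F y x - F y' x\<bar> \<le> L * d y y'"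
    and S_nonempty: "S \<noteq> {}"
begin

abbreviation "K \<equiv> L / (1 - \<Lambda>)"
abbreviation "cost y \<equiv> chain K (\<lambda>x. F y x - m) y"

text \<open>Least cost of travelling from \<open>x\<close> to \<open>y\<close>. Up to sign and the regularising jumps this is the Mane
potential of \<open>F y\<close> with target \<open>y\<close>.\<close>

definition maximal_subaction :: "(nat \<Rightarrow> nat) \<Rightarrow> (nat \<Rightarrow> nat) \<Rightarrow> real" where
  "maximal_subaction y x = Inf {c. cost y x c}"

lemma L_nonneg: "0 \<le> L"
  using S_nonempty critical critical_potential.L_nonneg by blast

lemma K_nonneg: "0 \<le> K"
  using L_nonneg \<Lambda>_less by simp

lemma F_lip:
  assumes "y \<in> S" "x \<in> S" "x' \<in> S"
  shows "\<bar>F y x - F y x'\<bar> \<le> L * d x x'"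
  by (rule critical_potential.f_lip[OF critical[OF assms(1)] assms(2,3)])

lemma F_bounded: obtains B where "0 \<le> B" "\<And>x y. x \<in> S \<Longrightarrow> y \<in> S \<Longrightarrow> \<bar>F y x - m\<bar> \<le> B"
proof -
  obtain z where z: "z \<in> S" using S_nonempty by blast
  obtain B where B: "0 \<le> B" "\<And>x. x \<in> S \<Longrightarrow> \<bar>F z x - m\<bar> \<le> B"
    using critical_potential.f_bounded[OF critical[OF z]] by blast
  show ?thesis
  proof (rule that[of "B + L"])
    fix x y assume xy: "x \<in> S" "y \<in> S"
    have "L * d y z \<le> L * 1" by (intro mult_left_mono d_le_1 L_nonneg)
    then show "\<bar>F y x - m\<bar> \<le> B + L"
      using B(2)[OF xy(1)] F_lip_param[OF xy(2) z xy(1)] by linarith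
  qed (use B L_nonneg in simp)
qed

lemma calibrated:
  assumes "y \<in> S"
  obtains u where "\<And>x x'. x \<in> S \<Longrightarrow> x' \<in> S \<Longrightarrow> x 0 = x' 0 \<Longrightarrow> u x - u x' \<le> K * d x x'"
    "\<And>x. x \<in> S \<Longrightarrow> F y x - m + u x \<le> u (\<sigma> x)"
    "\<exists>x\<in>S. \<sigma> x = y \<and> u y = F y x - m + u x"
proof -
  obtain u where u: "\<And>x x'. x \<in> S \<Longrightarrow> x' \<in> S \<Longrightarrow> x 0 = x' 0 \<Longrightarrow> \<bar>u x - u x'\<bar> \<le> K * d x x'"
    "\<And>x. x \<in> S \<Longrightarrow> F y x - m + u x \<le> u (\<sigma> x)"
    "\<And>z. z \<in> S \<Longrightarrow> \<exists>x\<in>S. \<sigma> x = z \<and> u z = F y x - m + u x"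
    using critical_potential.calibrated_subaction_exists[OF critical[OF assms]] by blast
  show ?thesis
  proof (rule that)
    show "u x - u x' \<le> K * d x x'" if "x \<in> S" "x' \<in> S" "x 0 = x' 0" for x x'
      using u(1)[OF that] by linarith
  qed (use u assms in blast)+
qed

text \<open>The lower bound compares the cost with a calibrated sub-action, whose oscillation is in turn bounded by
the cost of a chain in the opposite direction; so the bound is uniform in \<open>y\<close> and \<open>x\<close>.\<close>

lemma cost_bounded:
  obtains C where "0 \<le> C" "\<And>y x. y \<in> S \<Longrightarrow> x \<in> S \<Longrightarrow> \<exists>c\<le>C. cost y x c"
    "\<And>y x c. y \<in> S \<Longrightarrow> x \<in> S \<Longrightarrow> cost y x c \<Longrightarrow> - C \<le> c"
proof -
  obtain B where B: "0 \<le> B" "\<And>x y. x \<in> S \<Longrightarrow> y \<in> S \<Longrightarrow> \<bar>F y x - m\<bar> \<le> B" using F_bounded by blast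
  from chain_exists_bounded[OF K_nonneg B(1)]
  obtain C where C0: "\<forall>h. \<forall>t\<in>S. \<forall>x\<in>S. (\<forall>z\<in>S. \<bar>h z\<bar> \<le> B) \<longrightarrow> (\<exists>c\<le>C. chain K h t x c)"
    by (rule exE)
  have C: "\<exists>c\<le>C. chain K (\<lambda>z. F y z - m) t x c" if "t \<in> S" "x \<in> S" "y \<in> S" for y t x
  proof -
    have "\<forall>z\<in>S. \<bar>F y z - m\<bar> \<le> B" using B(2)[OF _ that(3)] by (rule ballI)
    then show ?thesis using spec[OF C0, of "\<lambda>z. F y z - m"] that(1,2) by blast
  qed
  show ?thesis
  proof (rule that[of "max 0 C"])
    show "\<exists>c\<le>max 0 C. cost y x c" if y: "y \<in> S" and x: "x \<in> S" for y x
    proof -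
      obtain c where "c \<le> C" "cost y x c" using C[OF y x y] by blast
      then show ?thesis by (intro exI[of _ c]) simp
    qed
    show "- max 0 C \<le> c" if y: "y \<in> S" and x: "x \<in> S" and c: "cost y x c" for y x c
    proof -
      obtain u where u: "\<And>x x'. x \<in> S \<Longrightarrow> x' \<in> S \<Longrightarrow> x 0 = x' 0 \<Longrightarrow> u x - u x' \<le> K * d x x'"
        "\<And>x. x \<in> S \<Longrightarrow> F y x - m + u x \<le> u (\<sigma> x)"
        using calibrated[OF y] by blast
      obtain c' where c': "c' \<le> C" "chain K (\<lambda>x. F y x - m) x y c'"
        using C[OF x y y] by blast
      have "u x - u y \<le> c" using c by (rule chain_ge) (fact u)+
      moreover have "u y - u x \<le> c'" using c'(2) by (rule chain_ge) (fact u)+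
      ultimately show ?thesis using c'(1) by linarith
    qed
  qed simp
qed

lemma cost_bdd_below: "y \<in> S \<Longrightarrow> x \<in> S \<Longrightarrow> bdd_below {c. cost y x c}"
proof -
  assume "y \<in> S" "x \<in> S"
  moreover obtain C where "0 \<le> C" "\<And>y x. y \<in> S \<Longrightarrow> x \<in> S \<Longrightarrow> \<exists>c\<le>C. cost y x c"
    "\<And>y x c. y \<in> S \<Longrightarrow> x \<in> S \<Longrightarrow> cost y x c \<Longrightarrow> - C \<le> c"
    using cost_bounded by blast
  ultimately show ?thesis by (intro bdd_belowI[of _ "- C"]) blast
qed

lemma cost_nonempty: "y \<in> S \<Longrightarrow> x \<in> S \<Longrightarrow> {c. cost y x c} \<noteq> {}"
  by (rule cost_bounded) blast

lemma maximal_subaction_le: "y \<in> S \<Longrightarrow> x \<in> S \<Longrightarrow> cost y x c \<Longrightarrow> maximal_subaction y x \<le> c"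
  unfolding maximal_subaction_def by (rule cInf_lower[OF _ cost_bdd_below]) simp_all

lemma maximal_subaction_greatest: "y \<in> S \<Longrightarrow> x \<in> S \<Longrightarrow> (\<And>c. cost y x c \<Longrightarrow> b \<le> c) \<Longrightarrow> b \<le> maximal_subaction y x"
  unfolding maximal_subaction_def by (rule cInf_greatest[OF cost_nonempty]) simp_all

lemma maximal_subaction_bounded:
  obtains C where "0 \<le> C" "\<And>y x. y \<in> S \<Longrightarrow> x \<in> S \<Longrightarrow> \<bar>maximal_subaction y x\<bar> \<le> C"
proof -
  obtain C where C: "0 \<le> C" "\<And>y x. y \<in> S \<Longrightarrow> x \<in> S \<Longrightarrow> \<exists>c\<le>C. cost y x c"
    "\<And>y x c. y \<in> S \<Longrightarrow> x \<in> S \<Longrightarrow> cost y x c \<Longrightarrow> - C \<le> c"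
    using cost_bounded by blast
  show ?thesis
  proof (rule that[OF C(1)])
    fix y x assume yx: "y \<in> S" "x \<in> S"
    obtain c where "c \<le> C" "cost y x c" using C(2)[OF yx] by blast
    then have "maximal_subaction y x \<le> C" using maximal_subaction_le[OF yx] by force
    moreover have "- C \<le> maximal_subaction y x" by (rule maximal_subaction_greatest[OF yx C(3)[OF yx]])
    ultimately show "\<bar>maximal_subaction y x\<bar> \<le> C" by linarith
  qed
qed

lemma maximal_subaction_lip_cylinder:
  assumes "y \<in> S" "x \<in> S" "x' \<in> S" "x 0 = x' 0"
  shows "maximal_subaction y x - maximal_subaction y x' \<le> K * d x x'"
proof -
  have "maximal_subaction y x - K * d x x' \<le> maximal_subaction y x'"
  proof (rule maximal_subaction_greatest[OF assms(1,3)])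
    fix c assume "cost y x' c"
    then show "maximal_subaction y x - K * d x x' \<le> c"
      using maximal_subaction_le[OF assms(1,2) chain_jump[OF assms(2-4)]] by force
  qed
  then show ?thesis by linarith
qed

lemma maximal_subaction_lipschitz:
  obtains C where "\<And>y x x'. y \<in> S \<Longrightarrow> x \<in> S \<Longrightarrow> x' \<in> S \<Longrightarrow> \<bar>maximal_subaction y x - maximal_subaction y x'\<bar> \<le> C * d x x'"
proof -
  obtain C where C: "0 \<le> C" "\<And>y x. y \<in> S \<Longrightarrow> x \<in> S \<Longrightarrow> \<bar>maximal_subaction y x\<bar> \<le> C" using maximal_subaction_bounded by blast
  have "\<bar>maximal_subaction y x - maximal_subaction y x'\<bar> \<le> (K + 2 * C) * d x x'" if y: "y \<in> S" and x: "x \<in> S" and x': "x' \<in> S" for y x x'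
  proof (cases "x 0 = x' 0")
    case True
    have "maximal_subaction y x - maximal_subaction y x' \<le> K * d x x'" "maximal_subaction y x' - maximal_subaction y x \<le> K * d x x'"
      using maximal_subaction_lip_cylinder[OF y x x' True] maximal_subaction_lip_cylinder[OF y x' x True[symmetric]]
      by (simp_all only: seq_dist_commute)
    moreover have "0 \<le> 2 * C * d x x'" using C(1) d_nonneg by simp
    ultimately show ?thesis unfolding distrib_right by linarith
  next
    case False
    then have "d x x' = 1" by (rule seq_dist_eq_1)
    moreover have "\<bar>maximal_subaction y x - maximal_subaction y x'\<bar> \<le> K + 2 * C"
      using C(2)[OF y x] C(2)[OF y x'] K_nonneg by linarith
    ultimately show ?thesis by simp
  qed
  then show ?thesis by (rule that)
qed

lemma maximal_subaction_is_subaction: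
  assumes "y \<in> S" "x \<in> S"
  shows "F y x - m + maximal_subaction y x \<le> maximal_subaction y (\<sigma> x)"
proof (rule maximal_subaction_greatest[OF assms(1) shift_in_S[OF assms(2)]])
  fix c assume "cost y (\<sigma> x) c"
  from maximal_subaction_le[OF assms chain_shift[OF assms(2) this]]
  show "F y x - m + maximal_subaction y x \<le> c" by linarith
qed

lemma maximal_subaction_self:
  assumes "y \<in> S"
  shows "maximal_subaction y y = 0"
proof -
  obtain u where u: "\<And>x x'. x \<in> S \<Longrightarrow> x' \<in> S \<Longrightarrow> x 0 = x' 0 \<Longrightarrow> u x - u x' \<le> K * d x x'"
    "\<And>x. x \<in> S \<Longrightarrow> F y x - m + u x \<le> u (\<sigma> x)"
    using calibrated[OF assms] by blast
  have "0 \<le> maximal_subaction y y"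
  proof (rule maximal_subaction_greatest[OF assms assms])
    fix c assume "cost y y c"
    then have "u y - u y \<le> c" by (rule chain_ge) (fact u)+
    then show "0 \<le> c" by simp
  qed
  moreover have "maximal_subaction y y \<le> 0" by (rule maximal_subaction_le[OF assms assms chain_end])
  ultimately show ?thesis by simp
qed

text \<open>A calibrated sub-action \<open>u\<close> of \<open>F y\<close> gives \<open>u x - u y\<close> as a lower bound for the cost from \<open>x\<close> to \<open>y\<close>.
At the preimage of \<open>y\<close> that realises calibration this equals the cost of the single shift step.\<close>

lemma maximal_subaction_calibrated_at:
  assumes "y \<in> S"
  shows "\<exists>x\<in>S. \<sigma> x = y \<and> F y x + maximal_subaction y x = m"
proof -
  obtain u where u: "\<And>x x'. x \<in> S \<Longrightarrow> x' \<in> S \<Longrightarrow> x 0 = x' 0 \<Longrightarrow> u x - u x' \<le> K * d x x'"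
    "\<And>x. x \<in> S \<Longrightarrow> F y x - m + u x \<le> u (\<sigma> x)"
    and ex: "\<exists>x\<in>S. \<sigma> x = y \<and> u y = F y x - m + u x"
    using calibrated[OF assms] by blast
  from ex obtain x where x: "x \<in> S" "\<sigma> x = y" "u y = F y x - m + u x" by blast
  have "u x - u y \<le> maximal_subaction y x"
  proof (rule maximal_subaction_greatest[OF assms x(1)])
    fix c assume "cost y x c"
    then show "u x - u y \<le> c" by (rule chain_ge) (fact u)+
  qed
  moreover have "F y x - m + maximal_subaction y x \<le> 0"
    using maximal_subaction_is_subaction[OF assms x(1)] maximal_subaction_self[OF assms] x(2) by simp
  ultimately have "F y x + maximal_subaction y x = m" using x(3) by linarith
  then show ?thesis using x by blast
qed

text \<open>A chain has finitely many steps, so its cost is a Lipschitz function of the parameter; one further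
jump moves its end point from \<open>y\<close> to \<open>y'\<close>. The constant depends on the chain, which is why the infimum is
only upper semicontinuous.\<close>

lemma cost_perturb:
  assumes y: "y \<in> S" and c: "cost y x c"
  shows "\<exists>b\<ge>0. \<forall>y'\<in>S. y' 0 = y 0 \<longrightarrow> (\<exists>c'\<le>c + b * d y' y. cost y' x c')"
  using c
proof induction
  case chain_end
  have *: "\<exists>c'\<le>0 + K * d y' y. cost y' y c'" if "y' \<in> S" "y' 0 = y 0" for y'
  proof (intro exI conjI)
    show "cost y' y (0 + K * d y y')"
      by (rule chain.chain_jump[OF y that(1) that(2)[symmetric] chain.chain_end])
    show "0 + K * d y y' \<le> 0 + K * d y' y"
      by (simp add: seq_dist_commute[of \<Lambda> y y'])
  qed
  show ?case
    by (rule exI[of _ K], rule conjI[OF K_nonneg], intro ballI impI, rule *)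
next
  case (chain_shift x c)
  then obtain b where b: "b \<ge> 0" "\<forall>y'\<in>S. y' 0 = y 0 \<longrightarrow> (\<exists>c'\<le>c + b * d y' y. cost y' (\<sigma> x) c')"
    by blast
  have *: "\<exists>c'\<le>c - (F y x - m) + (b + L) * d y' y. cost y' x c'" if y': "y' \<in> S" "y' 0 = y 0" for y'
  proof -
    obtain c' where c': "c' \<le> c + b * d y' y" "cost y' (\<sigma> x) c'" using b y' by blast
    have "\<bar>F y' x - F y x\<bar> \<le> L * d y' y" by (rule F_lip_param[OF y'(1) y chain_shift(1)])
    then have "c' - (F y' x - m) \<le> c - (F y x - m) + (b + L) * d y' y"
      using c'(1) unfolding distrib_right by linarith
    then show ?thesis using chain.chain_shift[OF chain_shift(1) c'(2)] by blast
  qed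
  have "0 \<le> b + L" using b(1) L_nonneg by simp
  then show ?case
    by (rule exI[of _ "b + L", OF conjI]) (intro ballI impI, rule *)
next
  case (chain_jump x z c)
  then obtain b where b: "b \<ge> 0" "\<forall>y'\<in>S. y' 0 = y 0 \<longrightarrow> (\<exists>c'\<le>c + b * d y' y. cost y' z c')"
    by blast
  have *: "\<exists>c'\<le>c + K * d x z + b * d y' y. cost y' x c'" if y': "y' \<in> S" "y' 0 = y 0" for y'
  proof -
    obtain c' where c': "c' \<le> c + b * d y' y" "cost y' z c'" using b y' by blast
    have "c' + K * d x z \<le> c + K * d x z + b * d y' y" using c'(1) by linarith
    then show ?thesis using chain.chain_jump[OF chain_jump(1-3) c'(2)] by blast
  qed
  show ?case
    by (rule exI[of _ b], rule conjI[OF b(1)], intro ballI impI, rule *)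
qed

lemma maximal_subaction_upper_semicontinuous:
  assumes y: "y \<in> S" and x: "x \<in> S" and c: "maximal_subaction y x < c"
  shows "\<exists>n. \<forall>y'\<in>S \<inter> cylinder y n. \<forall>x'\<in>S \<inter> cylinder x n. maximal_subaction y' x' < c"
proof -
  have "\<exists>c0\<in>{c. cost y x c}. c0 < c"
    using c unfolding maximal_subaction_def by (rule cInf_lessD[OF cost_nonempty[OF y x]])
  then obtain c0 where c0: "cost y x c0" "c0 < c" by blast
  obtain b where b: "b \<ge> 0" "\<forall>y'\<in>S. y' 0 = y 0 \<longrightarrow> (\<exists>c'\<le>c0 + b * d y' y. cost y' x c')"
    using cost_perturb[OF y c0(1)] by blast
  define q where "q = K + b + 1"
  have q: "0 < q" using K_nonneg b(1) unfolding q_def by linarith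
  obtain n where n: "\<Lambda> ^ n < (c - c0) / q"
    using real_arch_pow_inv[of "(c - c0) / q" \<Lambda>] c0(2) q \<Lambda>_less by auto
  show ?thesis
  proof (intro exI[of _ n] ballI)
    fix y' x' assume y': "y' \<in> S \<inter> cylinder y n" and x': "x' \<in> S \<inter> cylinder x n"
    have eq: "y j = y' j" "x j = x' j" if "j \<le> n" for j
      using y' x' that unfolding cylinder_def by blast+
    have dn: "d y' y \<le> \<Lambda> ^ n" "d x' x \<le> \<Lambda> ^ n"
      by (rule d_le_power; use eq in simp)+
    obtain c' where c': "c' \<le> c0 + b * d y' y" "cost y' x c'"
      using b(2) y' eq(1)[of 0] by auto
    have "maximal_subaction y' x' \<le> c' + K * d x' x"
      using y' x' x eq(2)[of 0] c'(2) by (intro maximal_subaction_le chain_jump[where y = x]) auto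
    also have "\<dots> \<le> c0 + b * \<Lambda> ^ n + K * \<Lambda> ^ n"
      using c'(1) mult_left_mono[OF dn(1) b(1)] mult_left_mono[OF dn(2) K_nonneg] by linarith
    also have "\<dots> \<le> c0 + q * \<Lambda> ^ n"
      using \<Lambda>_pos unfolding q_def distrib_right by simp
    also have "\<dots> < c" using n unfolding pos_less_divide_eq[OF q] by (simp add: mult.commute)
    finally show "maximal_subaction y' x' < c" .
  qed
qed

lemma maximal_subaction_measurable: "(\<lambda>(y, x). maximal_subaction y x) \<in> borel_measurable (restrict_space borel (S \<times> S))"
proof (rule borel_measurableI_less)
  fix c
  define A where "A = {p \<in> S \<times> S. (case p of (y, x) \<Rightarrow> maximal_subaction y x) < c}"
  have "\<exists>T. open T \<and> p \<in> T \<and> T \<inter> (S \<times> S) \<subseteq> A" if "p \<in> A" for p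
  proof -
    obtain y x where p: "p = (y, x)" by (cases p)
    then have yx: "y \<in> S" "x \<in> S" "maximal_subaction y x < c" using that by (auto simp: A_def)
    obtain n where n: "\<forall>y'\<in>S \<inter> cylinder y n. \<forall>x'\<in>S \<inter> cylinder x n. maximal_subaction y' x' < c"
      using maximal_subaction_upper_semicontinuous[OF yx] by blast
    have "(cylinder y n \<times> cylinder x n) \<inter> (S \<times> S) \<subseteq> A"
      using n unfolding A_def by auto
    moreover have "p \<in> cylinder y n \<times> cylinder x n" by (simp add: p cylinder_self)
    moreover have "open (cylinder y n \<times> cylinder x n)" by (intro open_Times open_cylinder)
    ultimately show ?thesis by blast
  qed
  then have "\<forall>p\<in>A. \<exists>T. open T \<and> p \<in> T \<and> T \<inter> (S \<times> S) \<subseteq> A" by (rule ballI)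
  then obtain T where T: "\<forall>p\<in>A. open (T p) \<and> p \<in> T p \<and> T p \<inter> (S \<times> S) \<subseteq> A"
    by (rule bchoice[THEN exE])
  have A: "A = (S \<times> S) \<inter> (\<Union>p\<in>A. T p)"
  proof (intro equalityI subsetI)
    fix p assume "p \<in> A"
    then have "p \<in> S \<times> S" by (simp add: A_def)
    moreover have "p \<in> T p" using T \<open>p \<in> A\<close> by blast
    ultimately show "p \<in> (S \<times> S) \<inter> (\<Union>p\<in>A. T p)" using \<open>p \<in> A\<close> by blast
  next
    fix p assume "p \<in> (S \<times> S) \<inter> (\<Union>p\<in>A. T p)"
    then obtain q where "q \<in> A" "p \<in> T q \<inter> (S \<times> S)" by blast
    then show "p \<in> A" using T by blast
  qed
  have O: "(\<Union>p\<in>A. T p) \<in> sets borel" using T by (intro borel_open open_UN) simp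
  have "A \<in> sets (restrict_space borel (S \<times> S))"
    unfolding sets_restrict_space by (rule image_eqI[where f = "(\<inter>) (S \<times> S)", OF A O])
  then show "{p \<in> space (restrict_space borel (S \<times> S)). (case p of (y, x) \<Rightarrow> maximal_subaction y x) < c}
      \<in> sets (restrict_space borel (S \<times> S))"
    by (simp add: space_restrict_space A_def)
qed

definition tight_points :: "(nat \<Rightarrow> nat) set" where
  "tight_points = {x \<in> S. m \<le> F (\<sigma> x) x + maximal_subaction (\<sigma> x) x}"

text \<open>On pairs \<open>(\<sigma> x, x)\<close> the function \<open>F + maximal_subaction\<close> is bounded above by \<open>m\<close> and upper
semicontinuous, so the set where it attains \<open>m\<close> is closed.\<close>

lemma closed_tight_points: "closed tight_points"
  unfolding closed_def
proof (rule topological_space_class.openI)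
  fix x assume x: "x \<in> - tight_points"
  show "\<exists>T. open T \<and> x \<in> T \<and> T \<subseteq> - tight_points"
  proof (cases "x \<in> S")
    case False
    then show ?thesis using closed_S
      by (intro exI[of _ "- S"]) (auto simp: tight_points_def)
  next
    case True
    define e where "e = (m - F (\<sigma> x) x - maximal_subaction (\<sigma> x) x) / 2"
    have e: "0 < e" using x True by (simp add: tight_points_def e_def)
    have "maximal_subaction (\<sigma> x) x < maximal_subaction (\<sigma> x) x + e" using e by simp
    from maximal_subaction_upper_semicontinuous[OF shift_in_S[OF True] True this]
    obtain n where n: "\<forall>y'\<in>S \<inter> cylinder (\<sigma> x) n. \<forall>x'\<in>S \<inter> cylinder x n. maximal_subaction y' x' < maximal_subaction (\<sigma> x) x + e"
      by blast
    obtain k where k: "\<Lambda> ^ k < e / (2 * L + 1)"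
      using real_arch_pow_inv[of "e / (2 * L + 1)" \<Lambda>] e L_nonneg \<Lambda>_less by auto
    let ?N = "Suc (max n k)"
    have "x' \<notin> tight_points" if x': "x' \<in> cylinder x ?N" for x'
    proof
      assume "x' \<in> tight_points"
      then have S': "x' \<in> S" and t: "m \<le> F (\<sigma> x') x' + maximal_subaction (\<sigma> x') x'" by (auto simp: tight_points_def)
      have eq: "x j = x' j" if "j \<le> ?N" for j using x' that unfolding cylinder_def by blast
      have "x' \<in> cylinder x n" "\<sigma> x' \<in> cylinder (\<sigma> x) n"
        unfolding cylinder_def using eq by (simp_all add: shift_map_def)
      then have w: "maximal_subaction (\<sigma> x') x' < maximal_subaction (\<sigma> x) x + e" using n S' shift_in_S by blast
      have "d (\<sigma> x') (\<sigma> x) \<le> \<Lambda> ^ k" "d x' x \<le> \<Lambda> ^ k"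
        by (rule d_le_power; use eq in \<open>simp add: shift_map_def\<close>)+
      then have "L * d (\<sigma> x') (\<sigma> x) \<le> L * \<Lambda> ^ k" "L * d x' x \<le> L * \<Lambda> ^ k"
        using L_nonneg by (auto intro: mult_left_mono)
      moreover have "\<bar>F (\<sigma> x') x' - F (\<sigma> x) x'\<bar> \<le> L * d (\<sigma> x') (\<sigma> x)"
        by (intro F_lip_param shift_in_S S' True)
      moreover have "\<bar>F (\<sigma> x) x' - F (\<sigma> x) x\<bar> \<le> L * d x' x"
        by (intro F_lip shift_in_S S' True)
      ultimately have "F (\<sigma> x') x' \<le> F (\<sigma> x) x + 2 * (L * \<Lambda> ^ k)" by linarith
      moreover have "2 * (L * \<Lambda> ^ k) \<le> (2 * L + 1) * \<Lambda> ^ k" using \<Lambda>_pos by (simp add: algebra_simps)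
      moreover have "(2 * L + 1) * \<Lambda> ^ k < e"
      proof -
        have "0 < 2 * L + 1" using L_nonneg by linarith
        from k[unfolded pos_less_divide_eq[OF this]] show ?thesis by (simp only: mult.commute)
      qed
      ultimately have "F (\<sigma> x') x' < F (\<sigma> x) x + e" by linarith
      moreover have "2 * e = m - F (\<sigma> x) x - maximal_subaction (\<sigma> x) x" by (simp add: e_def)
      ultimately show False using w t by linarith
    qed
    then show ?thesis
      by (intro exI[of _ "cylinder x ?N"] conjI open_cylinder cylinder_self subsetI) blast
  qed
qed

lemma tight_points_preimage:
  assumes "y \<in> S"
  shows "\<exists>x\<in>tight_points. \<sigma> x = y"
proof -
  obtain x where x: "x \<in> S" "\<sigma> x = y" "F y x + maximal_subaction y x = m" using maximal_subaction_calibrated_at[OF assms] by blast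
  have "m \<le> F (\<sigma> x) x + maximal_subaction (\<sigma> x) x" unfolding x(2) using x(3) by simp
  then have "x \<in> tight_points" unfolding tight_points_def using x(1) by blast
  then show ?thesis using x(2) by blast
qed

text \<open>Repeatedly choosing preimages among the tight points produces, for each \<open>n\<close>, a point whose first \<open>n\<close>
iterates are all tight.\<close>

lemma tight_invariant_measure:
  obtains \<nu> where "prob_space \<nu>" "sets \<nu> = sets borel" "distr \<nu> borel \<sigma> = \<nu>"
    "AE x in \<nu>. x \<in> tight_points"
proof -
  have sub: "tight_points \<subseteq> {x. \<forall>j. x j \<le> r}"
  proof
    fix x assume "x \<in> tight_points"
    then have "x j \<in> {1..r}" for j unfolding tight_points_def using letter_in by blast
    then show "x \<in> {x. \<forall>j. x j \<le> r}" by simp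
  qed
  have ex: "\<exists>x\<in>S. \<forall>k<n. (\<sigma> ^^ k) x \<in> tight_points" for n
  proof (induction n)
    case 0
    obtain x where "x \<in> S" using S_nonempty by blast
    then show ?case by (intro bexI[of _ x]) simp_all
  next
    case (Suc n)
    then obtain y where y: "y \<in> S" "\<forall>k<n. (\<sigma> ^^ k) y \<in> tight_points" by blast
    obtain x where x: "x \<in> tight_points" "\<sigma> x = y" using tight_points_preimage[OF y(1)] by blast
    have "(\<sigma> ^^ k) x \<in> tight_points" if "k < Suc n" for k
    proof (cases k)
      case (Suc j)
      have "(\<sigma> ^^ k) x = (\<sigma> ^^ j) y" unfolding Suc funpow_Suc_right comp_apply x(2) ..
      moreover have "j < n" using that Suc by simp
      ultimately show ?thesis using y(2) by simp
    qed (simp add: x(1))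
    moreover have "x \<in> S" using x(1) by (simp add: tight_points_def)
    ultimately show ?case by blast
  qed
  have exK: "\<exists>x. (\<forall>j. x j \<le> r) \<and> (\<forall>k<n. (\<sigma> ^^ k) x \<in> tight_points)" for n
  proof -
    obtain x where x: "x \<in> S" "\<forall>k<n. (\<sigma> ^^ k) x \<in> tight_points" using ex[of n] by blast
    have "x j \<le> r" for j using letter_in[OF x(1), of j] by simp
    with x(2) show ?thesis by blast
  qed
  obtain \<nu> where \<nu>: "prob_space \<nu>" "sets \<nu> = sets borel" "distr \<nu> borel \<sigma> = \<nu>"
    "AE x in \<nu>. x \<in> tight_points"
    by (rule invariant_measure_on_closed[OF closed_tight_points sub exK])
  show ?thesis by (rule that[OF \<nu>])
qed

end

section \<open>Lipschitz functions and entropy\<close>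

context subshift_system
begin

lemma lipschitz_functions_iff:
  "f \<in> lipschitz_functions r M \<Lambda> \<longleftrightarrow> (\<exists>B. \<forall>x\<in>S. \<forall>y\<in>S. \<bar>f x - f y\<bar> \<le> B * d x y)"
  unfolding lipschitz_functions_def Lipschitz_continuous_map_def
  by (simp add: Metric_space.mspace_metric[OF Metric_space_seq_dist[OF \<Lambda>_pos \<Lambda>_less]]
      Metric_space.mdist_metric[OF Metric_space_seq_dist[OF \<Lambda>_pos \<Lambda>_less]] dist_real_def)

lemma lipschitz_functionsE:
  assumes "f \<in> lipschitz_functions r M \<Lambda>"
  obtains B where "0 \<le> B" "\<And>x y. x \<in> S \<Longrightarrow> y \<in> S \<Longrightarrow> \<bar>f x - f y\<bar> \<le> B * d x y"
proof -
  obtain B where B: "\<forall>x\<in>S. \<forall>y\<in>S. \<bar>f x - f y\<bar> \<le> B * d x y"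
    using assms unfolding lipschitz_functions_iff by blast
  show ?thesis
  proof (rule that[of "max B 0"])
    fix x y assume "x \<in> S" "y \<in> S"
    then have "\<bar>f x - f y\<bar> \<le> B * d x y" using B by blast
    also have "\<dots> \<le> max B 0 * d x y" by (intro mult_right_mono d_nonneg) simp
    finally show "\<bar>f x - f y\<bar> \<le> max B 0 * d x y" .
  qed simp
qed

lemma lipschitz_integrable:
  assumes f: "f \<in> lipschitz_functions r M \<Lambda>" and \<mu>: "\<mu> \<in> invariant_measures r M"
  shows "integrable \<mu> f"
proof -
  interpret prob_space \<mu> by (rule invariant_measureD(1)[OF \<mu>])
  obtain B where B: "0 \<le> B" "\<And>x y. x \<in> S \<Longrightarrow> y \<in> S \<Longrightarrow> \<bar>f x - f y\<bar> \<le> B * d x y"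
    using lipschitz_functionsE[OF f] by blast
  obtain z where z: "z \<in> S" using not_empty invariant_measureD(3)[OF \<mu>] by blast
  have "f \<in> borel_measurable (restrict_space borel S)"
    by (intro borel_measurable_continuous_on_restrict continuous_on_seq_dist_lipschitz[OF \<Lambda>_pos \<Lambda>_less B(2)])
  then have m: "f \<in> borel_measurable \<mu>"
    unfolding measurable_cong_sets[OF invariant_measureD(2)[OF \<mu>] refl] .
  have "norm (f x) \<le> \<bar>f z\<bar> + B" if "x \<in> space \<mu>" for x
  proof -
    have "x \<in> S" using that invariant_measureD(3)[OF \<mu>] by simp
    then have "\<bar>f x - f z\<bar> \<le> B * d x z" using B(2) z by blast
    moreover have "B * d x z \<le> B * 1" by (intro mult_left_mono d_le_1 B(1))
    ultimately show ?thesis unfolding real_norm_def by linarith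
  qed
  then show ?thesis by (intro integrable_const_bound[OF AE_I2 m])
qed

text \<open>The trivial partition has entropy zero.\<close>

lemma KS_entropy_nonneg:
  assumes "\<mu> \<in> invariant_measures r M"
  shows "0 \<le> KS_entropy \<mu> \<sigma>"
proof -
  interpret prob_space \<mu> by (rule invariant_measureD(1)[OF assms])
  have space: "space \<mu> = S" by (rule invariant_measureD(3)[OF assms])
  have ne: "S \<noteq> {}" using not_empty space by simp
  let ?P = "{space \<mu>}"
  have pull: "pullback_partition \<mu> (\<sigma> ^^ i) ?P = {S}" for i
  proof -
    have "(\<sigma> ^^ i) -` S \<inter> S = S" using shift_funpow_in_S by blast
    then show ?thesis unfolding pullback_partition_def space using ne by simp
  qed
  have "partition_entropy \<mu> (dynamical_join \<mu> \<sigma> ?P n) / real n = 0" for n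
  proof (cases "n = 0")
    case False
    have "(\<lambda>i. pullback_partition \<mu> (\<sigma> ^^ i) ?P) ` {..<n} = {{S}}"
      using False unfolding pull by auto
    then have "dynamical_join \<mu> \<sigma> ?P n = {S}"
      using ne unfolding dynamical_join_def common_refinement by (auto simp: Pi_iff)
    moreover have "measure \<mu> S = 1" using prob_space space by simp
    ultimately show ?thesis by (simp add: partition_entropy_def)
  qed simp
  then have "entropy_wrt_partition \<mu> \<sigma> ?P = 0"
    unfolding entropy_wrt_partition_def by (simp only: lim_const)
  moreover have "finite_measurable_partition \<mu> ?P"
    unfolding finite_measurable_partition_def using not_empty by (auto simp: partition_on_def disjoint_def)
  ultimately show ?thesis
    unfolding KS_entropy_def by (intro SUP_upper2[of ?P]) auto
qed

end

section \<open>The zero temperature limit\<close>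

locale effective_system = subshift_system +
  fixes A :: "(nat \<Rightarrow> nat) \<times> (nat \<Rightarrow> nat) \<Rightarrow> real"
    and \<phi> :: "real \<Rightarrow> (nat \<Rightarrow> nat) \<Rightarrow> real" and lam :: "real \<Rightarrow> real"
  assumes A_lipschitz: "Lipschitz_continuous_map (metric (two_sided_subshift r M, pair_dist \<Lambda>)) euclidean_metric A"
    and effective: "\<And>\<beta>. \<beta> > 0 \<Longrightarrow> effective_potential r M \<Lambda> (\<lambda>p. \<beta> * A p) (\<phi> \<beta>) (lam \<beta>)"
    and S_nonempty: "S \<noteq> {}"
begin

abbreviation "A0 \<equiv> zero_ext M A"

lemma in_two_sided: "(y, x) \<in> two_sided_subshift r M \<longleftrightarrow> y \<in> S \<and> x \<in> S \<and> M (y 0) (x 0) = 1"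
  by (simp add: two_sided_subshift_def dual_eq)

lemma M_01: "y \<in> S \<Longrightarrow> x \<in> S \<Longrightarrow> M (y 0) (x 0) = 0 \<or> M (y 0) (x 0) = 1"
  using transition letter_in unfolding transition_matrix_def by blast

lemma A0_eq: "(y, x) \<in> two_sided_subshift r M \<Longrightarrow> A0 y x = A (y, x)"
  by (simp add: in_two_sided zero_ext_def)

lemma A0_cases:
  assumes "y \<in> S" "x \<in> S"
  shows "A0 y x = 0 \<and> M (y 0) (x 0) = 0 \<or> A0 y x = A (y, x) \<and> (y, x) \<in> two_sided_subshift r M"
  using M_01[OF assms] assms by (auto simp: in_two_sided zero_ext_def)

text \<open>Here symmetry of the matrix is essential: the transition from \<open>x\<^sub>0\<close> to \<open>x\<^sub>1\<close> is also one from \<open>x\<^sub>1\<close>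
to \<open>x\<^sub>0\<close>.\<close>

lemma shift_pair_in_two_sided: "x \<in> S \<Longrightarrow> (\<sigma> x, x) \<in> two_sided_subshift r M"
  unfolding in_two_sided using shift_in_S[of x] letter_in[of x] M_sym[of "x 0" "x 1"]
  by (simp add: in_S shift_map_def)

text \<open>The transition \<open>M (y 0) (x 0)\<close> can change only when a first letter does, that is, at distance one, where
any bounded function satisfies a Lipschitz estimate. Hence the extension by zero is Lipschitz in each variable.\<close>

lemma A_bounds:
  obtains a where "0 \<le> a" "\<And>p. p \<in> two_sided_subshift r M \<Longrightarrow> \<bar>A p\<bar> \<le> a"
    "\<And>y y' x. y \<in> S \<Longrightarrow> y' \<in> S \<Longrightarrow> x \<in> S \<Longrightarrow> \<bar>A0 y x - A0 y' x\<bar> \<le> a * d y y'"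
    "\<And>y x x'. y \<in> S \<Longrightarrow> x \<in> S \<Longrightarrow> x' \<in> S \<Longrightarrow> \<bar>A0 y x - A0 y x'\<bar> \<le> a * d x x'"
proof -
  let ?T = "two_sided_subshift r M"
  note met = Metric_space_pair_dist[OF \<Lambda>_pos \<Lambda>_less]
  from A_lipschitz obtain B where "\<forall>p\<in>?T. \<forall>q\<in>?T. dist (A p) (A q) \<le> B * pair_dist \<Lambda> p q"
    unfolding Lipschitz_continuous_map_def Metric_space.mspace_metric[OF met] Metric_space.mdist_metric[OF met]
      mdist_euclidean_metric by blast
  then have B: "dist (A p) (A q) \<le> B * pair_dist \<Lambda> p q" if "p \<in> ?T" "q \<in> ?T" for p q
    using that by blast
  define b where "b = max B 0"
  have b: "0 \<le> b" by (simp add: b_def)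
  have pd: "0 \<le> pair_dist \<Lambda> p q" "pair_dist \<Lambda> p q \<le> 1" for p q
    unfolding pair_dist_def using d_nonneg d_le_1 by (simp_all add: le_max_iff_disj)
  have lip: "\<bar>A p - A q\<bar> \<le> b * pair_dist \<Lambda> p q" if "p \<in> ?T" "q \<in> ?T" for p q
  proof -
    have "\<bar>A p - A q\<bar> \<le> B * pair_dist \<Lambda> p q" using B[OF that] by (simp add: dist_real_def)
    also have "\<dots> \<le> b * pair_dist \<Lambda> p q" by (intro mult_right_mono pd) (simp add: b_def)
    finally show ?thesis .
  qed
  obtain s where s: "s \<in> S" using S_nonempty by blast
  define c where "c = \<bar>A (\<sigma> s, s)\<bar> + b"
  have c: "\<bar>A p\<bar> \<le> c" if "p \<in> ?T" for p
  proof -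
    have "\<bar>A p - A (\<sigma> s, s)\<bar> \<le> b * pair_dist \<Lambda> p (\<sigma> s, s)"
      by (rule lip[OF that shift_pair_in_two_sided[OF s]])
    also have "\<dots> \<le> b * 1" by (intro mult_left_mono pd b)
    finally show ?thesis unfolding c_def by linarith
  qed
  have c0: "0 \<le> c" using b by (simp add: c_def)
  have A0c: "\<bar>A0 y x\<bar> \<le> c" if "y \<in> S" "x \<in> S" for y x
    using A0_cases[OF that] c c0 by fastforce
  define a where "a = 2 * c + b"
  have ba: "b * t \<le> a * t" if "0 \<le> t" for t
    using that c0 by (intro mult_right_mono) (simp_all add: a_def)
  have far: "\<bar>u - v\<bar> \<le> a" if "\<bar>u\<bar> \<le> c" "\<bar>v\<bar> \<le> c" for u v
    using that b unfolding a_def by linarith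
  show ?thesis
  proof (rule that[of a])
    show "0 \<le> a" using b c0 by (simp add: a_def)
    show "\<bar>A p\<bar> \<le> a" if "p \<in> ?T" for p using c[OF that] b c0 unfolding a_def by linarith
    show "\<bar>A0 y x - A0 y' x\<bar> \<le> a * d y y'" if y: "y \<in> S" and y': "y' \<in> S" and x: "x \<in> S" for y y' x
    proof (cases "y 0 = y' 0")
      case False
      show ?thesis unfolding seq_dist_eq_1[of y y', OF False] mult_1_right
        by (rule far[OF A0c[OF y x] A0c[OF y' x]])
    next
      case True
      consider "A0 y x = 0" "A0 y' x = 0"
        | "A0 y x = A (y, x)" "A0 y' x = A (y', x)" "(y, x) \<in> ?T" "(y', x) \<in> ?T"
        using A0_cases[OF y x] A0_cases[OF y' x] True by (auto simp: in_two_sided)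
      then show ?thesis
      proof cases
        case 1
        then show ?thesis using ba[OF d_nonneg[of y y']] b mult_nonneg_nonneg[OF b d_nonneg[of y y']]
          by linarith
      next
        case 2
        have "pair_dist \<Lambda> (y, x) (y', x) = d y y'"
          using d_nonneg[of y y'] by (simp add: pair_dist_def seq_dist_def)
        then show ?thesis using lip[OF 2(3,4)] ba[OF d_nonneg[of y y']] unfolding 2(1,2) by simp
      qed
    qed
    show "\<bar>A0 y x - A0 y x'\<bar> \<le> a * d x x'" if y: "y \<in> S" and x: "x \<in> S" and x': "x' \<in> S" for y x x'
    proof (cases "x 0 = x' 0")
      case False
      show ?thesis unfolding seq_dist_eq_1[of x x', OF False] mult_1_right
        by (rule far[OF A0c[OF y x] A0c[OF y x']])
    next
      case True
      consider "A0 y x = 0" "A0 y x' = 0"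
        | "A0 y x = A (y, x)" "A0 y x' = A (y, x')" "(y, x) \<in> ?T" "(y, x') \<in> ?T"
        using A0_cases[OF y x] A0_cases[OF y x'] True by (auto simp: in_two_sided)
      then show ?thesis
      proof cases
        case 1
        then show ?thesis using ba[OF d_nonneg[of x x']] b mult_nonneg_nonneg[OF b d_nonneg[of x x']]
          by linarith
      next
        case 2
        have "pair_dist \<Lambda> (y, x) (y, x') = d x x'"
          using d_nonneg[of x x'] by (simp add: pair_dist_def seq_dist_def)
        then show ?thesis using lip[OF 2(3,4)] ba[OF d_nonneg[of x x']] unfolding 2(1,2) by simp
      qed
    qed
  qed
qed

lemma A0_lipschitz: "y \<in> S \<Longrightarrow> A0 y \<in> lipschitz_functions r M \<Lambda>"
  unfolding lipschitz_functions_iff using A_bounds by metis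

lemma \<phi>_lipschitz: "0 < \<beta> \<Longrightarrow> \<phi> \<beta> \<in> lipschitz_functions r M \<Lambda>"
  using effective unfolding effective_potential_def by blast

lemma integrable_A0: "y \<in> S \<Longrightarrow> \<mu> \<in> invariant_measures r M \<Longrightarrow> integrable \<mu> (A0 y)"
  by (intro lipschitz_integrable A0_lipschitz)

lemma integrable_\<phi>: "0 < \<beta> \<Longrightarrow> \<mu> \<in> invariant_measures r M \<Longrightarrow> integrable \<mu> (\<phi> \<beta>)"
  by (intro lipschitz_integrable \<phi>_lipschitz)

lemma effective_eq:
  assumes "0 < \<beta>" "y \<in> S"
  shows "(SUP \<mu> \<in> invariant_measures r M.
      ereal (\<beta> * (\<integral>x. A0 y x \<partial>\<mu>) + (\<integral>x. \<phi> \<beta> x \<partial>\<mu>)) + KS_entropy \<mu> \<sigma>) = ereal (\<phi> \<beta> y + lam \<beta>)"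
proof -
  have "forward_operator r M (\<lambda>p. \<beta> * A p) (\<phi> \<beta>) y = ereal (\<phi> \<beta> y + lam \<beta>)"
    using effective[OF assms(1)] assms(2) unfolding effective_potential_def dual_eq by blast
  moreover have "(\<integral>x. zero_ext M (\<lambda>p. \<beta> * A p) y x + \<phi> \<beta> x \<partial>\<mu>) =
      \<beta> * (\<integral>x. A0 y x \<partial>\<mu>) + (\<integral>x. \<phi> \<beta> x \<partial>\<mu>)" if "\<mu> \<in> invariant_measures r M" for \<mu>
  proof -
    have "(\<integral>x. zero_ext M (\<lambda>p. \<beta> * A p) y x + \<phi> \<beta> x \<partial>\<mu>) = (\<integral>x. \<beta> * A0 y x + \<phi> \<beta> x \<partial>\<mu>)"
      by (simp add: zero_ext_def mult.assoc)
    also have "\<dots> = \<beta> * (\<integral>x. A0 y x \<partial>\<mu>) + (\<integral>x. \<phi> \<beta> x \<partial>\<mu>)"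
      using integrable_A0[OF assms(2) that] integrable_\<phi>[OF assms(1) that]
      by (subst Bochner_Integration.integral_add) simp_all
    finally show ?thesis .
  qed
  ultimately show ?thesis unfolding forward_operator_def by (simp cong: SUP_cong)
qed

lemma effective_upper:
  assumes "0 < \<beta>" "y \<in> S" "\<mu> \<in> invariant_measures r M"
  shows "ereal (\<beta> * (\<integral>x. A0 y x \<partial>\<mu>) + (\<integral>x. \<phi> \<beta> x \<partial>\<mu>)) + KS_entropy \<mu> \<sigma> \<le> ereal (\<phi> \<beta> y + lam \<beta>)"
  unfolding effective_eq[OF assms(1,2), symmetric] by (rule SUP_upper[OF assms(3)])

lemma effective_integral_le:
  assumes "0 < \<beta>" "y \<in> S" "\<mu> \<in> invariant_measures r M"
  shows "\<beta> * (\<integral>x. A0 y x \<partial>\<mu>) + (\<integral>x. \<phi> \<beta> x \<partial>\<mu>) \<le> \<phi> \<beta> y + lam \<beta>"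
proof -
  have "ereal (\<beta> * (\<integral>x. A0 y x \<partial>\<mu>) + (\<integral>x. \<phi> \<beta> x \<partial>\<mu>)) \<le>
    ereal (\<beta> * (\<integral>x. A0 y x \<partial>\<mu>) + (\<integral>x. \<phi> \<beta> x \<partial>\<mu>)) + KS_entropy \<mu> \<sigma>"
    using KS_entropy_nonneg[OF assms(3)] by (intro add_increasing2) simp_all
  also have "\<dots> \<le> ereal (\<phi> \<beta> y + lam \<beta>)" by (rule effective_upper[OF assms])
  finally show ?thesis by simp
qed

lemma integral_bounds:
  fixes f :: "(nat \<Rightarrow> nat) \<Rightarrow> real"
  assumes "\<mu> \<in> invariant_measures r M" "integrable \<mu> f" "\<And>x. x \<in> S \<Longrightarrow> f x \<le> b"
  shows "(\<integral>x. f x \<partial>\<mu>) \<le> b"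
proof -
  interpret prob_space \<mu> by (rule invariant_measureD(1)[OF assms(1)])
  show ?thesis
    by (rule integral_le_const[OF assms(2)], rule AE_I2) (use assms(3) invariant_measureD(3)[OF assms(1)] in simp)
qed

text \<open>At \<open>\<beta> = 1\<close> the supremum defining the operator is a real number and the integrals in it are
bounded below uniformly, so the entropies are bounded above uniformly.\<close>

lemma entropy_bounded:
  obtains h where "0 \<le> h" "\<And>\<mu>. \<mu> \<in> invariant_measures r M \<Longrightarrow> KS_entropy \<mu> \<sigma> \<le> ereal h"
proof -
  obtain s where s: "s \<in> S" using S_nonempty by blast
  obtain a where a: "0 \<le> a" "\<And>x x'. x \<in> S \<Longrightarrow> x' \<in> S \<Longrightarrow> \<bar>A0 s x - A0 s x'\<bar> \<le> a * d x x'"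
    using lipschitz_functionsE[OF A0_lipschitz[OF s]] by blast
  obtain b where b: "0 \<le> b" "\<And>x x'. x \<in> S \<Longrightarrow> x' \<in> S \<Longrightarrow> \<bar>\<phi> 1 x - \<phi> 1 x'\<bar> \<le> b * d x x'"
    using lipschitz_functionsE[OF \<phi>_lipschitz[of 1]] by auto
  define l where "l = (a - A0 s s) + (b - \<phi> 1 s)"
  define h where "h = max 0 (\<phi> 1 s + lam 1 + l)"
  have "KS_entropy \<mu> \<sigma> \<le> ereal h" if \<mu>: "\<mu> \<in> invariant_measures r M" for \<mu>
  proof -
    let ?I = "1 * (\<integral>x. A0 s x \<partial>\<mu>) + (\<integral>x. \<phi> 1 x \<partial>\<mu>)"
    have "(\<integral>x. - A0 s x \<partial>\<mu>) \<le> a - A0 s s"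
    proof (rule integral_bounds[OF \<mu>])
      fix x assume x: "x \<in> S"
      have "a * d x s \<le> a * 1" by (intro mult_left_mono d_le_1 a)
      then show "- A0 s x \<le> a - A0 s s" using a(2)[OF x s] by linarith
    qed (use integrable_A0[OF s \<mu>] in simp)
    moreover have "(\<integral>x. - \<phi> 1 x \<partial>\<mu>) \<le> b - \<phi> 1 s"
    proof (rule integral_bounds[OF \<mu>])
      fix x assume x: "x \<in> S"
      have "b * d x s \<le> b * 1" by (intro mult_left_mono d_le_1 b)
      then show "- \<phi> 1 x \<le> b - \<phi> 1 s" using b(2)[OF x s] by linarith
    qed (use integrable_\<phi>[of 1, OF _ \<mu>] in simp)
    ultimately have I: "- ?I \<le> l" unfolding l_def by simp
    have "ereal ?I + KS_entropy \<mu> \<sigma> \<le> ereal (\<phi> 1 s + lam 1)"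
      by (rule effective_upper[OF _ s \<mu>]) simp
    then have "KS_entropy \<mu> \<sigma> \<le> ereal (\<phi> 1 s + lam 1 - ?I)"
      by (cases "KS_entropy \<mu> \<sigma>") auto
    also have "\<phi> 1 s + lam 1 - ?I \<le> h" using I unfolding h_def by linarith
    then have "ereal (\<phi> 1 s + lam 1 - ?I) \<le> ereal h" by (simp only: ereal_less_eq)
    finally show ?thesis .
  qed
  moreover have "0 \<le> h" unfolding h_def by (rule max.cobounded1)
  ultimately show ?thesis by (rule that[rotated])
qed

lemma effective_integral_ge:
  assumes "0 < \<beta>" "y \<in> S" "0 < e" and h: "\<And>\<mu>. \<mu> \<in> invariant_measures r M \<Longrightarrow> KS_entropy \<mu> \<sigma> \<le> ereal h"
  shows "\<exists>\<mu>\<in>invariant_measures r M. \<phi> \<beta> y + lam \<beta> - e - h < \<beta> * (\<integral>x. A0 y x \<partial>\<mu>) + (\<integral>x. \<phi> \<beta> x \<partial>\<mu>)"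
proof -
  have "ereal (\<phi> \<beta> y + lam \<beta> - e) < ereal (\<phi> \<beta> y + lam \<beta>)" using assms(3) by simp
  then obtain \<mu> where \<mu>: "\<mu> \<in> invariant_measures r M"
    "ereal (\<phi> \<beta> y + lam \<beta> - e) < ereal (\<beta> * (\<integral>x. A0 y x \<partial>\<mu>) + (\<integral>x. \<phi> \<beta> x \<partial>\<mu>)) + KS_entropy \<mu> \<sigma>"
    unfolding effective_eq[OF assms(1,2), symmetric] less_SUP_iff by blast
  note \<mu>(2)
  also have "ereal (\<beta> * (\<integral>x. A0 y x \<partial>\<mu>) + (\<integral>x. \<phi> \<beta> x \<partial>\<mu>)) + KS_entropy \<mu> \<sigma> \<le>
    ereal (\<beta> * (\<integral>x. A0 y x \<partial>\<mu>) + (\<integral>x. \<phi> \<beta> x \<partial>\<mu>)) + ereal h"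
    by (intro add_left_mono h \<mu>(1))
  finally show ?thesis using \<mu>(1) by (intro bexI[of _ \<mu>]) simp_all
qed

text \<open>Fixed once, because the estimates for the effective potentials and for their limit must share the constant.\<close>

definition A_const :: real where
  "A_const = (SOME a. 0 \<le> a \<and> (\<forall>p\<in>two_sided_subshift r M. \<bar>A p\<bar> \<le> a) \<and>
     (\<forall>y\<in>S. \<forall>y'\<in>S. \<forall>x\<in>S. \<bar>A0 y x - A0 y' x\<bar> \<le> a * d y y') \<and>
     (\<forall>y\<in>S. \<forall>x\<in>S. \<forall>x'\<in>S. \<bar>A0 y x - A0 y x'\<bar> \<le> a * d x x'))"

lemma A_const:
  shows A_const_nonneg: "0 \<le> A_const"
    and A_const_bound: "p \<in> two_sided_subshift r M \<Longrightarrow> \<bar>A p\<bar> \<le> A_const"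
    and A_const_fst: "y \<in> S \<Longrightarrow> y' \<in> S \<Longrightarrow> x \<in> S \<Longrightarrow> \<bar>A0 y x - A0 y' x\<bar> \<le> A_const * d y y'"
    and A_const_snd: "y \<in> S \<Longrightarrow> x \<in> S \<Longrightarrow> x' \<in> S \<Longrightarrow> \<bar>A0 y x - A0 y x'\<bar> \<le> A_const * d x x'"
proof -
  obtain a where a: "0 \<le> a" "\<And>p. p \<in> two_sided_subshift r M \<Longrightarrow> \<bar>A p\<bar> \<le> a"
    "\<And>y y' x. y \<in> S \<Longrightarrow> y' \<in> S \<Longrightarrow> x \<in> S \<Longrightarrow> \<bar>A0 y x - A0 y' x\<bar> \<le> a * d y y'"
    "\<And>y x x'. y \<in> S \<Longrightarrow> x \<in> S \<Longrightarrow> x' \<in> S \<Longrightarrow> \<bar>A0 y x - A0 y x'\<bar> \<le> a * d x x'"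
    using A_bounds by blast
  have "\<exists>a. 0 \<le> a \<and> (\<forall>p\<in>two_sided_subshift r M. \<bar>A p\<bar> \<le> a) \<and>
     (\<forall>y\<in>S. \<forall>y'\<in>S. \<forall>x\<in>S. \<bar>A0 y x - A0 y' x\<bar> \<le> a * d y y') \<and>
     (\<forall>y\<in>S. \<forall>x\<in>S. \<forall>x'\<in>S. \<bar>A0 y x - A0 y x'\<bar> \<le> a * d x x')"
    by (intro exI[of _ a] conjI ballI) (rule a; assumption)+
  from someI_ex[OF this, folded A_const_def]
  show "0 \<le> A_const" "p \<in> two_sided_subshift r M \<Longrightarrow> \<bar>A p\<bar> \<le> A_const"
    "y \<in> S \<Longrightarrow> y' \<in> S \<Longrightarrow> x \<in> S \<Longrightarrow> \<bar>A0 y x - A0 y' x\<bar> \<le> A_const * d y y'"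
    "y \<in> S \<Longrightarrow> x \<in> S \<Longrightarrow> x' \<in> S \<Longrightarrow> \<bar>A0 y x - A0 y x'\<bar> \<le> A_const * d x x'"
    by blast+
qed

text \<open>The effective potential inherits the Lipschitz constant of the potential: only the term
\<open>\<beta> A(y, x)\<close> in the supremum depends on \<open>y\<close>. The linear growth in \<open>\<beta>\<close> is what makes the scaled potentials
equi-Lipschitz.\<close>

lemma \<phi>_lip:
  assumes \<beta>: "0 < \<beta>" and y: "y \<in> S" and y': "y' \<in> S"
  shows "\<phi> \<beta> y - \<phi> \<beta> y' \<le> \<beta> * (A_const * d y y')"
proof -
  let ?c = "\<beta> * (A_const * d y y')"
  have "ereal (\<phi> \<beta> y + lam \<beta>) \<le> ereal (\<phi> \<beta> y' + lam \<beta> + ?c)"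
    unfolding effective_eq[OF \<beta> y, symmetric]
  proof (rule SUP_least)
    fix \<mu> assume \<mu>: "\<mu> \<in> invariant_measures r M"
    have "(\<integral>x. A0 y x - A0 y' x \<partial>\<mu>) \<le> A_const * d y y'"
      by (rule integral_bounds[OF \<mu>])
        (use A_const_fst[OF y y'] integrable_A0[OF _ \<mu>] y y' in \<open>auto simp: abs_le_iff\<close>)
    then have "(\<integral>x. A0 y x \<partial>\<mu>) \<le> (\<integral>x. A0 y' x \<partial>\<mu>) + A_const * d y y'"
      using integrable_A0[OF y \<mu>] integrable_A0[OF y' \<mu>] by simp
    from mult_left_mono[OF this less_imp_le[OF \<beta>]]
    have I: "\<beta> * (\<integral>x. A0 y x \<partial>\<mu>) \<le> \<beta> * (\<integral>x. A0 y' x \<partial>\<mu>) + ?c"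
      by (simp only: distrib_left)
    obtain h where "KS_entropy \<mu> \<sigma> \<le> ereal h" using entropy_bounded \<mu> by blast
    then obtain k where k: "KS_entropy \<mu> \<sigma> = ereal k"
      using KS_entropy_nonneg[OF \<mu>] by (cases "KS_entropy \<mu> \<sigma>") auto
    have "\<beta> * (\<integral>x. A0 y' x \<partial>\<mu>) + (\<integral>x. \<phi> \<beta> x \<partial>\<mu>) + k \<le> \<phi> \<beta> y' + lam \<beta>"
      using effective_upper[OF \<beta> y' \<mu>] unfolding k by simp
    then show "ereal (\<beta> * (\<integral>x. A0 y x \<partial>\<mu>) + (\<integral>x. \<phi> \<beta> x \<partial>\<mu>)) + KS_entropy \<mu> \<sigma>
        \<le> ereal (\<phi> \<beta> y' + lam \<beta> + ?c)"
      unfolding k plus_ereal.simps ereal_less_eq using I by linarith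
  qed
  then show ?thesis by simp
qed

text \<open>A maximum principle. Let \<open>s\<close> be the supremum of the difference \<open>D\<close> of the two scaled effective
potentials. A measure that is nearly optimal for \<open>\<beta>\<close> at \<open>y\<close> is admissible for \<open>\<gamma>\<close>, and
\<open>D\<close> integrates to at most \<open>s\<close>; this bounds \<open>D y\<close> by \<open>s\<close> plus the difference of the
constants, up to the entropy error. Taking the supremum over \<open>y\<close> cancels \<open>s\<close>.\<close>

lemma effective_constant_compare:
  assumes \<beta>: "0 < \<beta>" and \<gamma>: "0 < \<gamma>"
    and h: "\<And>\<mu>. \<mu> \<in> invariant_measures r M \<Longrightarrow> KS_entropy \<mu> \<sigma> \<le> ereal h"
  shows "lam \<beta> / \<beta> \<le> lam \<gamma> / \<gamma> + h / \<beta>"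
proof (rule field_le_epsilon)
  fix e :: real assume e: "0 < e"
  define D where "D x = \<phi> \<beta> x / \<beta> - \<phi> \<gamma> x / \<gamma>" for x
  define s where "s = (SUP x\<in>S. D x)"
  obtain z where z: "z \<in> S" using S_nonempty by blast
  have osc: "\<phi> \<alpha> y / \<alpha> \<le> \<phi> \<alpha> y' / \<alpha> + A_const" if \<alpha>: "0 < \<alpha>" and y: "y \<in> S" and y': "y' \<in> S" for \<alpha> y y'
  proof -
    have "\<phi> \<alpha> y - \<phi> \<alpha> y' \<le> \<alpha> * (A_const * d y y')" by (rule \<phi>_lip[OF \<alpha> y y'])
    also have "\<dots> \<le> \<alpha> * (A_const * 1)"
      using \<alpha> by (intro mult_left_mono A_const_nonneg d_le_1) simp
    finally show ?thesis using \<alpha> by (simp add: field_simps)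
  qed
  have bdd: "bdd_above (D ` S)"
  proof (rule bdd_aboveI2)
    fix x assume x: "x \<in> S"
    show "D x \<le> D z + 2 * A_const"
      unfolding D_def using osc[OF \<beta> x z] osc[OF \<gamma> z x] by linarith
  qed
  have "D y \<le> s + (lam \<gamma> / \<gamma> - lam \<beta> / \<beta> + h / \<beta> + e)" if y: "y \<in> S" for y
  proof -
    obtain \<mu> where \<mu>: "\<mu> \<in> invariant_measures r M"
      and ge: "\<phi> \<beta> y + lam \<beta> - \<beta> * e - h < \<beta> * (\<integral>x. A0 y x \<partial>\<mu>) + (\<integral>x. \<phi> \<beta> x \<partial>\<mu>)"
      using effective_integral_ge[OF \<beta> y _ h, of "\<beta> * e"] \<beta> e by auto
    have "(\<phi> \<beta> y + lam \<beta> - \<beta> * e - h) / \<beta> < (\<beta> * (\<integral>x. A0 y x \<partial>\<mu>) + (\<integral>x. \<phi> \<beta> x \<partial>\<mu>)) / \<beta>"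
      using ge \<beta> by (rule divide_strict_right_mono)
    then have 1: "\<phi> \<beta> y / \<beta> + lam \<beta> / \<beta> - e - h / \<beta> < (\<integral>x. A0 y x \<partial>\<mu>) + (\<integral>x. \<phi> \<beta> x \<partial>\<mu>) / \<beta>"
      using \<beta> by (simp add: diff_divide_distrib add_divide_distrib)
    have "(\<gamma> * (\<integral>x. A0 y x \<partial>\<mu>) + (\<integral>x. \<phi> \<gamma> x \<partial>\<mu>)) / \<gamma> \<le> (\<phi> \<gamma> y + lam \<gamma>) / \<gamma>"
      using effective_integral_le[OF \<gamma> y \<mu>] \<gamma> by (intro divide_right_mono) simp_all
    then have 2: "(\<integral>x. A0 y x \<partial>\<mu>) + (\<integral>x. \<phi> \<gamma> x \<partial>\<mu>) / \<gamma> \<le> \<phi> \<gamma> y / \<gamma> + lam \<gamma> / \<gamma>"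
      using \<gamma> by (simp add: add_divide_distrib)
    have "(\<integral>x. D x \<partial>\<mu>) \<le> s"
    proof (rule integral_bounds[OF \<mu>])
      show "integrable \<mu> D"
        unfolding D_def using integrable_\<phi>[OF \<beta> \<mu>] integrable_\<phi>[OF \<gamma> \<mu>] by simp
      show "D x \<le> s" if "x \<in> S" for x unfolding s_def by (rule cSUP_upper[OF that bdd])
    qed
    moreover have "(\<integral>x. D x \<partial>\<mu>) = (\<integral>x. \<phi> \<beta> x \<partial>\<mu>) / \<beta> - (\<integral>x. \<phi> \<gamma> x \<partial>\<mu>) / \<gamma>"
      unfolding D_def using integrable_\<phi>[OF \<beta> \<mu>] integrable_\<phi>[OF \<gamma> \<mu>] by simp
    ultimately show ?thesis unfolding D_def using 1 2 by linarith
  qed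
  then have "s \<le> s + (lam \<gamma> / \<gamma> - lam \<beta> / \<beta> + h / \<beta> + e)"
    unfolding s_def by (intro cSUP_least S_nonempty) (simp add: s_def)
  then show "lam \<beta> / \<beta> \<le> lam \<gamma> / \<gamma> + h / \<beta> + e" by linarith
qed

text \<open>By the comparison each quotient is within \<open>h / \<beta>\<close> of the infimum of all of them.\<close>

lemma effective_constant_limit:
  obtains h m where "0 \<le> h" "\<forall>\<mu>\<in>invariant_measures r M. KS_entropy \<mu> \<sigma> \<le> ereal h"
    "\<forall>\<beta>>0. m \<le> lam \<beta> / \<beta> \<and> lam \<beta> / \<beta> \<le> m + h / \<beta>"
    "((\<lambda>\<beta>. lam \<beta> / \<beta>) \<longlongrightarrow> m) at_top"
proof -
  obtain h where h: "0 \<le> h" "\<And>\<mu>. \<mu> \<in> invariant_measures r M \<Longrightarrow> KS_entropy \<mu> \<sigma> \<le> ereal h"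
    using entropy_bounded by blast
  define m where "m = (INF \<beta>\<in>{0<..}. lam \<beta> / \<beta>)"
  have cmp: "lam \<beta> / \<beta> - h / \<beta> \<le> lam \<gamma> / \<gamma>" if "0 < \<beta>" "0 < \<gamma>" for \<beta> \<gamma>
    using effective_constant_compare[OF that h(2)] by linarith
  have bdd: "bdd_below ((\<lambda>\<beta>. lam \<beta> / \<beta>) ` {0<..})"
    by (rule bdd_belowI2[of _ "lam 1 / 1 - h / 1"]) (use cmp[of 1] in simp)
  have lo: "m \<le> lam \<beta> / \<beta>" if "0 < \<beta>" for \<beta>
    unfolding m_def by (rule cINF_lower[OF bdd]) (simp add: that)
  have up: "lam \<beta> / \<beta> \<le> m + h / \<beta>" if \<beta>: "0 < \<beta>" for \<beta>
  proof -
    have "lam \<beta> / \<beta> - h / \<beta> \<le> m"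
      unfolding m_def by (rule cINF_greatest) (use cmp[OF \<beta>] in simp_all)
    then show ?thesis by linarith
  qed
  have "((\<lambda>\<beta>. lam \<beta> / \<beta>) \<longlongrightarrow> m) at_top"
  proof (rule tendsto_sandwich[where f = "\<lambda>_. m" and h = "\<lambda>\<beta>. m + h / \<beta>"])
    show "eventually (\<lambda>\<beta>. m \<le> lam \<beta> / \<beta>) at_top"
      using eventually_gt_at_top[of 0] by eventually_elim (rule lo)
    show "eventually (\<lambda>\<beta>. lam \<beta> / \<beta> \<le> m + h / \<beta>) at_top"
      using eventually_gt_at_top[of 0] by eventually_elim (rule up)
    have "((\<lambda>\<beta>::real. h / \<beta>) \<longlongrightarrow> 0) at_top"
      by (rule tendsto_divide_0[OF tendsto_const filterlim_at_top_imp_at_infinity[OF filterlim_ident]])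
    from tendsto_add[OF tendsto_const[of m] this]
    show "((\<lambda>\<beta>. m + h / \<beta>) \<longlongrightarrow> m) at_top" by simp
  qed simp
  moreover have "\<forall>\<mu>\<in>invariant_measures r M. KS_entropy \<mu> \<sigma> \<le> ereal h" by (intro ballI h(2))
  moreover have "\<forall>\<beta>>0. m \<le> lam \<beta> / \<beta> \<and> lam \<beta> / \<beta> \<le> m + h / \<beta>" by (intro allI impI conjI lo up)
  ultimately show ?thesis using h(1) that by blast
qed

end

locale zero_temperature_limit = effective_system +
  fixes \<beta>s :: "nat \<Rightarrow> real" and V :: "(nat \<Rightarrow> nat) \<Rightarrow> real"
  assumes \<beta>s_pos: "\<And>n. \<beta>s n > 0" and \<beta>s_lim: "filterlim \<beta>s at_top sequentially"
    and V_lim: "uniform_limit S (\<lambda>n y. \<phi> (\<beta>s n) y / \<beta>s n) V sequentially"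
begin

lemma V_lip:
  assumes y: "y \<in> S" and y': "y' \<in> S"
  shows "\<bar>V y - V y'\<bar> \<le> A_const * d y y'"
proof -
  have one: "V y - V y' \<le> A_const * d y y'" if y: "y \<in> S" and y': "y' \<in> S" for y y'
  proof (rule LIMSEQ_le_const2)
    show "(\<lambda>n. \<phi> (\<beta>s n) y / \<beta>s n - \<phi> (\<beta>s n) y' / \<beta>s n) \<longlonglongrightarrow> V y - V y'"
      by (intro tendsto_diff tendsto_uniform_limitI[OF V_lim] y y')
    have "\<phi> (\<beta>s n) y / \<beta>s n - \<phi> (\<beta>s n) y' / \<beta>s n \<le> A_const * d y y'" for n
    proof -
      have "(\<phi> (\<beta>s n) y - \<phi> (\<beta>s n) y') / \<beta>s n \<le> \<beta>s n * (A_const * d y y') / \<beta>s n"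
        using \<phi>_lip[OF \<beta>s_pos y y', of n] \<beta>s_pos[of n] by (intro divide_right_mono) simp_all
      then show ?thesis using \<beta>s_pos[of n] by (simp add: diff_divide_distrib)
    qed
    then show "\<exists>N. \<forall>n\<ge>N. \<phi> (\<beta>s n) y / \<beta>s n - \<phi> (\<beta>s n) y' / \<beta>s n \<le> A_const * d y y'" by blast
  qed
  show ?thesis using one[OF y y'] one[OF y' y] unfolding seq_dist_commute[of \<Lambda> y' y] by linarith
qed

lemma V_lipschitz: "V \<in> lipschitz_functions r M \<Lambda>"
  unfolding lipschitz_functions_iff using V_lip by blast

lemma integrable_V: "\<mu> \<in> invariant_measures r M \<Longrightarrow> integrable \<mu> V"
  by (rule lipschitz_integrable[OF V_lipschitz])

text \<open>The limit of the fixed point equations. The entropy contributes at most \<open>h / \<beta>\<close>, and uniform convergence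
controls the integrals of the scaled potentials simultaneously for all invariant measures.\<close>

lemma limit_equation:
  obtains m where "((\<lambda>\<beta>. lam \<beta> / \<beta>) \<longlongrightarrow> m) at_top"
    "\<forall>y\<in>S. \<forall>\<mu>\<in>invariant_measures r M. (\<integral>x. A0 y x \<partial>\<mu>) + (\<integral>x. V x \<partial>\<mu>) \<le> V y + m"
    "\<forall>y\<in>S. \<forall>e>0. \<exists>\<mu>\<in>invariant_measures r M. V y + m - e < (\<integral>x. A0 y x \<partial>\<mu>) + (\<integral>x. V x \<partial>\<mu>)"
proof -
  obtain h m where h: "0 \<le> h" and ent: "\<forall>\<mu>\<in>invariant_measures r M. KS_entropy \<mu> \<sigma> \<le> ereal h"
    and lo_up: "\<forall>\<beta>>0. m \<le> lam \<beta> / \<beta> \<and> lam \<beta> / \<beta> \<le> m + h / \<beta>"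
    and lim: "((\<lambda>\<beta>. lam \<beta> / \<beta>) \<longlongrightarrow> m) at_top"
    by (rule effective_constant_limit)
  have lo: "m \<le> lam \<beta> / \<beta>" and up: "lam \<beta> / \<beta> \<le> m + h / \<beta>" if "0 < \<beta>" for \<beta>
    using lo_up that by blast+
  have approx: "\<exists>\<beta>>0. h / \<beta> < e \<and> (\<forall>x\<in>S. \<bar>\<phi> \<beta> x / \<beta> - V x\<bar> < e)" if e: "0 < e" for e
  proof -
    have "eventually (\<lambda>n. \<forall>x\<in>S. dist (\<phi> (\<beta>s n) x / \<beta>s n) (V x) < e) sequentially"
      by (rule uniform_limitD[OF V_lim e])
    moreover have "eventually (\<lambda>n. h / e < \<beta>s n) sequentially"
      using \<beta>s_lim unfolding filterlim_at_top_dense by blast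
    ultimately have "eventually (\<lambda>n. (\<forall>x\<in>S. dist (\<phi> (\<beta>s n) x / \<beta>s n) (V x) < e) \<and> h / e < \<beta>s n) sequentially"
      by (rule eventually_conj)
    then obtain n where n: "\<forall>x\<in>S. dist (\<phi> (\<beta>s n) x / \<beta>s n) (V x) < e" "h / e < \<beta>s n"
      using eventually_happens'[OF sequentially_bot] by blast
    have "h / \<beta>s n < e" using n(2) e \<beta>s_pos[of n] by (simp add: field_simps)
    then show ?thesis using n(1) \<beta>s_pos[of n] by (intro exI[of _ "\<beta>s n"]) (simp add: dist_real_def)
  qed
  have close: "\<bar>(\<integral>x. \<phi> \<beta> x \<partial>\<mu>) / \<beta> - (\<integral>x. V x \<partial>\<mu>)\<bar> \<le> e"
    if \<beta>: "0 < \<beta>" and c: "\<forall>x\<in>S. \<bar>\<phi> \<beta> x / \<beta> - V x\<bar> < e" and \<mu>: "\<mu> \<in> invariant_measures r M" for \<beta> e \<mu>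
  proof -
    have int: "integrable \<mu> (\<lambda>x. \<phi> \<beta> x / \<beta>)" using integrable_\<phi>[OF \<beta> \<mu>] by simp
    have "(\<integral>x. \<phi> \<beta> x / \<beta> - V x \<partial>\<mu>) \<le> e" "(\<integral>x. V x - \<phi> \<beta> x / \<beta> \<partial>\<mu>) \<le> e"
      by (rule integral_bounds[OF \<mu>]; use int integrable_V[OF \<mu>] c in \<open>fastforce simp: abs_less_iff\<close>)+
    then show ?thesis using int integrable_V[OF \<mu>] by simp
  qed
  show ?thesis
  proof (rule that[OF lim]; intro ballI allI impI)
    fix y \<mu> assume y: "y \<in> S" and \<mu>: "\<mu> \<in> invariant_measures r M"
    show "(\<integral>x. A0 y x \<partial>\<mu>) + (\<integral>x. V x \<partial>\<mu>) \<le> V y + m"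
    proof (rule field_le_epsilon)
      fix e :: real assume "0 < e"
      then have e: "0 < e / 3" by simp
      obtain \<beta> where \<beta>: "0 < \<beta>" "h / \<beta> < e / 3" and c: "\<forall>x\<in>S. \<bar>\<phi> \<beta> x / \<beta> - V x\<bar> < e / 3"
        using approx[OF e] by blast
      have "(\<beta> * (\<integral>x. A0 y x \<partial>\<mu>) + (\<integral>x. \<phi> \<beta> x \<partial>\<mu>)) / \<beta> \<le> (\<phi> \<beta> y + lam \<beta>) / \<beta>"
        using effective_integral_le[OF \<beta>(1) y \<mu>] \<beta>(1) by (intro divide_right_mono) simp_all
      then have "(\<integral>x. A0 y x \<partial>\<mu>) + (\<integral>x. \<phi> \<beta> x \<partial>\<mu>) / \<beta> \<le> \<phi> \<beta> y / \<beta> + lam \<beta> / \<beta>"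
        using \<beta>(1) by (simp add: add_divide_distrib)
      moreover have "\<bar>\<phi> \<beta> y / \<beta> - V y\<bar> < e / 3" using c y by blast
      ultimately show "(\<integral>x. A0 y x \<partial>\<mu>) + (\<integral>x. V x \<partial>\<mu>) \<le> V y + m + e"
        using close[OF \<beta>(1) c \<mu>] up[OF \<beta>(1)] \<beta>(2) by linarith
    qed
  next
    fix y and e :: real assume y: "y \<in> S" and "0 < e"
    then have e: "0 < e / 4" by simp
    obtain \<beta> where \<beta>: "0 < \<beta>" "h / \<beta> < e / 4" and c: "\<forall>x\<in>S. \<bar>\<phi> \<beta> x / \<beta> - V x\<bar> < e / 4"
      using approx[OF e] by blast
    obtain \<mu> where \<mu>: "\<mu> \<in> invariant_measures r M"
      and ge: "\<phi> \<beta> y + lam \<beta> - \<beta> * (e / 4) - h < \<beta> * (\<integral>x. A0 y x \<partial>\<mu>) + (\<integral>x. \<phi> \<beta> x \<partial>\<mu>)"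
      using effective_integral_ge[OF \<beta>(1) y mult_pos_pos[OF \<beta>(1) e] ent[rule_format]] by blast
    have "(\<phi> \<beta> y + lam \<beta> - \<beta> * (e / 4) - h) / \<beta> < (\<beta> * (\<integral>x. A0 y x \<partial>\<mu>) + (\<integral>x. \<phi> \<beta> x \<partial>\<mu>)) / \<beta>"
      using ge \<beta>(1) by (rule divide_strict_right_mono)
    then have "\<phi> \<beta> y / \<beta> + lam \<beta> / \<beta> - e / 4 - h / \<beta> < (\<integral>x. A0 y x \<partial>\<mu>) + (\<integral>x. \<phi> \<beta> x \<partial>\<mu>) / \<beta>"
      using \<beta>(1) by (simp add: diff_divide_distrib add_divide_distrib)
    moreover have "\<bar>\<phi> \<beta> y / \<beta> - V y\<bar> < e / 4" using c y by blast
    ultimately have "V y + m - e < (\<integral>x. A0 y x \<partial>\<mu>) + (\<integral>x. V x \<partial>\<mu>)"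
      using close[OF \<beta>(1) c \<mu>] lo[OF \<beta>(1)] \<beta>(2) by linarith
    then show "\<exists>\<mu>\<in>invariant_measures r M. V y + m - e < (\<integral>x. A0 y x \<partial>\<mu>) + (\<integral>x. V x \<partial>\<mu>)"
      using \<mu> by blast
  qed
qed

end

section \<open>Measures with equal marginals\<close>

context subshift_system
begin

lemma equal_marginalD:
  assumes "\<eta> \<in> equal_marginal_measures r M"
  shows "prob_space \<eta>" "sets \<eta> = sets (restrict_space borel (two_sided_subshift r M))"
    "space \<eta> = two_sided_subshift r M"
    "distr \<eta> (restrict_space borel S) snd = distr \<eta> (restrict_space borel S) fst"
proof -
  show "prob_space \<eta>" and sets: "sets \<eta> = sets (restrict_space borel (two_sided_subshift r M))"
    and "distr \<eta> (restrict_space borel S) snd = distr \<eta> (restrict_space borel S) fst"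
    using assms unfolding equal_marginal_measures_def dual_eq by blast+
  show "space \<eta> = two_sided_subshift r M"
    using sets_eq_imp_space_eq[OF sets] by (simp add: space_restrict_space)
qed

lemma two_sided_subset: "two_sided_subshift r M \<subseteq> S \<times> S"
  unfolding two_sided_subshift_def dual_eq by auto

lemma measurable_projections:
  "fst \<in> measurable (restrict_space borel (two_sided_subshift r M)) (restrict_space borel S)"
  "snd \<in> measurable (restrict_space borel (two_sided_subshift r M)) (restrict_space borel S)"
  by (intro measurable_restrict_space2 borel_measurable_continuous_on_restrict
      continuous_on_fst continuous_on_snd continuous_on_id;
      use two_sided_subset in \<open>auto simp: space_restrict_space\<close>)+

lemma equal_marginal_integral:
  fixes v :: "(nat \<Rightarrow> nat) \<Rightarrow> real"
  assumes \<eta>: "\<eta> \<in> equal_marginal_measures r M" and v: "v \<in> lipschitz_functions r M \<Lambda>"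
  shows "integrable \<eta> (\<lambda>p. v (fst p))" "integrable \<eta> (\<lambda>p. v (snd p))"
    "(\<integral>p. v (fst p) \<partial>\<eta>) = (\<integral>p. v (snd p) \<partial>\<eta>)"
proof -
  interpret prob_space \<eta> by (rule equal_marginalD(1)[OF \<eta>])
  note sets = equal_marginalD(2)[OF \<eta>] and space = equal_marginalD(3)[OF \<eta>]
  obtain B where B: "0 \<le> B" "\<And>x y. x \<in> S \<Longrightarrow> y \<in> S \<Longrightarrow> \<bar>v x - v y\<bar> \<le> B * d x y"
    using lipschitz_functionsE[OF v] by blast
  have vm: "v \<in> borel_measurable (restrict_space borel S)"
    by (intro borel_measurable_continuous_on_restrict continuous_on_seq_dist_lipschitz[OF \<Lambda>_pos \<Lambda>_less B(2)])
  have m: "fst \<in> measurable \<eta> (restrict_space borel S)" "snd \<in> measurable \<eta> (restrict_space borel S)"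
    unfolding measurable_cong_sets[OF sets refl] by (rule measurable_projections)+
  obtain p where "p \<in> space \<eta>" using not_empty by blast
  then have z: "fst p \<in> S" using two_sided_subset space by auto
  have bnd: "norm (v x) \<le> \<bar>v (fst p)\<bar> + B" if x: "x \<in> S" for x
  proof -
    have "\<bar>v x - v (fst p)\<bar> \<le> B * d x (fst p)" by (rule B(2)[OF x z])
    moreover have "B * d x (fst p) \<le> B * 1" by (intro mult_left_mono d_le_1 B(1))
    ultimately show ?thesis unfolding real_norm_def by linarith
  qed
  have inS: "fst q \<in> S" "snd q \<in> S" if "q \<in> space \<eta>" for q
    using that two_sided_subset unfolding space by auto
  show "integrable \<eta> (\<lambda>p. v (fst p))"
    by (rule integrable_const_bound[OF AE_I2[OF bnd[OF inS(1)]] measurable_compose[OF m(1) vm]])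
  show "integrable \<eta> (\<lambda>p. v (snd p))"
    by (rule integrable_const_bound[OF AE_I2[OF bnd[OF inS(2)]] measurable_compose[OF m(2) vm]])
  have "(\<integral>p. v (fst p) \<partial>\<eta>) = (\<integral>x. v x \<partial>distr \<eta> (restrict_space borel S) fst)"
    by (rule integral_distr[OF m(1) vm, symmetric])
  also have "\<dots> = (\<integral>x. v x \<partial>distr \<eta> (restrict_space borel S) snd)"
    unfolding equal_marginalD(4)[OF \<eta>] ..
  also have "\<dots> = (\<integral>p. v (snd p) \<partial>\<eta>)" by (rule integral_distr[OF m(2) vm])
  finally show "(\<integral>p. v (fst p) \<partial>\<eta>) = (\<integral>p. v (snd p) \<partial>\<eta>)" .
qed

end

context effective_system
begin

text \<open>The marginals of the image of \<open>\<nu>\<close> under \<open>x \<mapsto> (\<sigma> x, x)\<close> are \<open>\<sigma>\<^sub>*\<nu>\<close> and \<open>\<nu>\<close>.\<close>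

lemma graph_measure_equal_marginals:
  assumes \<nu>: "prob_space \<nu>" "sets \<nu> = sets borel" "distr \<nu> borel \<sigma> = \<nu>" and AE: "AE x in \<nu>. x \<in> S"
  obtains g where "g \<in> measurable \<nu> (restrict_space borel (two_sided_subshift r M))"
    "\<forall>x\<in>S. g x = (\<sigma> x, x)"
    "distr \<nu> (restrict_space borel (two_sided_subshift r M)) g \<in> equal_marginal_measures r M"
proof -
  interpret prob_space \<nu> by (rule \<nu>(1))
  note [measurable_cong] = \<nu>(2)
  let ?T = "two_sided_subshift r M"
  let ?RT = "restrict_space borel ?T" and ?R = "restrict_space borel S"
  obtain s where s: "s \<in> S" using S_nonempty by blast
  \<comment> \<open>The value off the subshift, a null set, only keeps g inside the two-sided space.\<close>
  define g where "g x = (if x \<in> S then (\<sigma> x, x) else (\<sigma> s, s))" for x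
  have gT: "g x \<in> ?T" for x
    using shift_pair_in_two_sided[OF s] shift_pair_in_two_sided[of x] by (simp add: g_def)
  have "g \<in> borel_measurable borel"
    unfolding g_def
    by (intro borel_measurable_continuous_on_if S_sets continuous_on_Pair continuous_shift_map
        continuous_on_id continuous_on_const)
  then have g: "g \<in> measurable \<nu> ?RT"
    unfolding measurable_cong_sets[OF \<nu>(2) refl] using gT by (intro measurable_restrict_space2) auto
  define \<eta> where "\<eta> = distr \<nu> ?RT g"
  have sets: "sets \<eta> = sets ?RT" by (simp add: \<eta>_def)
  have fg: "(\<lambda>x. fst (g x)) \<in> measurable \<nu> ?R" "(\<lambda>x. snd (g x)) \<in> measurable \<nu> ?R"
    by (rule measurable_compose[OF g measurable_projections(1)])
       (rule measurable_compose[OF g measurable_projections(2)])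
  have "distr \<eta> ?R snd = distr \<nu> ?R (\<lambda>x. snd (g x))"
    unfolding \<eta>_def by (simp add: distr_distr[OF measurable_projections(2) g] comp_def)
  moreover have "distr \<eta> ?R fst = distr \<nu> ?R (\<lambda>x. fst (g x))"
    unfolding \<eta>_def by (simp add: distr_distr[OF measurable_projections(1) g] comp_def)
  moreover have "distr \<nu> ?R (\<lambda>x. snd (g x)) = distr \<nu> ?R (\<lambda>x. fst (g x))"
  proof (rule measure_eqI)
    fix B assume "B \<in> sets (distr \<nu> ?R (\<lambda>x. snd (g x)))"
    then have B: "B \<in> sets ?R" by simp
    then have B': "B \<in> sets borel" "B \<subseteq> S"
      using S_sets by (simp_all add: sets_restrict_space_iff)
    have 1: "emeasure (distr \<nu> ?R (\<lambda>x. snd (g x))) B = emeasure \<nu> B"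
    proof -
      have "emeasure (distr \<nu> ?R (\<lambda>x. snd (g x))) B = emeasure \<nu> ((\<lambda>x. snd (g x)) -` B \<inter> space \<nu>)"
        by (rule emeasure_distr[OF fg(2) B])
      also have "\<dots> = emeasure \<nu> B"
      proof (rule emeasure_eq_AE)
        show "AE x in \<nu>. (x \<in> (\<lambda>x. snd (g x)) -` B \<inter> space \<nu>) = (x \<in> B)"
          using AE AE_space by eventually_elim (simp add: g_def)
      qed (use measurable_sets[OF fg(2) B] B' \<nu>(2) in simp_all)
      finally show ?thesis .
    qed
    have 2: "emeasure (distr \<nu> ?R (\<lambda>x. fst (g x))) B = emeasure \<nu> (\<sigma> -` B \<inter> space \<nu>)"
    proof -
      have "emeasure (distr \<nu> ?R (\<lambda>x. fst (g x))) B = emeasure \<nu> ((\<lambda>x. fst (g x)) -` B \<inter> space \<nu>)"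
        by (rule emeasure_distr[OF fg(1) B])
      also have "\<dots> = emeasure \<nu> (\<sigma> -` B \<inter> space \<nu>)"
      proof (rule emeasure_eq_AE)
        show "AE x in \<nu>. (x \<in> (\<lambda>x. fst (g x)) -` B \<inter> space \<nu>) = (x \<in> \<sigma> -` B \<inter> space \<nu>)"
          using AE by eventually_elim (simp add: g_def)
        show "\<sigma> -` B \<inter> space \<nu> \<in> sets \<nu>" using B'(1) by measurable
      qed (use measurable_sets[OF fg(1) B] in simp)
      finally show ?thesis .
    qed
    have "emeasure \<nu> (\<sigma> -` B \<inter> space \<nu>) = emeasure (distr \<nu> borel \<sigma>) B"
      by (rule emeasure_distr[symmetric, OF _ B'(1)]) measurable
    then show "emeasure (distr \<nu> ?R (\<lambda>x. snd (g x))) B = emeasure (distr \<nu> ?R (\<lambda>x. fst (g x))) B"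
      unfolding 1 2 \<nu>(3) by simp
  qed simp
  ultimately have "\<eta> \<in> equal_marginal_measures r M"
    unfolding equal_marginal_measures_def dual_eq
    using prob_space_distr[OF g] sets by (simp add: \<eta>_def)
  then show ?thesis using g unfolding \<eta>_def by (rule that[rotated 2]) (simp add: g_def)
qed

end

context zero_temperature_limit
begin

lemma A_continuous: "continuous_on (two_sided_subshift r M) A"
  using Lipschitz_continuous_imp_continuous_map[OF A_lipschitz]
  unfolding pair_dist_topology[OF \<Lambda>_pos \<Lambda>_less] mtopology_of_euclidean continuous_map_iff_continuous .

text \<open>The maximal sub-actions of the potentials \<open>f\<^sub>y\<close> form the required family. The supremum is attained
by the image of an invariant measure on the tight points.\<close>

lemma dual_formula:
  "\<exists>U :: (nat \<Rightarrow> nat) \<Rightarrow> (nat \<Rightarrow> nat) \<Rightarrow> real.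
    (\<forall>y\<in>dual_subshift r M. sub_action r M \<Lambda> (\<lambda>x. zero_ext M A y x + V x - V y) (U y)) \<and>
    bounded ((\<lambda>(y, x). A (y, x) + U y x - U y (shift_map x)) ` two_sided_subshift r M) \<and>
    (\<lambda>(y, x). A (y, x) + U y x - U y (shift_map x))
       \<in> borel_measurable (restrict_space borel (two_sided_subshift r M)) \<and>
    ((\<lambda>\<beta>. lam \<beta> / \<beta>) \<longlongrightarrow>
       (SUP \<eta>\<in>equal_marginal_measures r M.
          \<integral>(y, x). A (y, x) + U y x - U y (shift_map x) \<partial>\<eta>)) at_top"
proof -
  let ?T = "two_sided_subshift r M"
  let ?RT = "restrict_space borel ?T"
  obtain m where lim: "((\<lambda>\<beta>. lam \<beta> / \<beta>) \<longlongrightarrow> m) at_top"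
    and le: "\<forall>y\<in>S. \<forall>\<mu>\<in>invariant_measures r M. (\<integral>x. A0 y x \<partial>\<mu>) + (\<integral>x. V x \<partial>\<mu>) \<le> V y + m"
    and ge: "\<forall>y\<in>S. \<forall>e>0. \<exists>\<mu>\<in>invariant_measures r M. V y + m - e < (\<integral>x. A0 y x \<partial>\<mu>) + (\<integral>x. V x \<partial>\<mu>)"
    by (rule limit_equation)
  define F where "F y x = A0 y x + V x - V y" for y x
  have intF: "(\<integral>x. F y x \<partial>\<mu>) = (\<integral>x. A0 y x \<partial>\<mu>) + (\<integral>x. V x \<partial>\<mu>) - V y"
    if y: "y \<in> S" and \<mu>: "\<mu> \<in> invariant_measures r M" for y \<mu>
  proof -
    interpret prob_space \<mu> by (rule invariant_measureD(1)[OF \<mu>])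
    show ?thesis
      unfolding F_def using integrable_A0[OF y \<mu>] integrable_V[OF \<mu>] by (simp add: prob_space)
  qed
  have F_lip: "\<bar>F y x - F y x'\<bar> \<le> 2 * A_const * d x x'" if "y \<in> S" "x \<in> S" "x' \<in> S" for y x x'
    using A_const_snd[OF that] V_lip[OF that(2,3)] unfolding F_def by linarith
  have F_param: "\<bar>F y x - F y' x\<bar> \<le> 2 * A_const * d y y'" if "y \<in> S" "y' \<in> S" "x \<in> S" for y y' x
    using A_const_fst[OF that] V_lip[OF that(1,2)] unfolding F_def by linarith
  have crit: "critical_potential r M \<Lambda> (F y) m (2 * A_const)" if y: "y \<in> S" for y
  proof (intro critical_potential.intro subshift_system_axioms critical_potential_axioms.intro)
    show "0 \<le> 2 * A_const" using A_const_nonneg by simp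
    show "\<bar>F y x - F y x'\<bar> \<le> 2 * A_const * d x x'" if "x \<in> S" "x' \<in> S" for x x'
      by (rule F_lip[OF y that])
    show "(\<integral>x. F y x \<partial>\<mu>) \<le> m" if "\<mu> \<in> invariant_measures r M" for \<mu>
      using le[rule_format, OF y that] unfolding intF[OF y that] by linarith
    show "\<exists>\<mu>\<in>invariant_measures r M. m - e < (\<integral>x. F y x \<partial>\<mu>)" if e: "0 < e" for e
    proof -
      obtain \<mu> where \<mu>: "\<mu> \<in> invariant_measures r M"
        and "V y + m - e < (\<integral>x. A0 y x \<partial>\<mu>) + (\<integral>x. V x \<partial>\<mu>)"
        using ge y e by blast
      then have "m - e < (\<integral>x. F y x \<partial>\<mu>)" unfolding intF[OF y \<mu>] by linarith
      with \<mu> show ?thesis by blast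
    qed
  qed
  interpret cf: critical_family r M \<Lambda> F m "2 * A_const"
    by (intro critical_family.intro subshift_system_axioms critical_family_axioms.intro crit F_param S_nonempty)
  define U where "U = cf.maximal_subaction"
  define G where "G = (\<lambda>(y, x). A (y, x) + U y x - U y (\<sigma> x))"
  obtain C where C: "0 \<le> C" "\<And>y x. y \<in> S \<Longrightarrow> x \<in> S \<Longrightarrow> \<bar>U y x\<bar> \<le> C"
    using cf.maximal_subaction_bounded unfolding U_def by blast
  have SUP_eq: "(SUP \<mu>\<in>invariant_measures r M. \<integral>x. F y x \<partial>\<mu>) = m" if y: "y \<in> S" for y
  proof (rule antisym)
    interpret cp: critical_potential r M \<Lambda> "F y" m "2 * A_const" by (rule crit[OF y])
    have ne: "invariant_measures r M \<noteq> {}" using cp.integral_approx[of 1] by auto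
    show "(SUP \<mu>\<in>invariant_measures r M. \<integral>x. F y x \<partial>\<mu>) \<le> m"
      by (rule cSUP_least[OF ne cp.integral_le])
    have bdd: "bdd_above ((\<lambda>\<mu>. \<integral>x. F y x \<partial>\<mu>) ` invariant_measures r M)"
      by (rule bdd_aboveI2[OF cp.integral_le])
    show "m \<le> (SUP \<mu>\<in>invariant_measures r M. \<integral>x. F y x \<partial>\<mu>)"
    proof (rule field_le_epsilon)
      fix e :: real assume "0 < e"
      then obtain \<mu> where \<mu>: "\<mu> \<in> invariant_measures r M" "m - e < (\<integral>x. F y x \<partial>\<mu>)"
        using cp.integral_approx by blast
      have "(\<integral>x. F y x \<partial>\<mu>) \<le> (SUP \<mu>\<in>invariant_measures r M. \<integral>x. F y x \<partial>\<mu>)"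
        by (rule cSUP_upper[OF \<mu>(1) bdd])
      then show "m \<le> (SUP \<mu>\<in>invariant_measures r M. \<integral>x. F y x \<partial>\<mu>) + e" using \<mu>(2) by linarith
    qed
  qed
  have sub: "sub_action r M \<Lambda> (F y) (U y)" if y: "y \<in> S" for y
  proof -
    have "F y \<in> lipschitz_functions r M \<Lambda>" unfolding lipschitz_functions_iff using F_lip[OF y] by blast
    moreover obtain B where "\<And>y x x'. y \<in> S \<Longrightarrow> x \<in> S \<Longrightarrow> x' \<in> S \<Longrightarrow> \<bar>U y x - U y x'\<bar> \<le> B * d x x'"
      using cf.maximal_subaction_lipschitz unfolding U_def by blast
    then have "U y \<in> lipschitz_functions r M \<Lambda>" unfolding lipschitz_functions_iff using y by blast
    moreover have "F y x + U y x - U y (\<sigma> x) \<le> m" if "x \<in> S" for x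
      using cf.maximal_subaction_is_subaction[OF y that] unfolding U_def by linarith
    ultimately show ?thesis unfolding sub_action_def SUP_eq[OF y] by blast
  qed
  have G_bounded: "\<bar>G p\<bar> \<le> A_const + 2 * C" if "p \<in> ?T" for p
  proof -
    obtain y x where p: "p = (y, x)" by (cases p)
    have yx: "y \<in> S" "x \<in> S" "\<sigma> x \<in> S" using that shift_in_S unfolding p in_two_sided by blast+
    show ?thesis
      using A_const_bound[OF that] C(2)[OF yx(1,2)] C(2)[OF yx(1,3)] unfolding G_def p by simp
  qed
  have G_meas: "G \<in> borel_measurable ?RT"
  proof -
    have joint: "(\<lambda>p. U (fst p) (snd p)) \<in> borel_measurable (restrict_space borel (S \<times> S))"
      using cf.maximal_subaction_measurable unfolding U_def by (simp only: case_prod_beta')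
    have "(\<lambda>p. p) \<in> measurable ?RT (restrict_space borel (S \<times> S))"
      using two_sided_subset
      by (intro measurable_restrict_space2 borel_measurable_continuous_on_restrict continuous_on_id)
        (auto simp: space_restrict_space)
    from measurable_compose[OF this joint]
    have 1: "(\<lambda>p. U (fst p) (snd p)) \<in> borel_measurable ?RT" .
    have "(\<lambda>p. (fst p, \<sigma> (snd p))) \<in> measurable ?RT (restrict_space borel (S \<times> S))"
    proof (intro measurable_restrict_space2 borel_measurable_continuous_on_restrict)
      show "(\<lambda>p. (fst p, \<sigma> (snd p))) \<in> space ?RT \<rightarrow> S \<times> S"
        using two_sided_subset shift_in_S by (auto simp: space_restrict_space)
      show "continuous_on ?T (\<lambda>p. (fst p, \<sigma> (snd p)))"
        by (intro continuous_on_Pair continuous_on_fst continuous_on_id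
            continuous_on_compose2[OF continuous_shift_map[of UNIV]] continuous_on_snd) simp
    qed
    from measurable_compose[OF this joint]
    have 2: "(\<lambda>p. U (fst p) (\<sigma> (snd p))) \<in> borel_measurable ?RT" by simp
    have "A \<in> borel_measurable ?RT" by (rule borel_measurable_continuous_on_restrict[OF A_continuous])
    from borel_measurable_diff[OF borel_measurable_add[OF this 1] 2]
    show ?thesis by (simp add: G_def case_prod_beta')
  qed
  have G_le: "G p \<le> m + V (fst p) - V (snd p)" if "p \<in> ?T" for p
  proof -
    obtain y x where p: "p = (y, x)" by (cases p)
    have yx: "y \<in> S" "x \<in> S" using that unfolding p in_two_sided by blast+
    have "F y x - m + U y x \<le> U y (\<sigma> x)" using cf.maximal_subaction_is_subaction[OF yx] unfolding U_def .
    then show ?thesis using A0_eq[OF that[unfolded p]] unfolding F_def G_def p by simp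
  qed
  have G_tight: "G (\<sigma> x, x) = m + V (\<sigma> x) - V x" if x: "x \<in> cf.tight_points" for x
  proof -
    have xS: "x \<in> S" and t: "m \<le> F (\<sigma> x) x + U (\<sigma> x) x"
      using x unfolding cf.tight_points_def U_def by blast+
    have "U (\<sigma> x) (\<sigma> x) = 0" unfolding U_def by (rule cf.maximal_subaction_self[OF shift_in_S[OF xS]])
    then have "m + V (\<sigma> x) - V x \<le> G (\<sigma> x, x)"
      using t A0_eq[OF shift_pair_in_two_sided[OF xS]] unfolding F_def G_def by simp
    then show ?thesis using G_le[OF shift_pair_in_two_sided[OF xS]] by simp
  qed
  have upper: "(\<integral>p. G p \<partial>\<eta>) \<le> m" if \<eta>: "\<eta> \<in> equal_marginal_measures r M" for \<eta>
  proof -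
    interpret prob_space \<eta> by (rule equal_marginalD(1)[OF \<eta>])
    note Vint = equal_marginal_integral[OF \<eta> V_lipschitz]
    have "integrable \<eta> G"
    proof (rule integrable_const_bound)
      show "AE p in \<eta>. norm (G p) \<le> A_const + 2 * C"
        by (rule AE_I2) (use G_bounded equal_marginalD(3)[OF \<eta>] in simp)
      show "G \<in> borel_measurable \<eta>"
        using G_meas unfolding measurable_cong_sets[OF equal_marginalD(2)[OF \<eta>] refl] .
    qed
    then have "(\<integral>p. G p \<partial>\<eta>) \<le> (\<integral>p. m + V (fst p) - V (snd p) \<partial>\<eta>)"
      by (rule integral_mono) (use Vint G_le equal_marginalD(3)[OF \<eta>] in simp_all)
    also have "\<dots> = m" using Vint by (simp add: prob_space)
    finally show ?thesis .
  qed
  obtain \<nu> where \<nu>: "prob_space \<nu>" "sets \<nu> = sets borel" "distr \<nu> borel \<sigma> = \<nu>"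
    and tight: "AE x in \<nu>. x \<in> cf.tight_points"
    by (rule cf.tight_invariant_measure)
  have AES: "AE x in \<nu>. x \<in> S"
    using tight by eventually_elim (simp add: cf.tight_points_def)
  obtain g where g: "g \<in> measurable \<nu> ?RT" "\<forall>x\<in>S. g x = (\<sigma> x, x)"
    and \<eta>: "distr \<nu> ?RT g \<in> equal_marginal_measures r M"
    by (rule graph_measure_equal_marginals[OF \<nu> AES])
  have attained: "(\<integral>p. G p \<partial>distr \<nu> ?RT g) = m"
  proof -
    let ?\<eta> = "distr \<nu> ?RT g"
    interpret \<nu>: prob_space \<nu> by (rule \<nu>(1))
    interpret \<eta>: prob_space ?\<eta> by (rule equal_marginalD(1)[OF \<eta>])
    note Vint = equal_marginal_integral[OF \<eta> V_lipschitz]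
    let ?H = "\<lambda>p. m + V (fst p) - V (snd p)"
    have Hm: "?H \<in> borel_measurable ?RT"
    proof -
      have "?H \<in> borel_measurable ?\<eta>"
        using borel_measurable_integrable[OF Vint(1)] borel_measurable_integrable[OF Vint(2)]
        by (intro borel_measurable_diff borel_measurable_add borel_measurable_const)
      then show ?thesis unfolding measurable_distr_eq1 .
    qed
    have "(\<integral>p. G p \<partial>?\<eta>) = (\<integral>x. G (g x) \<partial>\<nu>)" by (rule integral_distr[OF g(1) G_meas])
    also have "\<dots> = (\<integral>x. ?H (g x) \<partial>\<nu>)"
    proof (rule integral_cong_AE)
      show "AE x in \<nu>. G (g x) = ?H (g x)"
        using tight AES by eventually_elim (simp add: g(2) G_tight)
    qed (rule measurable_compose[OF g(1) G_meas], rule measurable_compose[OF g(1) Hm])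
    also have "\<dots> = (\<integral>p. ?H p \<partial>?\<eta>)" by (rule integral_distr[OF g(1) Hm, symmetric])
    also have "\<dots> = m" using Vint \<eta>.prob_space by simp
    finally show ?thesis .
  qed
  have SUP_m: "(SUP \<eta>\<in>equal_marginal_measures r M. \<integral>p. G p \<partial>\<eta>) = m"
    by (rule cSup_eq_maximum) (use attained \<eta> upper in blast)+
  have "bounded (G ` ?T)"
    unfolding bounded_iff using G_bounded by (intro exI[of _ "A_const + 2 * C"]) simp
  moreover have "\<forall>y\<in>dual_subshift r M. sub_action r M \<Lambda> (\<lambda>x. A0 y x + V x - V y) (U y)"
    unfolding dual_eq using sub unfolding F_def by blast
  moreover have "((\<lambda>\<beta>. lam \<beta> / \<beta>) \<longlongrightarrow> (SUP \<eta>\<in>equal_marginal_measures r M. \<integral>p. G p \<partial>\<eta>)) at_top"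
    unfolding SUP_m by (rule lim)
  ultimately show ?thesis using G_meas unfolding G_def by blast
qed

end

theorem theorem7:
  fixes r :: nat and M :: "nat \<Rightarrow> nat \<Rightarrow> nat" and \<Lambda> :: real
    and A :: "(nat \<Rightarrow> nat) \<times> (nat \<Rightarrow> nat) \<Rightarrow> real"
    and \<phi> :: "real \<Rightarrow> (nat \<Rightarrow> nat) \<Rightarrow> real" and lam :: "real \<Rightarrow> real"
    and y0 :: "nat \<Rightarrow> nat" and \<beta>s :: "nat \<Rightarrow> real" and V :: "(nat \<Rightarrow> nat) \<Rightarrow> real"
  assumes "transition_matrix r M" and "symmetric_matrix r M" and "irreducible_matrix r M"
    and "0 < \<Lambda>" and "\<Lambda> < 1"
    and "Lipschitz_continuous_map (metric (two_sided_subshift r M, pair_dist \<Lambda>)) euclidean_metric A"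
    and "y0 \<in> dual_subshift r M"
    and "\<And>\<beta>. \<beta> > 0 \<Longrightarrow> effective_potential r M \<Lambda> (\<lambda>p. \<beta> * A p) (\<phi> \<beta>) (lam \<beta>)"
    and "\<And>\<beta>. \<beta> > 0 \<Longrightarrow> \<phi> \<beta> y0 = 0"
    and "\<And>n. \<beta>s n > 0" and "filterlim \<beta>s at_top sequentially"
    and "uniform_limit (dual_subshift r M) (\<lambda>n y. \<phi> (\<beta>s n) y / \<beta>s n) V sequentially"
  shows "\<exists>U :: (nat \<Rightarrow> nat) \<Rightarrow> (nat \<Rightarrow> nat) \<Rightarrow> real.
    (\<forall>y\<in>dual_subshift r M. sub_action r M \<Lambda> (\<lambda>x. zero_ext M A y x + V x - V y) (U y)) \<and>
    bounded ((\<lambda>(y, x). A (y, x) + U y x - U y (shift_map x)) ` two_sided_subshift r M) \<and>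
    (\<lambda>(y, x). A (y, x) + U y x - U y (shift_map x))
       \<in> borel_measurable (restrict_space borel (two_sided_subshift r M)) \<and>
    ((\<lambda>\<beta>. lam \<beta> / \<beta>) \<longlongrightarrow>
       (SUP \<eta>\<in>equal_marginal_measures r M.
          \<integral>(y, x). A (y, x) + U y x - U y (shift_map x) \<partial>\<eta>)) at_top"
proof -
  have dual: "dual_subshift r M = subshift r M"
    by (rule dual_subshift_eq_subshift[OF assms(2)])
  interpret zero_temperature_limit r M \<Lambda> A \<phi> lam \<beta>s V
  proof
    show "subshift r M \<noteq> {}" using assms(7) unfolding dual by blast
    show "uniform_limit (subshift r M) (\<lambda>n y. \<phi> (\<beta>s n) y / \<beta>s n) V sequentially"
      using assms(12) unfolding dual .
  qed (fact assms)+
  show ?thesis by (rule dual_formula)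
qed

end
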